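(* Let $\alpha,\beta>0$, $\gamma,\delta\ge 0$, $0\le q<1$, and let $A,B,C,D$ be the associated parameters defined in the context. Assume the low density phase $C>A$, $C>1$. Let $\mu_n$ be the stationary measure of open ASEP on $\{1,\dots,n\}$ and, for $1\le m\le n$, let $\mu_{n|m}$ be its marginal on the first $m$ sites $\{1,\dots,m\}$. (i) As $n\to\infty$, $\mu_n$ (regarded as a measure on $\{0,1\}^{\mathbb{Z}_+}$) converges weakly to the product Bernoulli measure on $\{0,1\}^{\mathbb{Z}_+}$ with density $\frac{1}{1+C}$. (ii) Assume furthermore that $A/C\notin\{q^l:l\in\mathbb{Z}_+\}$ if $A\ge 1$. Then there exist $H>0$ depending on $A,B,C,D,q$ and $\theta\in(0,1)$ depending only on $A,C,q$ such that for all $1\le m\le n$, $$d_{TV}\left(\mu_{n|m},\mathrm{Ber}_m\left(\tfrac{1}{1+C}\right)\right)\le \theta^n (Hm)^{3m}.$$ (iii) Under the assumption in (ii), there exists $s>0$ depending only on $A,C,q$ such that for any sequence of integers $\{m_n\}_{n\ge1}$ with $1\le m_n\le n$ for all $n$ and $m_n\le s\frac{n}{\log n}$ for all sufficiently large $n$, $$\lim_{n\to\infty}d_{TV}\left(\mu_{n|m_n},\mathrm{Ber}_{m_n}\left(\tfrac{1}{1+C}\right)\right)=0.$$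
   Context: $\mathbb{Z}_+=\{1,2,\dots\}$. Open ASEP on $\{1,\dots,n\}$ with parameters $\alpha,\beta>0$, $\gamma,\delta\ge0$, $0\le q<1$ is the continuous-time irreducible Markov process on $\{0,1\}^n$ (a state $(\tau_1,\dots,\tau_n)$ records occupations, $\tau_i=1$ meaning that site $i$ is occupied) with the following jumps: a particle at site $i$ jumps to site $i+1$ with rate $1$ and a particle at site $i+1$ jumps to site $i$ with rate $q$ ($1\le i\le n-1$), provided the target site is empty; at site $1$ a particle enters with rate $\alpha$ if the site is empty and exits with rate $\gamma$ if it is occupied; at site $n$ a particle enters with rate $\delta$ if the site is empty and exits with rate $\beta$ if it is occupied. Its unique stationary probability measure on $\{0,1\}^n$ is denoted $\mu_n$. It is regarded as a probability measure on $\{0,1\}^{\mathbb{Z}_+}$ (product topology and product $\sigma$-algebra) by setting $\tau_i=0$ for $i\ge n+1$. Parameters: for $x>0$, $y\ge0$ set $\phi_\pm(x,y)=\frac{1}{2x}\left(1-q-x+y\pm\sqrt{(1-q-x+y)^2+4xy}\right)$, and $A=\phi_+(\beta,\delta)$, $B=\phi_-(\beta,\delta)$, $C=\phi_+(\alpha,\gamma)$, $D=\phi_-(\alpha,\gamma)$. This is a bijection onto $A,C\ge0$, $-1<B,D\le0$ (for fixed $q$). For probability measures $\kappa,\kappa'$ on $\{0,1\}^m$, $d_{TV}(\kappa,\kappa')=\frac12\sum_{x\in\{0,1\}^m}|\kappa(x)-\kappa'(x)|$. $\mathrm{Ber}_k(\rho)$ is the law on $\{0,1\}^k$ of $k$ independent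 Bernoulli($\rho$) variables. *)

theory Defs
  imports "HOL-Probability.Probability"
begin

section \<open>Configurations\<close>

text \<open>
  Sites are numbered from 0: the site \<open>i \<in> {1, 2, \<dots>}\<close> of the mathematical text is the
  coordinate \<open>i - 1\<close>. The type \<open>config\<close> carries the product topology of discrete spaces.
  An element of \<open>{0,1}\<^sup>n\<close> is represented by its extension by empty sites, so measures on
  \<open>{0,1}\<^sup>n\<close> are measures on configurations of infinitely many sites from the outset.
\<close>

type_synonym config = "nat \<Rightarrow> bool"

definition configs :: "nat \<Rightarrow> config set" where
  "configs n = {\<tau>. \<forall>i\<ge>n. \<not> \<tau> i}"

definition config_space :: "config measure" where
  "config_space = PiM UNIV (\<lambda>_. count_space UNIV)"


section \<open>Open ASEP\<close>

text \<open>
  The rates are sums over all mechanisms leading from \<open>\<tau>\<close> to \<open>\<tau>'\<close>; for \<open>n = 1\<close> the single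
  site is in contact with both reservoirs and the two boundary rates add up.
\<close>

definition jump_rate ::
  "real \<Rightarrow> real \<Rightarrow> real \<Rightarrow> real \<Rightarrow> real \<Rightarrow> nat \<Rightarrow> config \<Rightarrow> config \<Rightarrow> real" where
  "jump_rate \<alpha> \<beta> \<gamma> \<delta> q n \<tau> \<tau>' =
     (\<Sum>i<n - 1.
        (if \<tau> i \<and> \<not> \<tau> (Suc i) \<and> \<tau>' = \<tau>(i := False, Suc i := True) then 1 else 0)
      + (if \<not> \<tau> i \<and> \<tau> (Suc i) \<and> \<tau>' = \<tau>(i := True, Suc i := False) then q else 0))
   + (if \<not> \<tau> 0 \<and> \<tau>' = \<tau>(0 := True) then \<alpha> else 0)
   + (if \<tau> 0 \<and> \<tau>' = \<tau>(0 := False) then \<gamma> else 0)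
   + (if \<not> \<tau> (n - 1) \<and> \<tau>' = \<tau>(n - 1 := True) then \<delta> else 0)
   + (if \<tau> (n - 1) \<and> \<tau>' = \<tau>(n - 1 := False) then \<beta> else 0)"

definition asep_generator ::
  "real \<Rightarrow> real \<Rightarrow> real \<Rightarrow> real \<Rightarrow> real \<Rightarrow> nat \<Rightarrow> (config \<Rightarrow> real) \<Rightarrow> config \<Rightarrow> real" where
  "asep_generator \<alpha> \<beta> \<gamma> \<delta> q n f \<tau> =
     (\<Sum>\<tau>'\<in>configs n. jump_rate \<alpha> \<beta> \<gamma> \<delta> q n \<tau> \<tau>' * (f \<tau>' - f \<tau>))"

text \<open>The transition semigroup \<open>exp (t L)\<close> of the jump process with generator \<open>L\<close>.\<close>

definition asep_semigroup ::
  "real \<Rightarrow> real \<Rightarrow> real \<Rightarrow> real \<Rightarrow> real \<Rightarrow> nat \<Rightarrow> real \<Rightarrow> (config \<Rightarrow> real) \<Rightarrow> config \<Rightarrow> real" where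
  "asep_semigroup \<alpha> \<beta> \<gamma> \<delta> q n t f \<tau> =
     (\<Sum>k. t ^ k / fact k * (asep_generator \<alpha> \<beta> \<gamma> \<delta> q n ^^ k) f \<tau>)"

definition asep_stationary ::
  "real \<Rightarrow> real \<Rightarrow> real \<Rightarrow> real \<Rightarrow> real \<Rightarrow> nat \<Rightarrow> config pmf \<Rightarrow> bool" where
  "asep_stationary \<alpha> \<beta> \<gamma> \<delta> q n \<mu> \<longleftrightarrow>
     set_pmf \<mu> \<subseteq> configs n \<and>
     (\<forall>t\<ge>0. \<forall>f. measure_pmf.expectation \<mu> (asep_semigroup \<alpha> \<beta> \<gamma> \<delta> q n t f)
                = measure_pmf.expectation \<mu> f)"

definition asep_measure ::
  "real \<Rightarrow> real \<Rightarrow> real \<Rightarrow> real \<Rightarrow> real \<Rightarrow> nat \<Rightarrow> config pmf" where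
  "asep_measure \<alpha> \<beta> \<gamma> \<delta> q n = (THE \<mu>. asep_stationary \<alpha> \<beta> \<gamma> \<delta> q n \<mu>)"

text \<open>Marginal on the first \<open>m\<close> sites, as a measure on \<open>configs m\<close>.\<close>

definition marginal :: "nat \<Rightarrow> config pmf \<Rightarrow> config pmf" where
  "marginal m \<mu> = map_pmf (\<lambda>\<tau> i. i < m \<and> \<tau> i) \<mu>"


section \<open>Parameters\<close>

definition phi_plus :: "real \<Rightarrow> real \<Rightarrow> real \<Rightarrow> real" where
  "phi_plus q x y = (1 - q - x + y + sqrt ((1 - q - x + y)\<^sup>2 + 4 * x * y)) / (2 * x)"

definition phi_minus :: "real \<Rightarrow> real \<Rightarrow> real \<Rightarrow> real" where
  "phi_minus q x y = (1 - q - x + y - sqrt ((1 - q - x + y)\<^sup>2 + 4 * x * y)) / (2 * x)"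

definition asep_params :: "real \<Rightarrow> real \<Rightarrow> real \<Rightarrow> real \<Rightarrow> real \<Rightarrow> bool" where
  "asep_params \<alpha> \<beta> \<gamma> \<delta> q \<longleftrightarrow> \<alpha> > 0 \<and> \<beta> > 0 \<and> \<gamma> \<ge> 0 \<and> \<delta> \<ge> 0 \<and> 0 \<le> q \<and> q < 1"


section \<open>Measures and distances\<close>

definition bernoulli_product :: "nat \<Rightarrow> real \<Rightarrow> config pmf" where
  "bernoulli_product k \<rho> = Pi_pmf {..<k} False (\<lambda>_. bernoulli_pmf \<rho>)"

definition bernoulli_measure :: "real \<Rightarrow> config measure" where
  "bernoulli_measure \<rho> = PiM UNIV (\<lambda>_. measure_pmf (bernoulli_pmf \<rho>))"

text \<open>For measures supported on \<open>configs m\<close>.\<close>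

definition d_TV :: "nat \<Rightarrow> config pmf \<Rightarrow> config pmf \<Rightarrow> real" where
  "d_TV m \<kappa> \<kappa>' = 1 / 2 * (\<Sum>x\<in>configs m. \<bar>pmf \<kappa> x - pmf \<kappa>' x\<bar>)"

text \<open>The discrete measure \<open>\<mu>\<close>, restricted to the product \<open>\<sigma>\<close>-algebra.\<close>

definition config_measure :: "config pmf \<Rightarrow> config measure" where
  "config_measure \<mu> = distr (measure_pmf \<mu>) config_space (\<lambda>\<tau>. \<tau>)"

definition weakly_converges ::
  "(nat \<Rightarrow> 'a::topological_space measure) \<Rightarrow> 'a measure \<Rightarrow> bool" where
  "weakly_converges M N \<longleftrightarrow>
     (\<forall>f :: 'a \<Rightarrow> real. continuous_on UNIV f \<and> bounded (range f) \<longrightarrow>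
        (\<lambda>n. \<integral>x. f x \<partial>M n) \<longlonglongrightarrow> (\<integral>x. f x \<partial>N))"

end

theory Submission
  imports Defs
begin

text \<open>
  Let \<open>x y - q y x = 1 - q\<close> and let the row vector \<open>W\<close> satisfy \<open>W (y + C D x) = (C + D) W\<close>.
  Any \<open>V\<close> with \<open>(x + A B y) V = (A + B) V\<close> turns products of \<open>1 + x\<close> (particle) and \<open>1 + y\<close>
  (hole) between \<open>W\<close> and \<open>V\<close> into weights solving the balance equations. The coordinates
  \<open>\<phi>\<^sub>j = W x\<^sup>j V\<close> obey a three-term recurrence, which is solvable even when
  \<open>A B C D q\<^sup>k = 1\<close>: then the solution starts at \<open>j = k + 1\<close>, and only the weights of small systems
  vanish.

  The Chebyshev coordinates \<open>u\<^sub>k = W U\<^sub>k\<^sub>-\<^sub>1(x + y) V\<close> satisfy a five-term recurrence whose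
  coefficients differ by \<open>O(q\<^sup>k)\<close> from those with characteristic roots \<open>A, B, C, D\<close>. As
  \<open>C\<close> dominates, \<open>u\<^sub>k = K C\<^sup>k + O(r\<^sup>k)\<close> for any \<open>max(1, A, q C) < r < C\<close>. The leading term is
  the one-dimensional representation \<open>x = 1/C\<close>, \<open>y = C\<close>, which yields exactly the Bernoulli
  weights with partition function \<open>\<Lambda>\<^sup>n\<close>, \<open>\<Lambda> = 2 + C + 1/C\<close>; the remainder is
  \<open>O((2 + r + 1/r)\<^sup>n)\<close>.

  The partition function is bounded below by a multiple of \<open>\<Lambda>\<^sup>n\<close> because the weights are
  eventually of one sign (they are stationary for an irreducible chain) and because the weights of
  \<open>1\<^sup>j\<close> dominate a combination of geometric sequences on which \<open>2 + x + y\<close> acts explicitly.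
\<close>

section \<open>The matrix algebra\<close>

text \<open>Treating \<open>W\<close> and \<open>V\<close> as infinite vectors would raise
  convergence questions, so neither is built: a column vector is its coordinate sequence,
  \<open>W\<close> is evaluation at \<open>0\<close>, and every weight is a finite expression.

  Polynomials in \<open>x + y\<close> are the right coordinates because summing out a site applies
  \<open>2 + x + y\<close>, which acts on them by shifts: a growth rate \<open>R\<close> costs
  \<open>2 + R + 1/R\<close> per summed site, and the gap between \<open>r\<close> and
  \<open>c\<close> turns into exponential decay. The operator \<open>x\<close> alone has no
  comparably sharp bound, but it acts only on the \<open>m\<close> observed sites, where any fixed
  operator norm will do; it produces a factor exponential in \<open>m\<close>. Since
  \<open>b\<close> and \<open>d\<close> lie in \<open>(-1, 0]\<close>, only \<open>1\<close>,
  \<open>a\<close> and \<open>q c\<close> restrict \<open>r\<close>, whence a rate depending on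
  \<open>a\<close>, \<open>c\<close>, \<open>q\<close> alone.

  The obstacle is the denominator: the decomposition gives \<open>K \<Lambda>^n\<close> plus a
  remainder but no information on \<open>K\<close>. The lower bound therefore comes from positivity,
  and since the signs of the weights can change finitely often with the system size, positivity is
  available for large systems only.\<close>

locale asep_weights =
  fixes q a b c d :: real
  assumes q: "0 \<le> q" "q < 1"
    and ab: "0 \<le> a" "-1 < b" "b \<le> 0"
    and cd: "1 < c" "-1 < d" "d \<le> 0"
    and ac: "a < c"
begin

text \<open>
  \<open>X\<close> and \<open>Y\<close> are the transposes of right multiplication by \<open>x\<close> and \<open>y\<close> in the basis
  \<open>W x\<^sup>j\<close>: a column vector \<open>V\<close> is represented by \<open>\<phi>\<^sub>j = W x\<^sup>j V\<close>. The junk value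
  \<open>\<phi> (0 - 1)\<close> in \<open>Y\<close> has coefficient \<open>0\<close>.
\<close>

definition X :: "(nat \<Rightarrow> real) \<Rightarrow> nat \<Rightarrow> real" where
  "X \<phi> j = \<phi> (Suc j)"

definition Y :: "(nat \<Rightarrow> real) \<Rightarrow> nat \<Rightarrow> real" where
  "Y \<phi> j = (1 - q ^ j) * \<phi> (j - 1) + q ^ j * (c + d) * \<phi> j - q ^ j * (c * d) * \<phi> (Suc j)"

definition S :: "(nat \<Rightarrow> real) \<Rightarrow> nat \<Rightarrow> real" where
  "S \<phi> j = X \<phi> j + Y \<phi> j"

definition site :: "bool \<Rightarrow> (nat \<Rightarrow> real) \<Rightarrow> nat \<Rightarrow> real" where
  "site s \<phi> j = \<phi> j + (if s then X \<phi> j else Y \<phi> j)"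

definition T :: "(nat \<Rightarrow> real) \<Rightarrow> nat \<Rightarrow> real" where
  "T \<phi> j = site True \<phi> j + site False \<phi> j"

fun word :: "bool list \<Rightarrow> (nat \<Rightarrow> real) \<Rightarrow> nat \<Rightarrow> real" where
  "word [] \<phi> = \<phi>"
| "word (s # w) \<phi> = site s (word w \<phi>)"

definition right_vector :: "(nat \<Rightarrow> real) \<Rightarrow> bool" where
  "right_vector \<phi> \<longleftrightarrow> (\<forall>j. X \<phi> j + a * b * Y \<phi> j = (a + b) * \<phi> j)"

lemma signs: "a * b \<le> 0" "c * d \<le> 0" "0 < c + d" "0 < (1 + a) * (1 + b)" "0 < (1 + c) * (1 + d)"
  "0 \<le> a * b * c * d"
proof -
  show "a * b \<le> 0" using ab by (simp add: mult_nonneg_nonpos)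
  moreover show "c * d \<le> 0" using cd by (simp add: mult_nonneg_nonpos)
  ultimately have "0 \<le> (a * b) * (c * d)" by (rule mult_nonpos_nonpos)
  then show "0 \<le> a * b * c * d" by (simp add: mult.assoc)
qed (use ab cd in auto)

lemma q_power: "0 \<le> q ^ k" "q ^ k \<le> 1"
  using q by (auto intro: power_le_one)

text \<open>\<open>Y\<close> is what \<open>W x^j y V\<close> becomes when \<open>y\<close> is moved
  left through \<open>x^j\<close> and absorbed by \<open>W y = (c + d) W - c d W x\<close>; the
  exchanges leave multiples of \<open>1 - q\<close> that add up to \<open>1 - q ^ j\<close>. Hence
  the relation holds for every sequence.\<close>

lemma XY: "X (Y \<phi>) j - q * Y (X \<phi>) j = (1 - q) * \<phi> j"
  by (cases j) (simp_all add: X_def Y_def algebra_simps)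

lemma Y_0: "Y \<phi> 0 = (c + d) * \<phi> 0 - c * d * X \<phi> 0"
  by (simp add: X_def Y_def)

lemma Y_eq: "Y \<phi> = (\<lambda>j. S \<phi> j - X \<phi> j)"
  by (auto simp: S_def)

lemma X_linear: "X (\<lambda>j. x * \<phi> j + y * \<psi> j) = (\<lambda>j. x * X \<phi> j + y * X \<psi> j)"
  by (auto simp: X_def)

lemma Y_linear: "Y (\<lambda>j. x * \<phi> j + y * \<psi> j) = (\<lambda>j. x * Y \<phi> j + y * Y \<psi> j)"
  by (auto simp: Y_def algebra_simps)

lemma S_linear: "S (\<lambda>j. x * \<phi> j + y * \<psi> j) = (\<lambda>j. x * S \<phi> j + y * S \<psi> j)"
  by (auto simp: S_def X_linear Y_linear algebra_simps)

lemma site_linear: "site s (\<lambda>j. x * \<phi> j + y * \<psi> j) = (\<lambda>j. x * site s \<phi> j + y * site s \<psi> j)"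
  by (auto simp: site_def X_linear Y_linear algebra_simps)

lemma T_linear: "T (\<lambda>j. x * \<phi> j + y * \<psi> j) = (\<lambda>j. x * T \<phi> j + y * T \<psi> j)"
  by (auto simp: T_def site_linear algebra_simps)

lemma T_pow_linear:
  "(T ^^ n) (\<lambda>j. x * \<phi> j + y * \<psi> j) = (\<lambda>j. x * (T ^^ n) \<phi> j + y * (T ^^ n) \<psi> j)"
  by (induction n arbitrary: \<phi> \<psi>) (simp_all add: T_linear)

lemma word_linear:
  "word w (\<lambda>j. x * \<phi> j + y * \<psi> j) = (\<lambda>j. x * word w \<phi> j + y * word w \<psi> j)"
  by (induction w) (simp_all add: site_linear)

lemma T_eq: "T \<phi> = (\<lambda>j. 2 * \<phi> j + S \<phi> j)"
  by (auto simp: T_def site_def S_def)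

lemma word_append: "word (u @ v) \<phi> = word u (word v \<phi>)"
  by (induction u) auto

text \<open>With \<open>D = (1 + x) / (1 - q)\<close> and \<open>E = (1 + y) / (1 - q)\<close> this
  is the bulk relation \<open>D E - q E D = D + E\<close> of the matrix product ansatz. The part of
  degree at most one gives \<open>(1 - q) (1 + x + y)\<close>, and \<open>x y - q y x\<close>
  supplies the missing \<open>1 - q\<close>.\<close>

lemma site_commute:
  "site True (site False \<phi>) = (\<lambda>j. q * site False (site True \<phi>) j + (1 - q) * T \<phi> j)"
proof
  fix j
  have 1: "X (\<lambda>j. \<phi> j + Y \<phi> j) = (\<lambda>j. X \<phi> j + X (Y \<phi>) j)"
    using X_linear[of 1 \<phi> 1 "Y \<phi>"] by simp
  have 2: "Y (\<lambda>j. \<phi> j + X \<phi> j) = (\<lambda>j. Y \<phi> j + Y (X \<phi>) j)"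
    using Y_linear[of 1 \<phi> 1 "X \<phi>"] by simp
  show "site True (site False \<phi>) j = q * site False (site True \<phi>) j + (1 - q) * T \<phi> j"
    using XY[of \<phi> j] by (simp add: site_def[abs_def] 1 2 T_def algebra_simps)
qed

lemma site_left: "site False \<phi> 0 + c * d * site True \<phi> 0 = (1 + c) * (1 + d) * \<phi> 0"
  by (simp add: site_def Y_0 algebra_simps)

lemma site_right:
  assumes "right_vector \<phi>"
  shows "site True \<phi> j + a * b * site False \<phi> j = (1 + a) * (1 + b) * \<phi> j"
  using assms by (simp add: right_vector_def site_def algebra_simps)

text \<open>
  Coordinates with respect to the Chebyshev polynomials of the second kind in \<open>S\<close>:
  the value at \<open>0\<close> of \<open>U\<^sub>k\<^sub>-\<^sub>1(S) \<psi>\<close>.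
\<close>

fun cheb :: "(nat \<Rightarrow> real) \<Rightarrow> nat \<Rightarrow> real" where
  "cheb \<psi> 0 = 0"
| "cheb \<psi> (Suc 0) = \<psi> 0"
| "cheb \<psi> (Suc (Suc k)) = cheb (S \<psi>) (Suc k) - cheb \<psi> k"

text \<open>The odd continuation of the Chebyshev polynomials to negative index, under which the
  three-term recurrence holds at every integer and index \<open>k - 2\<close> needs no case
  distinction.\<close>

definition chebz :: "(nat \<Rightarrow> real) \<Rightarrow> int \<Rightarrow> real" where
  "chebz \<psi> i = (if i \<ge> 0 then cheb \<psi> (nat i) else - cheb \<psi> (nat (- i)))"

lemma cheb_linear: "cheb (\<lambda>j. x * \<phi> j + y * \<psi> j) k = x * cheb \<phi> k + y * cheb \<psi> k"
  by (induction k arbitrary: \<phi> \<psi> rule: induct_nat_012) (simp_all add: S_linear algebra_simps)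

lemma chebz_linear: "chebz (\<lambda>j. x * \<phi> j + y * \<psi> j) i = x * chebz \<phi> i + y * chebz \<psi> i"
  by (simp add: chebz_def cheb_linear)

lemma chebz_minus: "chebz \<psi> (- i) = - chebz \<psi> i"
  by (auto simp: chebz_def)

lemma chebz_S: "chebz (S \<psi>) i = chebz \<psi> (i + 1) + chebz \<psi> (i - 1)"
proof -
  have pos: "chebz (S \<psi>) (int k) = chebz \<psi> (int k + 1) + chebz \<psi> (int k - 1)" for k
  proof (cases k)
    case (Suc m)
    have "nat (2 + int m) = Suc (Suc m)" "nat (1 + int m) = Suc m" by linarith+
    with Suc show ?thesis by (simp add: chebz_def)
  qed (simp add: chebz_def)
  show ?thesis
  proof (cases "i \<ge> 0")
    case True
    then show ?thesis using pos[of "nat i"] by simp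
  next
    case False
    then have "chebz (S \<psi>) (- i) = chebz \<psi> (- i + 1) + chebz \<psi> (- i - 1)"
      using pos[of "nat (- i)"] by simp
    then show ?thesis
      using chebz_minus[of \<psi> "i - 1"] chebz_minus[of \<psi> "i + 1"] chebz_minus[of "S \<psi>" i]
      by simp
  qed
qed

text \<open>
  The two functionals encode a polynomial identity \<open>W g\<^sub>k(x + y) x = W h\<^sub>k(x + y)\<close>, which expresses
  \<open>X\<close> in Chebyshev coordinates. It follows by induction on \<open>k\<close> from the relation between \<open>x\<close>
  and \<open>y\<close>, since \<open>W h\<^sub>k + q W g\<^sub>k y = W g\<^sub>k\<^sub>+\<^sub>1 + q W g\<^sub>k\<^sub>-\<^sub>1\<close>.
\<close>

definition G :: "nat \<Rightarrow> (nat \<Rightarrow> real) \<Rightarrow> real" where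
  "G k \<psi> = (1 - q ^ k * (c * d)) * chebz \<psi> (int k + 1) - (c + d) * (1 - q ^ k) * chebz \<psi> (int k)
           + (c * d - q ^ k) * chebz \<psi> (int k - 1)"

definition H :: "nat \<Rightarrow> (nat \<Rightarrow> real) \<Rightarrow> real" where
  "H k \<psi> = chebz \<psi> (int k + 2) - (c + d) * chebz \<psi> (int k + 1) + c * d * (1 - q ^ k) * chebz \<psi> (int k)
           + q ^ k * (c + d) * chebz \<psi> (int k - 1) - q ^ k * chebz \<psi> (int k - 2)"

lemma G_linear: "G k (\<lambda>j. x * \<phi> j + y * \<psi> j) = x * G k \<phi> + y * G k \<psi>"
  by (simp add: G_def chebz_linear algebra_simps)

lemma H_linear: "H k (\<lambda>j. x * \<phi> j + y * \<psi> j) = x * H k \<phi> + y * H k \<psi>"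
  by (simp add: H_def chebz_linear algebra_simps)

lemma chebz_0: "chebz \<psi> 0 = 0" by (simp add: chebz_def)

lemma chebz_1: "chebz \<psi> 1 = \<psi> 0" by (simp add: chebz_def)

lemma chebz_2: "chebz \<psi> 2 = S \<psi> 0" using chebz_S[of \<psi> 1] by (simp add: chebz_0 chebz_1)

text \<open>\<open>W g_k (x y - q y x) V\<close> is evaluated twice: by the commutation relation,
  and by replacing \<open>y\<close> with \<open>(x + y) - x\<close> and then \<open>W g_k x\<close>
  with \<open>W h_k\<close>.\<close>

lemma G_X_step:
  assumes "G k (X (Y \<psi>)) = H k (Y \<psi>)" "G k (X (X \<psi>)) = H k (X \<psi>)"
  shows "H k (S \<psi>) - (1 - q) * H k (X \<psi>) - q * G k (S (X \<psi>)) = (1 - q) * G k \<psi>"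
proof -
  have "G k (\<lambda>j. 1 * X (Y \<psi>) j + (- q) * Y (X \<psi>) j) = G k (\<lambda>j. (1 - q) * \<psi> j + 0 * \<psi> j)"
    using XY[of \<psi>] by (intro arg_cong[of _ _ "G k"]) auto
  then have "G k (X (Y \<psi>)) - q * G k (Y (X \<psi>)) = (1 - q) * G k \<psi>"
    unfolding G_linear by simp
  moreover have "G k (Y (X \<psi>)) = G k (S (X \<psi>)) - G k (X (X \<psi>))"
    using G_linear[of k 1 "S (X \<psi>)" "-1" "X (X \<psi>)"] by (simp add: Y_eq[of "X \<psi>"])
  moreover have "H k (Y \<psi>) = H k (S \<psi>) - H k (X \<psi>)"
    using H_linear[of k 1 "S \<psi>" "-1" "X \<psi>"] by (simp add: Y_eq[of \<psi>])
  ultimately show ?thesis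
    using assms by (simp add: algebra_simps)
qed

lemma G_X: "G k (X \<psi>) = H k \<psi>"
proof (induction k arbitrary: \<psi> rule: less_induct)
  case (less k)
  consider "k = 0" | "k = 1" | m where "k = Suc (Suc m)"
    by (metis One_nat_def not0_implies_Suc)
  then show ?case
  proof cases
    \<comment> \<open>The base case is the left boundary relation: \<open>x + y\<close> acts on
      \<open>W\<close> as \<open>(1 - c d) x + (c + d)\<close>.\<close>
    case 1
    then show ?thesis
      by (simp add: G_def H_def chebz_0 chebz_1 chebz_2 chebz_minus[of _ 1, simplified]
          chebz_minus[of _ 2, simplified] S_def Y_0 algebra_simps)
  next
    \<comment> \<open>The odd continuation folds the would-be term of index \<open>-1\<close> onto
      \<open>G 1\<close>, so the step from \<open>0\<close> yields twice the claim and cannot share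
      the general case.\<close>
    case 2
    have IH: "G 0 (X \<psi>) = H 0 \<psi>" for \<psi> using less 2 by simp
    show ?thesis
      using G_X_step[OF IH IH, of \<psi>] IH[of \<psi>] 2 
      by (simp add: G_def H_def chebz_S chebz_0 chebz_minus[of _ 1, simplified]
          chebz_minus[of _ 2, simplified] chebz_minus[of _ 3, simplified] algebra_simps)
  next
    case 3
    have IH1: "G (Suc m) (X \<psi>) = H (Suc m) \<psi>" for \<psi> using less 3 by simp
    have IH0: "G m (X \<psi>) = H m \<psi>" using less 3 by simp
    show ?thesis
      using G_X_step[OF IH1 IH1, of \<psi>] arg_cong[OF IH0, of "\<lambda>x. q * x"] unfolding 3
      by (simp add: G_def H_def chebz_S algebra_simps)
  qed
qed

text \<open>Apply \<open>W g_k\<close> to the right boundary relation; \<open>G_X\<close> then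
  eliminates \<open>x\<close> and \<open>y\<close> separately, so that only functions of
  \<open>x + y\<close> remain.\<close>

lemma five_term:
  assumes "right_vector \<phi>"
  shows "H k \<phi> + a * b * (G k (S \<phi>) - H k \<phi>) = (a + b) * G k \<phi>"
proof -
  have "(\<lambda>j. 1 * X \<phi> j + a * b * Y \<phi> j) = (\<lambda>j. (a + b) * \<phi> j + 0 * \<phi> j)"
    using assms by (auto simp: right_vector_def)
  then have "G k (\<lambda>j. 1 * X \<phi> j + a * b * Y \<phi> j) = G k (\<lambda>j. (a + b) * \<phi> j + 0 * \<phi> j)"
    by simp
  then have "G k (X \<phi>) + a * b * G k (Y \<phi>) = (a + b) * G k \<phi>"
    unfolding G_linear by simp
  moreover have "G k (Y \<phi>) = G k (S \<phi>) - G k (X \<phi>)"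
    using G_linear[of k 1 "S \<phi>" "-1" "X \<phi>"] by (simp add: Y_eq[of "\<phi>"])
  ultimately show ?thesis by (simp add: G_X)
qed

section \<open>Operator norms in Chebyshev coordinates\<close>

definition cheb_bounded :: "real \<Rightarrow> real \<Rightarrow> (nat \<Rightarrow> real) \<Rightarrow> bool" where
  "cheb_bounded B R \<psi> \<longleftrightarrow> (\<forall>k. \<bar>cheb \<psi> k\<bar> \<le> B * R ^ k)"

lemma cheb_boundedD:
  assumes "cheb_bounded B R \<psi>" shows "\<bar>chebz \<psi> i\<bar> \<le> B * R ^ nat \<bar>i\<bar>"
  using assms by (auto simp: cheb_bounded_def chebz_def)

lemma cheb_bounded_nonneg: "cheb_bounded B R \<psi> \<Longrightarrow> 0 \<le> B"
  by (auto simp: cheb_bounded_def dest: spec[of _ 0])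

lemma cheb_bounded_mono:
  assumes "cheb_bounded B R \<psi>" "0 \<le> R" "R \<le> R'" "B \<le> B'"
  shows "cheb_bounded B' R' \<psi>"
proof -
  have "B * R ^ k \<le> B' * R' ^ k" for k
    using assms cheb_bounded_nonneg[OF assms(1)] by (intro mult_mono power_mono) auto
  then show ?thesis using assms(1) order_trans unfolding cheb_bounded_def by blast
qed

lemma cheb_bounded_0: "cheb_bounded B R \<psi> \<Longrightarrow> \<bar>\<psi> 0\<bar> \<le> B * R"
  by (auto simp: cheb_bounded_def dest: spec[of _ "Suc 0"])

lemma cheb_bounded_linear:
  assumes "cheb_bounded B R \<phi>" "cheb_bounded B' R \<psi>"
  shows "cheb_bounded (\<bar>x\<bar> * B + \<bar>y\<bar> * B') R (\<lambda>j. x * \<phi> j + y * \<psi> j)"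
  unfolding cheb_bounded_def
proof
  fix k
  have "\<bar>x * cheb \<phi> k + y * cheb \<psi> k\<bar> \<le> \<bar>x\<bar> * \<bar>cheb \<phi> k\<bar> + \<bar>y\<bar> * \<bar>cheb \<psi> k\<bar>"
    by (metis abs_mult abs_triangle_ineq)
  also have "\<dots> \<le> \<bar>x\<bar> * (B * R ^ k) + \<bar>y\<bar> * (B' * R ^ k)"
    using assms by (intro add_mono mult_left_mono) (auto simp: cheb_bounded_def)
  finally show "\<bar>cheb (\<lambda>j. x * \<phi> j + y * \<psi> j) k\<bar> \<le> (\<bar>x\<bar> * B + \<bar>y\<bar> * B') * R ^ k"
    by (simp add: cheb_linear algebra_simps)
qed

text \<open>In these coordinates \<open>S\<close> is the sum of the two shifts, which cost
  \<open>R\<close> and \<open>1 / R\<close> against the weight \<open>R ^ k\<close>.\<close>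

lemma cheb_bounded_S:
  assumes "cheb_bounded B R \<psi>" "0 < R"
  shows "cheb_bounded (B * (R + 1 / R)) R (S \<psi>)"
  unfolding cheb_bounded_def
proof
  fix k
  show "\<bar>cheb (S \<psi>) k\<bar> \<le> B * (R + 1 / R) * R ^ k"
  proof (cases k)
    case 0
    then show ?thesis using assms cheb_bounded_nonneg[OF assms(1)] by simp
  next
    case (Suc m)
    have "cheb (S \<psi>) (Suc m) = cheb \<psi> (Suc (Suc m)) + cheb \<psi> m" by simp
    moreover have "\<bar>cheb \<psi> (Suc (Suc m))\<bar> \<le> B * R ^ Suc (Suc m)" "\<bar>cheb \<psi> m\<bar> \<le> B * R ^ m"
      using assms(1) unfolding cheb_bounded_def by blast+
    moreover have "B * R ^ Suc (Suc m) + B * R ^ m = B * (R + 1 / R) * R ^ Suc m"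
      using assms(2) by (simp add: field_simps)
    ultimately show ?thesis unfolding Suc by linarith
  qed
qed

lemma cheb_bounded_T:
  assumes "cheb_bounded B R \<psi>" "0 < R"
  shows "cheb_bounded (B * (2 + R + 1 / R)) R (T \<psi>)"
  using cheb_bounded_linear[OF assms(1) cheb_bounded_S[OF assms], of 2 1]
  by (simp add: T_eq algebra_simps)

lemma cheb_bounded_T_pow:
  assumes "cheb_bounded B R \<psi>" "0 < R"
  shows "cheb_bounded (B * (2 + R + 1 / R) ^ n) R ((T ^^ n) \<psi>)"
proof (induction n)
  case (Suc n)
  then show ?case using cheb_bounded_T[OF Suc.IH assms(2)] by (simp add: mult_ac)
qed (simp add: assms)

text \<open>Fitted to the induction that bounds \<open>X\<close>: half of the radius pays for the
  coefficients \<open>c + d\<close> and \<open>1 - c d\<close> of the two lower terms, and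
  \<open>X_norm\<close> is scaled so that the inhomogeneous term takes the other half. The summand
  \<open>c\<close> keeps the radius above every rate \<open>r < c\<close>.\<close>

definition cheb_radius :: real where "cheb_radius = 2 * (c + d + (1 - c * d)) + c"

definition X_norm :: real where "X_norm = 2 * cheb_radius * (2 + 2 * (c + d) - c * d)"

lemma cheb_radius: "c \<le> cheb_radius" "1 \<le> cheb_radius" "2 * (c + d + (1 - c * d)) \<le> cheb_radius" "0 \<le> X_norm"
  using signs cd by (auto simp: cheb_radius_def X_norm_def)

lemma H_bound:
  assumes "cheb_bounded B R \<psi>" "1 \<le> R"
  shows "\<bar>H k \<psi>\<bar> \<le> B * R ^ (k + 2) * (2 + 2 * (c + d) - c * d)"
proof -
  have B: "0 \<le> B" by (rule cheb_bounded_nonneg[OF assms(1)])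
  have bd: "\<bar>chebz \<psi> i\<bar> \<le> B * R ^ (k + 2)" if "\<bar>i\<bar> \<le> int k + 2" for i
  proof -
    have "B * R ^ nat \<bar>i\<bar> \<le> B * R ^ (k + 2)"
      using that assms(2) B by (intro mult_left_mono power_increasing) auto
    then show ?thesis using cheb_boundedD[OF assms(1), of i] by linarith
  qed
  have pr: "\<bar>x * y\<bar> \<le> z * Z" if "\<bar>x\<bar> \<le> z" "\<bar>y\<bar> \<le> Z" for x y z Z :: real
    unfolding abs_mult using that by (intro mult_mono) auto
  have "\<bar>(c + d) * chebz \<psi> (int k + 1)\<bar> \<le> (c + d) * (B * R ^ (k + 2))"
    using signs by (intro pr bd) auto
  moreover have "\<bar>c * d * (1 - q ^ k) * chebz \<psi> (int k)\<bar> \<le> (- (c * d)) * (B * R ^ (k + 2))"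
  proof (intro pr bd)
    show "\<bar>c * d * (1 - q ^ k)\<bar> \<le> - (c * d)"
      using signs(2) q_power[of k] mult_left_le[of "1 - q ^ k" "- (c * d)"]
      by (simp only: abs_mult[of "c * d"] abs_of_nonpos) simp
  qed auto
  moreover have "\<bar>q ^ k * (c + d) * chebz \<psi> (int k - 1)\<bar> \<le> (c + d) * (B * R ^ (k + 2))"
  proof (intro pr bd)
    show "\<bar>q ^ k * (c + d)\<bar> \<le> c + d"
      using signs(3) q_power[of k] mult_left_le_one_le[of "c + d" "q ^ k"] by (simp add: abs_mult)
  qed auto
  moreover have "\<bar>q ^ k * chebz \<psi> (int k - 2)\<bar> \<le> 1 * (B * R ^ (k + 2))"
    using q_power[of k] by (intro pr bd) auto
  moreover have "\<bar>chebz \<psi> (int k + 2)\<bar> \<le> B * R ^ (k + 2)" by (rule bd) auto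
  ultimately have "\<bar>H k \<psi>\<bar> \<le> B * R ^ (k + 2) + (c + d) * (B * R ^ (k + 2))
      + (- (c * d)) * (B * R ^ (k + 2)) + (c + d) * (B * R ^ (k + 2)) + 1 * (B * R ^ (k + 2))"
    unfolding H_def by linarith
  then show ?thesis by (simp add: algebra_simps)
qed

text \<open>\<open>G k (X \<psi>) = H k \<psi>\<close> is a recursion for the coordinates of
  \<open>X \<psi>\<close>. Its leading coefficient \<open>1 - q ^ k * (c * d)\<close> is at least
  \<open>1\<close> because \<open>c * d \<le> 0\<close>, so solving for the top term never loses
  anything.\<close>

lemma cheb_bounded_X:
  assumes "cheb_bounded B cheb_radius \<psi>"
  shows "cheb_bounded (B * X_norm) cheb_radius (X \<psi>)"
proof -
  note B = cheb_bounded_nonneg[OF assms]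
  have "\<bar>cheb (X \<psi>) k\<bar> \<le> B * X_norm * cheb_radius ^ k" for k
  proof (induction k rule: less_induct)
    case (less k)
    define M where "M = B * X_norm"
    have M: "0 \<le> M" using B cheb_radius by (simp add: M_def)
    note Hb = H_bound[OF assms cheb_radius(2)]
    have Hb': "\<bar>H k \<psi>\<bar> \<le> M * cheb_radius ^ (k + 1) / 2" for k
      using Hb[of k] by (simp add: M_def X_norm_def algebra_simps)
    consider "k = 0" | "k = 1" | m where "k = Suc (Suc m)"
      by (metis One_nat_def not0_implies_Suc)
    then show ?case
    proof cases
      case 1
      then show ?thesis using B cheb_radius by simp
    next
      case 2
      have "2 * ((1 - c * d) * cheb (X \<psi>) 1) = H 0 \<psi>"
        using G_X[of 0 \<psi>]
        by (simp add: G_def chebz_0 chebz_1 chebz_minus[of _ 1, simplified] algebra_simps)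
      then have "\<bar>(1 - c * d) * cheb (X \<psi>) 1\<bar> \<le> M * cheb_radius"
        using Hb'[of 0] M cheb_radius(2) by auto
      moreover have "\<bar>cheb (X \<psi>) 1\<bar> \<le> \<bar>(1 - c * d) * cheb (X \<psi>) 1\<bar>"
        using signs(2) mult_right_mono[of 1 "1 - c * d" "\<bar>cheb (X \<psi>) 1\<bar>"]
        by (simp add: abs_mult)
      ultimately show ?thesis using 2 by (simp add: M_def)
    next
      case 3
      let ?n = "Suc m"
      let ?A = "cheb (X \<psi>) k" and ?B = "cheb (X \<psi>) (Suc m)" and ?C = "cheb (X \<psi>) m"
      have z: "chebz (X \<psi>) (int ?n + 1) = ?A" "chebz (X \<psi>) (int ?n) = ?B"
        "chebz (X \<psi>) (int ?n - 1) = ?C"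
        using 3 by (auto simp: chebz_def nat_add_distrib numeral_eq_Suc)
      have le: "\<bar>?B\<bar> \<le> M * cheb_radius ^ Suc m" "\<bar>?C\<bar> \<le> M * cheb_radius ^ m"
        using less[of "Suc m"] less[of m] 3 by (auto simp: M_def)
      have "M * cheb_radius ^ m \<le> M * cheb_radius ^ Suc m"
        using M cheb_radius by (intro mult_left_mono power_increasing) auto
      then have le': "\<bar>?C\<bar> \<le> M * cheb_radius ^ Suc m" using le(2) by linarith
      have eq: "(1 - q ^ ?n * (c * d)) * ?A
          = H ?n \<psi> + (c + d) * (1 - q ^ ?n) * ?B - (c * d - q ^ ?n) * ?C"
        using G_X[of ?n \<psi>] unfolding G_def z by linarith
      have "\<bar>(c + d) * (1 - q ^ ?n) * ?B\<bar> \<le> (c + d) * (M * cheb_radius ^ Suc m)"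
        using signs(3) q_power[of ?n] le(1) mult_left_le[of "1 - q ^ ?n" "c + d"]
        unfolding abs_mult[of _ ?B] by (intro mult_mono) (auto simp: abs_mult)
      moreover have "\<bar>(c * d - q ^ ?n) * ?C\<bar> \<le> (1 - c * d) * (M * cheb_radius ^ Suc m)"
        unfolding abs_mult[of _ ?C]
      proof (rule mult_mono)
        show "\<bar>c * d - q ^ Suc m\<bar> \<le> 1 - c * d" "0 \<le> 1 - c * d"
          using signs(2) q_power[of "Suc m"] by linarith+
      qed (use le' in auto)
      moreover have "\<bar>?A\<bar> \<le> \<bar>(1 - q ^ ?n * (c * d)) * ?A\<bar>"
      proof -
        have "q ^ ?n * (c * d) \<le> 0" using signs(2) q_power[of ?n] mult_nonneg_nonpos by blast
        then show ?thesis
          using mult_right_mono[of 1 "1 - q ^ ?n * (c * d)" "\<bar>?A\<bar>"] by (simp add: abs_mult)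
      qed
      ultimately have "\<bar>?A\<bar> \<le> M * cheb_radius ^ (?n + 1) / 2 + (c + d) * (M * cheb_radius ^ Suc m)
          + (1 - c * d) * (M * cheb_radius ^ Suc m)"
        using Hb'[of ?n] eq by linarith
      also have "\<dots> = M * cheb_radius ^ (?n + 1) / 2 + (c + d + (1 - c * d)) * (M * cheb_radius ^ Suc m)"
        by (simp add: algebra_simps)
      also have "\<dots> \<le> M * cheb_radius ^ (?n + 1) / 2 + cheb_radius / 2 * (M * cheb_radius ^ Suc m)"
        using cheb_radius M by (intro add_left_mono mult_right_mono) auto
      also have "\<dots> = M * cheb_radius ^ k" using 3 by simp
      finally show ?thesis by (simp add: M_def)
    qed
  qed
  then show ?thesis unfolding cheb_bounded_def by blast
qed

definition site_norm :: real where "site_norm = 1 + X_norm + (cheb_radius + 1 / cheb_radius)"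

lemma site_norm: "1 \<le> site_norm"
  using cheb_radius by (simp add: site_norm_def)

lemma cheb_bounded_site:
  assumes "cheb_bounded B cheb_radius \<psi>"
  shows "cheb_bounded (B * site_norm) cheb_radius (site s \<psi>)"
proof -
  note B = cheb_bounded_nonneg[OF assms]
  note X = cheb_bounded_X[OF assms]
  have R: "0 < cheb_radius" using cheb_radius by simp
  note S = cheb_bounded_S[OF assms R]
  have "cheb_bounded (B * (X_norm + (cheb_radius + 1 / cheb_radius))) cheb_radius (Y \<psi>)"
    using cheb_bounded_linear[OF S X, of 1 "-1"] by (simp add: Y_eq algebra_simps)
  note Y = cheb_bounded_linear[OF assms this, of 1 1]
  have "cheb_bounded (B * site_norm) cheb_radius (site False \<psi>)"
    using Y by (simp add: site_def[abs_def] site_norm_def algebra_simps)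
  moreover have "cheb_bounded (B + B * X_norm) cheb_radius (site True \<psi>)"
    using cheb_bounded_linear[OF assms X, of 1 1] by (simp add: site_def[abs_def])
  moreover have "B + B * X_norm \<le> B * site_norm" using B R by (simp add: site_norm_def algebra_simps)
  ultimately show ?thesis
    by (cases s) (use R in \<open>auto intro: cheb_bounded_mono\<close>)
qed

lemma cheb_bounded_word:
  assumes "cheb_bounded B cheb_radius \<psi>"
  shows "cheb_bounded (B * site_norm ^ length w) cheb_radius (word w \<psi>)"
proof (induction w)
  case (Cons s w)
  then show ?case using cheb_bounded_site[OF Cons.IH] by (simp add: mult_ac)
qed (simp add: assms)

end

section \<open>Growth of the Chebyshev coordinates\<close>

definition geometric_bound :: "real \<Rightarrow> (nat \<Rightarrow> real) \<Rightarrow> bool" where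
  "geometric_bound r x \<longleftrightarrow> (\<exists>M. \<forall>k. \<bar>x k\<bar> \<le> M * r ^ k)"

lemma geometric_bound_mono:
  assumes "geometric_bound r x" "0 \<le> r" "r \<le> r'"
  shows "geometric_bound r' x"
proof -
  obtain M where M: "\<And>k. \<bar>x k\<bar> \<le> M * r ^ k"
    using assms(1) by (auto simp: geometric_bound_def)
  have "0 \<le> M" using M[of 0] by simp
  then have "M * r ^ k \<le> M * r' ^ k" for k
    using assms by (intro mult_left_mono power_mono)
  then show ?thesis using M order_trans unfolding geometric_bound_def by blast
qed

text \<open>Strips a characteristic root of modulus below \<open>r\<close>: the constant is large
  enough that \<open>\<bar>\<rho>\<bar> M' + M \<le> r M'\<close>.\<close>

lemma geometric_bound_first_order:
  assumes "geometric_bound r (\<lambda>k. x (Suc k) - \<rho> * x k)" "\<bar>\<rho>\<bar> < r"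
  shows "geometric_bound r x"
proof -
  obtain M where M: "\<And>k. \<bar>x (Suc k) - \<rho> * x k\<bar> \<le> M * r ^ k"
    using assms(1) by (auto simp: geometric_bound_def)
  have r: "0 < r" using assms(2) by linarith
  define M' where "M' = max \<bar>x 0\<bar> (M / (r - \<bar>\<rho>\<bar>))"
  have "M / (r - \<bar>\<rho>\<bar>) \<le> M'" by (simp add: M'_def)
  then have M': "M \<le> M' * (r - \<bar>\<rho>\<bar>)" using assms(2) by (simp add: divide_le_eq)
  have "\<bar>x k\<bar> \<le> M' * r ^ k" for k
  proof (induction k)
    case 0
    then show ?case by (simp add: M'_def)
  next
    case (Suc k)
    have "\<bar>x (Suc k)\<bar> \<le> \<bar>\<rho>\<bar> * \<bar>x k\<bar> + M * r ^ k"
      using M[of k] abs_mult[of \<rho> "x k"] by linarith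
    also have "\<dots> \<le> \<bar>\<rho>\<bar> * (M' * r ^ k) + M' * (r - \<bar>\<rho>\<bar>) * r ^ k"
      using Suc.IH M' r by (intro add_mono mult_left_mono mult_right_mono) auto
    finally show ?case by (simp add: algebra_simps)
  qed
  then show ?thesis by (auto simp: geometric_bound_def)
qed

text \<open>Strips a root above \<open>r\<close>: the increments of \<open>x k / \<rho> ^ k\<close>
  are \<open>O((r / \<rho>)^k)\<close>, so the quotient converges to some \<open>K\<close>, and the
  tail of the geometric series gives the error.\<close>

lemma geometric_bound_dominant:
  assumes "geometric_bound r (\<lambda>k. x (Suc k) - \<rho> * x k)" "0 < r" "r < \<rho>"
  shows "\<exists>K. geometric_bound r (\<lambda>k. x k - K * \<rho> ^ k)"
proof -
  obtain M where M: "\<And>k. \<bar>x (Suc k) - \<rho> * x k\<bar> \<le> M * r ^ k"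
    using assms(1) by (auto simp: geometric_bound_def)
  define z where "z k = x k / \<rho> ^ k" for k
  define t where "t = r / \<rho>"
  have t: "0 < t" "t < 1" using assms by (auto simp: t_def)
  have dz: "\<bar>z (Suc k) - z k\<bar> \<le> M / \<rho> * t ^ k" for k
  proof -
    have "z (Suc k) - z k = (x (Suc k) - \<rho> * x k) / \<rho> ^ Suc k"
      using assms by (simp add: z_def field_simps)
    then have "\<bar>z (Suc k) - z k\<bar> = \<bar>x (Suc k) - \<rho> * x k\<bar> / \<rho> ^ Suc k" using assms by simp
    also have "\<dots> \<le> M * r ^ k / \<rho> ^ Suc k" using M assms by (intro divide_right_mono) auto
    finally show ?thesis by (simp add: t_def power_divide)
  qed
  have sg: "(\<lambda>k. M / \<rho> * t ^ (k + n)) sums (M / \<rho> * t ^ n / (1 - t))" for n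
    using sums_mult[OF geometric_sums[of t], of "M / \<rho> * t ^ n"] t
    by (simp add: power_add mult_ac)
  have sm: "summable (\<lambda>k. z (Suc k) - z k)"
    by (rule summable_comparison_test'[of "\<lambda>k. M / \<rho> * t ^ k"])
      (use sg[of 0] dz in \<open>auto simp: sums_iff\<close>)
  then obtain K where K: "z \<longlonglongrightarrow> K"
  proof -
    have "(\<lambda>n. z n - z 0) \<longlonglongrightarrow> (\<Sum>k. z (Suc k) - z k)"
      using summable_LIMSEQ[OF sm] by (simp add: sum_lessThan_telescope)
    from tendsto_add[OF this tendsto_const[of "z 0"]] show ?thesis
      by (intro that) simp
  qed
  have zK: "\<bar>z n - K\<bar> \<le> M / \<rho> * t ^ n / (1 - t)" for n
  proof -
    have "(\<lambda>k. z (Suc k + n) - z (k + n)) sums (K - z n)"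
      using telescope_sums[OF LIMSEQ_ignore_initial_segment[OF K, of n]] by simp
    then have "K - z n = (\<Sum>k. z (Suc k + n) - z (k + n))" by (simp add: sums_iff)
    moreover have "\<bar>\<Sum>k. z (Suc k + n) - z (k + n)\<bar> \<le> (\<Sum>k. M / \<rho> * t ^ (k + n))"
      using norm_suminf_le[of "\<lambda>k. z (Suc k + n) - z (k + n)" "\<lambda>k. M / \<rho> * t ^ (k + n)"]
        dz sg[of n] by (simp add: sums_iff)
    ultimately show ?thesis using sg[of n] by (auto simp: sums_iff)
  qed
  have "\<bar>x n - K * \<rho> ^ n\<bar> \<le> (M / \<rho> / (1 - t)) * r ^ n" for n
  proof -
    have "x n - K * \<rho> ^ n = (z n - K) * \<rho> ^ n" using assms by (simp add: z_def algebra_simps)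
    then have "\<bar>x n - K * \<rho> ^ n\<bar> = \<bar>z n - K\<bar> * \<rho> ^ n" using assms by (simp add: abs_mult)
    also have "\<dots> \<le> M / \<rho> * t ^ n / (1 - t) * \<rho> ^ n" using zK assms by (intro mult_right_mono) auto
    also have "\<dots> = (M / \<rho> / (1 - t)) * r ^ n" using assms by (simp add: t_def power_divide)
    finally show ?thesis .
  qed
  then show ?thesis unfolding geometric_bound_def by blast
qed

lemma geometric_bound_fourth_order:
  fixes x :: "nat \<Rightarrow> real"
  assumes "\<And>n. n \<ge> n0 \<Longrightarrow> \<bar>x (n + 4)\<bar> \<le> C * (\<bar>x (n + 3)\<bar> + \<bar>x (n + 2)\<bar> + \<bar>x (n + 1)\<bar> + \<bar>x n\<bar>)"
    and "0 \<le> C"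
  shows "\<exists>R\<ge>1. geometric_bound R x"
proof -
  define R where "R = max 1 (4 * C)"
  define M where "M = Max ((\<lambda>i. \<bar>x i\<bar>) ` {..n0 + 3})"
  have R: "1 \<le> R" "4 * C \<le> R" by (auto simp: R_def)
  have M: "\<bar>x i\<bar> \<le> M" if "i \<le> n0 + 3" for i
    unfolding M_def using that by (intro Max_ge) auto
  have M0: "0 \<le> M" using M[of 0] by simp
  have "\<bar>x k\<bar> \<le> M * R ^ k" for k
  proof (induction k rule: less_induct)
    case (less k)
    show ?case
    proof (cases "k \<le> n0 + 3")
      case True
      have "M * 1 \<le> M * R ^ k" using M0 R by (intro mult_left_mono one_le_power) auto
      then show ?thesis using M[OF True] by simp
    next
      case False
      define n where "n = k - 4"
      have n: "k = n + 4" "n \<ge> n0" using False by (auto simp: n_def)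
      have b: "\<bar>x i\<bar> \<le> M * R ^ (n + 3)" if "i \<le> n + 3" for i
      proof -
        have "M * R ^ i \<le> M * R ^ (n + 3)" using that M0 R by (intro mult_left_mono power_increasing)
        then show ?thesis using less[of i] that n by force
      qed
      have "\<bar>x k\<bar> \<le> C * (\<bar>x (n + 3)\<bar> + \<bar>x (n + 2)\<bar> + \<bar>x (n + 1)\<bar> + \<bar>x n\<bar>)"
        using assms(1)[OF n(2)] n(1) by simp
      also have "\<dots> \<le> C * (4 * (M * R ^ (n + 3)))"
        using b[of "n + 3"] b[of "n + 2"] b[of "n + 1"] b[of n] assms(2)
        by (intro mult_left_mono) auto
      also have "\<dots> = 4 * C * (M * R ^ (n + 3))" by simp
      also have "\<dots> \<le> R * (M * R ^ (n + 3))" using R M0 by (intro mult_right_mono) auto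
      also have "\<dots> = M * R ^ k" using n by (simp add: power_add eval_nat_numeral)
      finally show ?thesis .
    qed
  qed
  then show ?thesis using R by (auto simp: geometric_bound_def)
qed

lemma abs_sum4:
  fixes w x y z :: real
  shows "\<bar>w + x + y + z\<bar> \<le> \<bar>w\<bar> + \<bar>x\<bar> + \<bar>y\<bar> + \<bar>z\<bar>"
  by linarith

context asep_weights begin

text \<open>\<open>e1\<close> to \<open>e4\<close> are the elementary symmetric polynomials in
  \<open>a, b, c, d\<close>.\<close>

definition e1 :: real where "e1 = a + b + c + d"
definition e2 :: real where "e2 = a * b + (a + b) * (c + d) + c * d"
definition e3 :: real where "e3 = a * b * (c + d) + (a + b) * (c * d)"
definition e4 :: real where "e4 = a * b * (c * d)"

text \<open>The five-term relation at \<open>k = n + 2\<close>, sorted by \<open>q ^ k\<close>: the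
  left side has characteristic polynomial \<open>(z - a) (z - b) (z - c) (z - d)\<close>, the
  perturbation its reversal. The shift by \<open>2\<close> keeps all indices nonnegative.\<close>

lemma cheb_recurrence:
  assumes "right_vector \<phi>"
  defines "u \<equiv> cheb \<phi>"
  shows "u (n + 4) - e1 * u (n + 3) + e2 * u (n + 2) - e3 * u (n + 1) + e4 * u n
    = q ^ (n + 2) * (e4 * u (n + 4) - e3 * u (n + 3) + e2 * u (n + 2) - e1 * u (n + 1) + u n)"
proof -
  have z: "chebz \<phi> (int m) = u m" for m by (simp add: chebz_def u_def)
  have i: "int (n + 2) + 1 = int (n + 3)" "int (n + 2) + 2 = int (n + 4)"
      "int (n + 2) - 1 = int (n + 1)" "int (n + 2) - 2 = int n"
      "int (n + 3) + 1 = int (n + 4)" "int (n + 3) - 1 = int (n + 2)"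
      "int (n + 1) + 1 = int (n + 2)" "int (n + 1) - 1 = int n"
    by simp_all
  show ?thesis
    using five_term[OF assms(1), of "n + 2"]
    unfolding G_def H_def chebz_S i z e1_def e2_def e3_def e4_def
    by (simp add: algebra_simps)
qed

definition diff4 :: "(nat \<Rightarrow> real) \<Rightarrow> nat \<Rightarrow> real" where
  "diff4 u n = u (n + 4) - e1 * u (n + 3) + e2 * u (n + 2) - e3 * u (n + 1) + e4 * u n"

text \<open>\<open>diff4\<close> is the product of the first-order operators with roots
  \<open>a, b, c, d\<close>. The roots \<open>d\<close>, \<open>b\<close>, \<open>a\<close> have
  modulus below \<open>r\<close> and are removed one at a time; only the factor of \<open>c\<close>
  survives.\<close>

lemma leading_difference_bound:
  assumes "geometric_bound r (diff4 u)" "1 \<le> r" "a < r"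
  shows "geometric_bound r (\<lambda>n. u (Suc n) - c * u n)"
proof -
  define D1 where "D1 n = u (Suc n) - c * u n" for n
  define D2 where "D2 n = D1 (Suc n) - a * D1 n" for n
  define D3 where "D3 n = D2 (Suc n) - b * D2 n" for n
  have "diff4 u = (\<lambda>n. D3 (Suc n) - d * D3 n)"
    by (auto simp: diff4_def D3_def D2_def D1_def e1_def e2_def e3_def e4_def
        eval_nat_numeral algebra_simps)
  then have "geometric_bound r (\<lambda>n. D3 (Suc n) - d * D3 n)" using assms by simp
  then have "geometric_bound r D3"
    by (rule geometric_bound_first_order) (use cd assms in auto)
  then have "geometric_bound r D2"
    unfolding D3_def[abs_def] by (rule geometric_bound_first_order) (use ab assms in auto)
  then have "geometric_bound r D1"
    unfolding D2_def[abs_def] by (rule geometric_bound_first_order) (use ab assms in auto)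
  then show ?thesis by (simp add: D1_def[abs_def])
qed

text \<open>The perturbation carries the factor \<open>q ^ (n + 2)\<close>, so growth
  \<open>R\<close> of the coordinates becomes growth \<open>q R\<close> of
  \<open>diff4\<close>.\<close>

lemma diff4_bound:
  assumes "right_vector \<phi>" "geometric_bound R (cheb \<phi>)" "1 \<le> R" "q * R \<le> r" "0 < r"
  shows "geometric_bound r (diff4 (cheb \<phi>))"
proof -
  obtain M where M: "\<And>k. \<bar>cheb \<phi> k\<bar> \<le> M * R ^ k"
    using assms(2) by (auto simp: geometric_bound_def)
  have M0: "0 \<le> M" using M[of 0] by simp
  let ?E = "\<bar>e4\<bar> + \<bar>e3\<bar> + \<bar>e2\<bar> + \<bar>e1\<bar> + 1"
  have "\<bar>diff4 (cheb \<phi>) n\<bar> \<le> ?E * M * R ^ 4 * r ^ n" for n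
  proof -
    let ?u = "cheb \<phi>"
    have b: "\<bar>x * ?u i\<bar> \<le> \<bar>x\<bar> * (M * R ^ (n + 4))" if "i \<le> n + 4" for i x
    proof -
      have "M * R ^ i \<le> M * R ^ (n + 4)"
        using that M0 assms(3) by (intro mult_left_mono power_increasing)
      then show ?thesis unfolding abs_mult using M[of i] by (intro mult_left_mono) auto
    qed
    have "\<bar>e4 * ?u (n + 4) - e3 * ?u (n + 3) + e2 * ?u (n + 2) - e1 * ?u (n + 1) + ?u n\<bar>
       \<le> ?E * (M * R ^ (n + 4))"
    proof -
      have "\<bar>v - w + x - y + z\<bar> \<le> \<bar>v\<bar> + \<bar>w\<bar> + \<bar>x\<bar> + \<bar>y\<bar> + \<bar>z\<bar>" for v w x y z :: real
        by linarith
      note this[of "e4 * ?u (n + 4)" "e3 * ?u (n + 3)" "e2 * ?u (n + 2)" "e1 * ?u (n + 1)" "?u n"]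
      also have "\<bar>e4 * ?u (n + 4)\<bar> + \<bar>e3 * ?u (n + 3)\<bar> + \<bar>e2 * ?u (n + 2)\<bar> + \<bar>e1 * ?u (n + 1)\<bar>
          + \<bar>?u n\<bar> \<le> \<bar>e4\<bar> * (M * R ^ (n + 4)) + \<bar>e3\<bar> * (M * R ^ (n + 4))
          + \<bar>e2\<bar> * (M * R ^ (n + 4)) + \<bar>e1\<bar> * (M * R ^ (n + 4)) + 1 * (M * R ^ (n + 4))"
        using b[of n 1] by (intro add_mono b) auto
      finally show ?thesis by (simp only: distrib_right)
    qed
    then have "\<bar>diff4 ?u n\<bar> \<le> q ^ (n + 2) * (?E * (M * R ^ (n + 4)))"
      unfolding diff4_def cheb_recurrence[OF assms(1)] abs_mult
      using q_power[of "n + 2"] by (simp add: mult_left_mono)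
    also have "\<dots> \<le> q ^ n * (?E * (M * R ^ (n + 4)))"
      using q M0 assms(3) by (intro mult_right_mono power_decreasing) auto
    also have "\<dots> = ?E * M * R ^ 4 * (q * R) ^ n"
      by (simp add: power_add power_mult_distrib mult_ac)
    also have "\<dots> \<le> ?E * M * R ^ 4 * r ^ n"
      using M0 assms q by (intro mult_left_mono power_mono) auto
    finally show ?thesis .
  qed
  then show ?thesis by (auto simp: geometric_bound_def)
qed

lemma cheb_crude_bound:
  assumes "right_vector \<phi>"
  shows "\<exists>R\<ge>1. geometric_bound R (cheb \<phi>)"
proof -
  \<comment> \<open>The coefficient \<open>1 - e4 q^(n+2)\<close> of the top term can vanish for
    small \<open>n\<close>. From \<open>n0\<close> on it exceeds \<open>1 / 2\<close>; the earlier
    values only enter the constant.\<close>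
  have "(\<lambda>k. e4 * q ^ k) \<longlonglongrightarrow> e4 * 0"
    using q by (intro tendsto_intros LIMSEQ_realpow_zero) auto
  then have "eventually (\<lambda>k. e4 * q ^ k < 1 / 2) sequentially"
    by (rule order_tendstoD) auto
  then obtain n0 where n0: "\<And>k. k \<ge> n0 \<Longrightarrow> e4 * q ^ k < 1 / 2"
    by (auto simp: eventually_sequentially)
  let ?u = "cheb \<phi>"
  let ?E = "\<bar>e4\<bar> + 2 * \<bar>e3\<bar> + 2 * \<bar>e2\<bar> + 2 * \<bar>e1\<bar> + 1"
  have "\<bar>?u (n + 4)\<bar> \<le> 2 * ?E * (\<bar>?u (n + 3)\<bar> + \<bar>?u (n + 2)\<bar> + \<bar>?u (n + 1)\<bar> + \<bar>?u n\<bar>)"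
    if "n \<ge> n0" for n
  proof -
    let ?Q = "q ^ (n + 2)"
    let ?s = "\<bar>?u (n + 3)\<bar> + \<bar>?u (n + 2)\<bar> + \<bar>?u (n + 1)\<bar> + \<bar>?u n\<bar>"
    have eq: "(1 - e4 * ?Q) * ?u (n + 4) = (e1 - ?Q * e3) * ?u (n + 3) + (?Q * e2 - e2) * ?u (n + 2)
       + (e3 - ?Q * e1) * ?u (n + 1) + (?Q - e4) * ?u n"
      using cheb_recurrence[OF assms, of n] by (simp add: algebra_simps)
    have E: "\<bar>x * y\<bar> \<le> ?E * \<bar>y\<bar>" if "\<bar>x\<bar> \<le> ?E" for x y :: real
      unfolding abs_mult using that by (intro mult_right_mono) auto
    have Q: "\<bar>?Q * x\<bar> \<le> \<bar>x\<bar>" for x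
      using q_power[of "n + 2"] mult_left_le_one_le[of "\<bar>x\<bar>" ?Q]
      by (simp only: abs_mult abs_of_nonneg abs_ge_zero)
    have "\<bar>e1 - ?Q * e3\<bar> \<le> ?E" "\<bar>?Q * e2 - e2\<bar> \<le> ?E" "\<bar>e3 - ?Q * e1\<bar> \<le> ?E" "\<bar>?Q - e4\<bar> \<le> ?E"
    proof -
      show "\<bar>e1 - ?Q * e3\<bar> \<le> ?E"
        using abs_triangle_ineq4[of e1 "?Q * e3"] Q[of e3]
          abs_ge_zero[of e1] abs_ge_zero[of e2] abs_ge_zero[of e3] abs_ge_zero[of e4]
        unfolding mult_1_right abs_one by linarith
      show "\<bar>?Q * e2 - e2\<bar> \<le> ?E"
        using abs_triangle_ineq4[of "?Q * e2" e2] Q[of e2]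
          abs_ge_zero[of e1] abs_ge_zero[of e2] abs_ge_zero[of e3] abs_ge_zero[of e4]
        unfolding mult_1_right abs_one by linarith
      show "\<bar>e3 - ?Q * e1\<bar> \<le> ?E"
        using abs_triangle_ineq4[of e3 "?Q * e1"] Q[of e1]
          abs_ge_zero[of e1] abs_ge_zero[of e2] abs_ge_zero[of e3] abs_ge_zero[of e4]
        unfolding mult_1_right abs_one by linarith
      show "\<bar>?Q - e4\<bar> \<le> ?E"
        using abs_triangle_ineq4[of ?Q e4] Q[of 1]
          abs_ge_zero[of e1] abs_ge_zero[of e2] abs_ge_zero[of e3] abs_ge_zero[of e4]
        unfolding mult_1_right abs_one by linarith
    qed
    note bd = E[OF this(1), of "?u (n + 3)"] E[OF this(2), of "?u (n + 2)"]
      E[OF this(3), of "?u (n + 1)"] E[OF this(4), of "?u n"]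
    have "\<bar>(1 - e4 * ?Q) * ?u (n + 4)\<bar> \<le> ?E * \<bar>?u (n + 3)\<bar> + ?E * \<bar>?u (n + 2)\<bar>
        + ?E * \<bar>?u (n + 1)\<bar> + ?E * \<bar>?u n\<bar>"
      unfolding eq by (intro order_trans[OF abs_sum4] add_mono bd)
    moreover have "\<bar>?u (n + 4)\<bar> * (1 / 2) \<le> \<bar>(1 - e4 * ?Q) * ?u (n + 4)\<bar>"
      using n0[of "n + 2"] that mult_right_mono[of "1 / 2" "1 - e4 * ?Q" "\<bar>?u (n + 4)\<bar>"]
      by (simp add: abs_mult)
    ultimately show ?thesis by (simp add: algebra_simps)
  qed
  then show ?thesis by (rule geometric_bound_fourth_order) auto
qed

text \<open>A bound with ratio \<open>R\<close> improves to one with ratio \<open>max (q R) c'\<close>, and this is iterated.\<close>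

lemma cheb_bootstrap:
  assumes "right_vector \<phi>" "c < c'"
  shows "geometric_bound c' (cheb \<phi>)"
proof -
  obtain R where R: "1 \<le> R" "geometric_bound R (cheb \<phi>)" using cheb_crude_bound[OF assms(1)] by blast
  have "geometric_bound (max (q ^ i * R) c') (cheb \<phi>)" for i
  proof (induction i)
    case 0
    show ?case using R by (auto intro: geometric_bound_mono)
  next
    case (Suc i)
    let ?r = "max (q ^ Suc i * R) c'"
    have c': "1 \<le> c'" using assms cd by simp
    have "q * c' \<le> c'" using q c' by (intro mult_left_le_one_le) auto
    then have "q * max (q ^ i * R) c' \<le> ?r"
      by (cases "q ^ i * R \<le> c'") (simp_all add: mult.assoc max_def)
    then have "geometric_bound ?r (diff4 (cheb \<phi>))"
      using c' by (intro diff4_bound[OF assms(1) Suc.IH]) auto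
    then have "geometric_bound ?r (\<lambda>n. cheb \<phi> (Suc n) - c * cheb \<phi> n)"
      using c' ac assms by (intro leading_difference_bound) auto
    moreover have "\<bar>c\<bar> < ?r" using cd assms by (simp add: less_max_iff_disj)
    ultimately show ?case by (rule geometric_bound_first_order)
  qed
  moreover have "\<exists>i. q ^ i * R \<le> c'"
  proof -
    have "(\<lambda>k. q ^ k * R) \<longlonglongrightarrow> 0 * R"
      using q by (intro tendsto_intros LIMSEQ_realpow_zero) auto
    then have "eventually (\<lambda>k. q ^ k * R < c') sequentially"
      by (rule order_tendstoD) (use assms cd in auto)
    then show ?thesis by (auto simp: eventually_sequentially intro: less_imp_le)
  qed
  ultimately show ?thesis by (metis max.absorb2)
qed

lemma cheb_asymptotics:
  assumes "right_vector \<phi>" "1 \<le> r" "a < r" "q * c < r" "r < c"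
  shows "\<exists>K. geometric_bound r (\<lambda>k. cheb \<phi> k - K * c ^ k)"
proof -
  \<comment> \<open>A rate above \<open>c\<close>, as the bootstrap requires, that still satisfies
    \<open>q c' \<le> r\<close>: the excess \<open>r - q c\<close> only shrinks under multiplication
    by \<open>q\<close>.\<close>
  define c' where "c' = c + (r - q * c)"
  have "q * (r - q * c) \<le> r - q * c"
    using q assms by (intro mult_left_le_one_le) auto
  then have c': "c < c'" "q * c' \<le> r" using assms by (auto simp: c'_def algebra_simps)
  have "geometric_bound r (diff4 (cheb \<phi>))"
    by (rule diff4_bound[OF assms(1) cheb_bootstrap[OF assms(1) c'(1)]]) (use assms c' cd in auto)
  then have "geometric_bound r (\<lambda>n. cheb \<phi> (Suc n) - c * cheb \<phi> n)"
    using assms by (intro leading_difference_bound)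
  then show ?thesis using assms by (intro geometric_bound_dominant) auto
qed

section \<open>Geometric vectors and the Bernoulli representation\<close>

definition geom :: "real \<Rightarrow> nat \<Rightarrow> real" where
  "geom x j = x ^ j"

text \<open>Eigenvectors of \<open>x\<close> form a triangular system for \<open>x + y\<close>,
  because \<open>q ^ j\<close> in \<open>Y\<close> turns ratio \<open>x\<close> into
  \<open>q x\<close>. The coupling vanishes at \<open>x = 1 / c\<close>, which isolates the
  one-dimensional representation.\<close>

lemma geom_S:
  assumes "x \<noteq> 0"
  shows "S (geom x) = (\<lambda>j. (x + 1 / x) * geom x j + ((c * x - 1) * (1 - d * x) / x) * geom (q * x) j)"
proof
  fix j
  show "S (geom x) j = (x + 1 / x) * geom x j + ((c * x - 1) * (1 - d * x) / x) * geom (q * x) j"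
    using assms by (cases j) (simp_all add: S_def X_def Y_def geom_def power_mult_distrib field_simps)
qed

lemma geom_X: "X (geom x) = (\<lambda>j. x * geom x j)"
  by (auto simp: X_def geom_def)

lemma geom_S_c: "S (geom (1 / c)) = (\<lambda>j. (c + 1 / c) * geom (1 / c) j + 0 * geom (1 / c) j)"
  using cd by (simp add: geom_S add.commute)

lemma geom_Y_c: "Y (geom (1 / c)) = (\<lambda>j. c * geom (1 / c) j)"
  by (auto simp: Y_eq geom_S_c geom_X algebra_simps)

definition \<Lambda> :: real where "\<Lambda> = 2 + c + 1 / c"

lemma geom_site_c:
  "site s (geom (1 / c)) = (\<lambda>j. (if s then 1 + 1 / c else 1 + c) * geom (1 / c) j)"
  by (auto simp: site_def geom_X geom_Y_c algebra_simps)

lemma geom_T: "T (geom (1 / c)) = (\<lambda>j. \<Lambda> * geom (1 / c) j)"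
  by (auto simp: T_def geom_site_c \<Lambda>_def algebra_simps)

lemma geom_T_pow: "(T ^^ n) (geom (1 / c)) = (\<lambda>j. \<Lambda> ^ n * geom (1 / c) j)"
proof (induction n)
  case (Suc n)
  have "T (\<lambda>j. \<Lambda> ^ n * geom (1 / c) j) = (\<lambda>j. \<Lambda> ^ n * T (geom (1 / c)) j)"
    using T_linear[of "\<Lambda> ^ n" "geom (1 / c)" 0] by simp
  then show ?case by (simp add: Suc geom_T mult_ac)
qed simp

lemma cheb_geom_c: "(c - 1 / c) * cheb (geom (1 / c)) k = c ^ k - (1 / c) ^ k"
proof (induction k rule: induct_nat_012)
  case (ge2 n)
  have "cheb (S (geom (1 / c))) (Suc n) = (c + 1 / c) * cheb (geom (1 / c)) (Suc n)"
    unfolding geom_S_c cheb_linear by simp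
  then have "(c - 1 / c) * cheb (geom (1 / c)) (Suc (Suc n))
     = (c + 1 / c) * ((c - 1 / c) * cheb (geom (1 / c)) (Suc n)) - (c - 1 / c) * cheb (geom (1 / c)) n"
    by (simp add: right_diff_distrib mult.left_commute)
  also have "\<dots> = (c + 1 / c) * (c ^ Suc n - (1 / c) ^ Suc n) - (c ^ n - (1 / c) ^ n)"
    unfolding ge2 ..
  also have "\<dots> = c ^ Suc (Suc n) - (1 / c) ^ Suc (Suc n)"
    using cd by (simp add: field_simps)
  finally show ?case .
qed (simp_all add: geom_def)

lemma right_vector_decomposition:
  assumes "right_vector \<phi>" "1 \<le> r" "a < r" "q * c < r" "r < c"
  shows "\<exists>K B. cheb_bounded B r (\<lambda>j. 1 * \<phi> j + (- K) * geom (1 / c) j)"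
proof -
  obtain K M where KM: "\<And>k. \<bar>cheb \<phi> k - K * c ^ k\<bar> \<le> M * r ^ k"
    using cheb_asymptotics[OF assms] by (auto simp: geometric_bound_def)
  \<comment> \<open>The coordinates of \<open>geom (1 / c)\<close> are
    \<open>(c^k - c^(-k)) / (c - 1 / c)\<close>. This normalisation cancels \<open>K c^k\<close>
    exactly; the leftover \<open>K c^(-k)\<close> is bounded and hence
    \<open>O(r^k)\<close>.\<close>
  define K' where "K' = K * (c - 1 / c)"
  have "\<bar>cheb (\<lambda>j. 1 * \<phi> j + (- K') * geom (1 / c) j) k\<bar> \<le> (M + \<bar>K\<bar>) * r ^ k" for k
  proof -
    have "cheb (\<lambda>j. 1 * \<phi> j + (- K') * geom (1 / c) j) k
        = cheb \<phi> k - K * ((c - 1 / c) * cheb (geom (1 / c)) k)"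
      unfolding cheb_linear by (simp add: K'_def)
    also have "\<dots> = (cheb \<phi> k - K * c ^ k) + K * (1 / c) ^ k"
      unfolding cheb_geom_c by (simp add: algebra_simps)
    finally have "\<bar>cheb (\<lambda>j. 1 * \<phi> j + (- K') * geom (1 / c) j) k\<bar> \<le> M * r ^ k + \<bar>K\<bar> * \<bar>(1 / c) ^ k\<bar>"
      using KM[of k] abs_mult[of K "(1 / c) ^ k"] by linarith
    also have "\<dots> \<le> M * r ^ k + \<bar>K\<bar> * r ^ k"
    proof -
      have "\<bar>(1 / c) ^ k\<bar> \<le> 1" using cd by (simp add: power_le_one)
      also have "1 \<le> r ^ k" using assms by simp
      finally show ?thesis by (intro add_left_mono mult_left_mono) auto
    qed
    finally show ?thesis by (simp add: algebra_simps)
  qed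
  then show ?thesis unfolding cheb_bounded_def by blast
qed

section \<open>Positivity and the lower bound\<close>

lemma word_bulk:
  "word (u @ True # False # v) \<phi> 0 = q * word (u @ False # True # v) \<phi> 0
     + (1 - q) * (word (u @ True # v) \<phi> 0 + word (u @ False # v) \<phi> 0)"
proof -
  let ?\<psi> = "word v \<phi>"
  have "word u (T ?\<psi>) = (\<lambda>j. word u (site True ?\<psi>) j + word u (site False ?\<psi>) j)"
    using word_linear[of u 1 "site True ?\<psi>" 1 "site False ?\<psi>"] by (simp add: T_def[abs_def])
  then show ?thesis
    by (simp add: word_append site_commute word_linear)
qed

lemma word_left:
  "word (False # w) \<phi> 0 + c * d * word (True # w) \<phi> 0 = (1 + c) * (1 + d) * word w \<phi> 0"
  by (simp add: site_left)

lemma word_right: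
  assumes "right_vector \<phi>"
  shows "word (w @ [True]) \<phi> j + a * b * word (w @ [False]) \<phi> j = (1 + a) * (1 + b) * word w \<phi> j"
proof -
  have "(\<lambda>j. 1 * site True \<phi> j + a * b * site False \<phi> j) = (\<lambda>j. (1 + a) * (1 + b) * \<phi> j + 0 * \<phi> j)"
    using site_right[OF assms] by auto
  then have "word w (\<lambda>j. 1 * site True \<phi> j + a * b * site False \<phi> j) j
      = word w (\<lambda>j. (1 + a) * (1 + b) * \<phi> j + 0 * \<phi> j) j" by simp
  then show ?thesis unfolding word_linear by (simp add: word_append)
qed

definition positive :: "nat \<Rightarrow> (nat \<Rightarrow> real) \<Rightarrow> bool" where
  "positive n \<phi> \<longleftrightarrow> (\<forall>w. length w = n \<longrightarrow> 0 < word w \<phi> 0)"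

text \<open>
  Moving the hole in \<open>1\<^sup>n 0\<close> to the left end with the bulk relation only produces nonnegative terms.
\<close>

lemma sweep_hole:
  assumes "positive n \<phi>" "i \<le> n"
  shows "q ^ i * word (replicate (n - i) True @ False # replicate i True) \<phi> 0
    \<le> word (replicate n True @ [False]) \<phi> 0"
  using assms(2)
proof (induction i)
  case (Suc i)
  let ?u = "replicate (n - Suc i) True" and ?v = "replicate i True"
  have "replicate (n - i) True = ?u @ [True]"
    using Suc.prems by (metis Suc_diff_Suc Suc_le_lessD replicate_Suc replicate_append_same)
  then have eq: "word (replicate (n - i) True @ False # ?v) \<phi> 0
      = q * word (?u @ False # True # ?v) \<phi> 0 + (1 - q) * (word (?u @ True # ?v) \<phi> 0 + word (?u @ False # ?v) \<phi> 0)"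
    using word_bulk[of ?u ?v \<phi>] by simp
  have "0 < word (?u @ True # ?v) \<phi> 0" "0 < word (?u @ False # ?v) \<phi> 0"
    using assms(1) Suc.prems by (auto simp: positive_def)
  then have "q * word (?u @ False # True # ?v) \<phi> 0 \<le> word (replicate (n - i) True @ False # ?v) \<phi> 0"
    unfolding eq using q by simp
  then have "q ^ i * (q * word (?u @ False # True # ?v) \<phi> 0)
      \<le> q ^ i * word (replicate (n - i) True @ False # ?v) \<phi> 0"
    using q_power by (intro mult_left_mono)
  also have "\<dots> \<le> word (replicate n True @ [False]) \<phi> 0" using Suc by simp
  finally show ?case by (simp add: mult_ac)
qed simp

text \<open>The right relation expresses the weight of \<open>1^(n+1)\<close> through those of
  \<open>1^n\<close> and \<open>1^n 0\<close>; sweeping the hole bounds the latter below by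
  \<open>q^n\<close> times that of \<open>0 1^n\<close>, and the left relation returns to
  \<open>1^n\<close> and \<open>1^(n+1)\<close>. As \<open>a b\<close> and \<open>c d\<close> are
  nonpositive, all terms in the weight of \<open>1^n\<close> are nonnegative, and the sign of
  \<open>1 - a b c d q^n\<close> is all that is left to decide.\<close>

lemma full_word_step:
  assumes "right_vector \<phi>" "positive n \<phi>"
  shows "0 < (1 - a * b * c * d * q ^ n) * word (replicate (Suc n) True) \<phi> 0"
proof -
  let ?W = "replicate n True"
  let ?F = "word ?W \<phi> 0" and ?D = "word (replicate (Suc n) True) \<phi> 0"
    and ?E = "word (?W @ [False]) \<phi> 0"
  have F: "0 < ?F" using assms(2) by (simp add: positive_def)
  have R: "?D + a * b * ?E = (1 + a) * (1 + b) * ?F"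
    using word_right[OF assms(1), of ?W 0] by (simp add: replicate_append_same)
  have "q ^ n * ((1 + c) * (1 + d) * ?F - c * d * ?D) \<le> ?E"
  proof -
    have "word (False # ?W) \<phi> 0 = (1 + c) * (1 + d) * ?F - c * d * ?D"
      using word_left[of ?W \<phi>] by simp
    then show ?thesis using sweep_hole[OF assms(2), of n] by simp
  qed
  then have "(- (a * b)) * (q ^ n * ((1 + c) * (1 + d) * ?F - c * d * ?D)) \<le> (- (a * b)) * ?E"
    using signs(1) by (intro mult_left_mono) auto
  moreover have "0 \<le> (- (a * b)) * (q ^ n * ((1 + c) * (1 + d) * ?F))"
    using signs F q_power[of n] by (simp add: mult_nonneg_nonneg mult_nonpos_nonneg)
  moreover have "0 < (1 + a) * (1 + b) * ?F" using signs F by simp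
  ultimately show ?thesis using R by (simp add: algebra_simps)
qed

lemma positive_T:
  assumes "positive (Suc n) \<phi>"
  shows "positive n (T \<phi>)"
  unfolding positive_def
proof (intro allI impI)
  fix w :: "bool list"
  assume "length w = n"
  then have "0 < word (w @ [True]) \<phi> 0" "0 < word (w @ [False]) \<phi> 0"
    using assms by (auto simp: positive_def)
  then show "0 < word w (T \<phi>) 0"
    using word_linear[of w 1 "site True \<phi>" 1 "site False \<phi>"]
    by (simp add: T_def[abs_def] word_append)
qed

lemma positive_T_pow:
  assumes "positive (n + k) \<phi>"
  shows "positive n ((T ^^ k) \<phi>)"
  using assms by (induction k arbitrary: n) (auto intro: positive_T)

section \<open>The order given by fully occupied words\<close>

definition cone :: "(nat \<Rightarrow> real) \<Rightarrow> bool" where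
  "cone \<psi> \<longleftrightarrow> (\<forall>j. 0 \<le> word (replicate j True) \<psi> 0)"

lemma full_word_Suc: "word (replicate (Suc j) True) \<psi> = word (replicate j True) (site True \<psi>)"
  by (simp add: word_append flip: replicate_append_same)

lemma cone_site_True: "cone \<psi> \<Longrightarrow> cone (site True \<psi>)"
  unfolding cone_def by (simp only: full_word_Suc[symmetric]) blast

lemma cone_nonneg: "cone \<psi> \<Longrightarrow> 0 \<le> \<psi> 0"
  unfolding cone_def by (metis replicate_0 word.simps(1))

text \<open>A hole at the right end travels left by the bulk relation and is absorbed at the wall by
  \<open>site False = (1 + c) (1 + d) - c d site True\<close>. Every coefficient is nonnegative, so
  signs on the words \<open>1^j\<close> control those on \<open>1^j 0\<close>. Generalising over
  \<open>\<psi>\<close> lets the induction also use the shifted vector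
  \<open>site True \<psi>\<close>.\<close>

lemma full_word_site_False:
  assumes "cone \<psi>"
  shows "0 \<le> word (replicate j True) (site False \<psi>) 0"
  using assms
proof (induction j arbitrary: \<psi>)
  case 0
  have "site False \<psi> 0 = (1 + c) * (1 + d) * \<psi> 0 + (- (c * d)) * site True \<psi> 0"
    using site_left[of \<psi>] by simp
  moreover have "0 \<le> \<psi> 0" "0 \<le> site True \<psi> 0"
    using 0 by (auto intro: cone_nonneg cone_site_True)
  moreover from this have "0 \<le> (1 + c) * (1 + d) * \<psi> 0" "0 \<le> (- (c * d)) * site True \<psi> 0"
    using signs by (auto intro: mult_nonneg_nonneg simp: mult_nonpos_nonneg)
  ultimately have "0 \<le> site False \<psi> 0" by linarith
  then show ?case by simp
next
  case (Suc j)
  let ?W = "replicate j True"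
  have "word (replicate (Suc j) True) (site False \<psi>) 0
      = q * word ?W (site False (site True \<psi>)) 0 + (1 - q) * word ?W (T \<psi>) 0"
    unfolding full_word_Suc site_commute word_linear by simp
  moreover have "word ?W (T \<psi>) 0 = word (replicate (Suc j) True) \<psi> 0 + word ?W (site False \<psi>) 0"
    using word_linear[of ?W 1 "site True \<psi>" 1 "site False \<psi>"]
    unfolding full_word_Suc by (simp add: T_def[abs_def])
  moreover have "0 \<le> word (replicate (Suc j) True) \<psi> 0" using Suc.prems unfolding cone_def by blast
  ultimately show ?case
    using Suc.IH[OF cone_site_True[OF Suc.prems]] Suc.IH[OF Suc.prems] q by simp
qed

lemma cone_T:
  assumes "cone \<psi>" shows "cone (T \<psi>)"
  unfolding cone_def
proof
  fix j
  have "word (replicate j True) (T \<psi>) 0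
      = word (replicate (Suc j) True) \<psi> 0 + word (replicate j True) (site False \<psi>) 0"
    using word_linear[of _ 1 "site True \<psi>" 1 "site False \<psi>"]
    unfolding full_word_Suc by (simp add: T_def[abs_def])
  moreover have "0 \<le> word (replicate (Suc j) True) \<psi> 0" using assms unfolding cone_def by blast
  ultimately show "0 \<le> word (replicate j True) (T \<psi>) 0"
    using full_word_site_False[OF assms] by simp
qed

lemma cone_T_pow: "cone \<psi> \<Longrightarrow> cone ((T ^^ n) \<psi>)"
  by (induction n) (auto intro: cone_T)

lemma full_word_geom: "word (replicate j True) (geom x) = (\<lambda>i. (1 + x) ^ j * geom x i)"
proof (induction j)
  case (Suc j)
  have "word (replicate (Suc j) True) (geom x) = site True (\<lambda>i. (1 + x) ^ j * geom x i)"
    using Suc by simp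
  also have "\<dots> = (\<lambda>i. (1 + x) ^ Suc j * geom x i)"
    by (auto simp: site_def X_def geom_def algebra_simps)
  finally show ?case .
qed simp

text \<open>\<open>T\<close> preserves the cone, so partition functions can be compared by looking
  at full words only; on geometric vectors these are just the numbers
  \<open>(1 + x) ^ j\<close>.\<close>

lemma T_pow_mono:
  assumes "\<And>j. word (replicate j True) \<phi> 0 \<le> word (replicate j True) \<psi> 0"
  shows "(T ^^ n) \<phi> 0 \<le> (T ^^ n) \<psi> 0"
proof -
  have "cone (\<lambda>j. 1 * \<psi> j + (-1) * \<phi> j)"
    unfolding cone_def word_linear using assms by simp
  from cone_nonneg[OF cone_T_pow[OF this]] show ?thesis
    unfolding T_pow_linear by simp
qed

lemma \<Lambda>_pos: "0 < \<Lambda>"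
  using cd by (simp add: \<Lambda>_def add_pos_pos)

text \<open>On \<open>geom x\<close> the operator \<open>T\<close> acts by a factor
  \<open>\<mu> < \<Lambda>\<close>, since \<open>1 / c < x < c\<close>, plus a nonnegative multiple
  of \<open>geom (q * x)\<close>. The latter lies below \<open>geom (1 / c)\<close> in the order of
  the cone, because \<open>q x \<le> 1 / c\<close>, and so contributes at most
  \<open>\<Lambda>^n\<close>.\<close>

lemma geom_T_pow_bound:
  assumes x: "1 / c < x" "x \<le> 1" "q * x \<le> 1 / c"
  shows "\<exists>B. \<forall>n. (T ^^ n) (geom x) 0 \<le> B * \<Lambda> ^ n"
proof -
  have x0: "0 < x" using x(1) cd by (meson divide_pos_pos less_trans zero_less_one)
  define \<mu> where "\<mu> = 2 + x + 1 / x"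
  define \<kappa> where "\<kappa> = (c * x - 1) * (1 - d * x) / x"
  have "0 \<le> \<kappa>"
    unfolding \<kappa>_def using x x0 cd mult_nonpos_nonneg[of d x]
    by (intro divide_nonneg_pos mult_nonneg_nonneg) (auto simp: field_simps)
  have "\<Lambda> - \<mu> = (c * x - 1) * (c - x) / (c * x)"
    using x0 cd by (simp add: \<Lambda>_def \<mu>_def field_simps)
  moreover have "0 < (c * x - 1) * (c - x) / (c * x)"
    using x x0 cd by (intro divide_pos_pos mult_pos_pos) (auto simp: field_simps)
  ultimately have gap: "\<mu> < \<Lambda>" by linarith
  have \<mu>0: "0 \<le> \<mu>" using x0 by (simp add: \<mu>_def)
  note \<Lambda>0 = \<Lambda>_pos
  define B where "B = max 1 (\<kappa> / (\<Lambda> - \<mu>))"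
  have "\<kappa> / (\<Lambda> - \<mu>) \<le> B" by (simp add: B_def)
  then have B: "\<kappa> \<le> B * (\<Lambda> - \<mu>)" using gap by (simp add: pos_divide_le_eq)
  have T: "T (geom x) = (\<lambda>j. \<mu> * geom x j + \<kappa> * geom (q * x) j)"
    using x0 by (auto simp: T_eq geom_S \<mu>_def \<kappa>_def algebra_simps)
  have "(T ^^ n) (geom x) 0 \<le> B * \<Lambda> ^ n" for n
  proof (induction n)
    case 0
    then show ?case by (simp add: geom_def B_def)
  next
    case (Suc n)
    have "(T ^^ n) (geom (q * x)) 0 \<le> (T ^^ n) (geom (1 / c)) 0"
    proof (rule T_pow_mono)
      fix j
      have "(1 + q * x) ^ j \<le> (1 + 1 / c) ^ j" using x q x0 by (intro power_mono) auto
      then show "word (replicate j True) (geom (q * x)) 0 \<le> word (replicate j True) (geom (1 / c)) 0"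
        by (simp add: full_word_geom geom_def)
    qed
    then have le: "(T ^^ n) (geom (q * x)) 0 \<le> \<Lambda> ^ n" by (simp add: geom_T_pow geom_def)
    have "(T ^^ Suc n) (geom x) 0 = \<mu> * (T ^^ n) (geom x) 0 + \<kappa> * (T ^^ n) (geom (q * x)) 0"
      unfolding funpow_Suc_right o_def T T_pow_linear ..
    also have "\<dots> \<le> \<mu> * (B * \<Lambda> ^ n) + \<kappa> * \<Lambda> ^ n"
      using Suc le \<mu>0 \<open>0 \<le> \<kappa>\<close> by (intro add_mono mult_left_mono)
    also have "\<dots> \<le> \<mu> * (B * \<Lambda> ^ n) + B * (\<Lambda> - \<mu>) * \<Lambda> ^ n"
      using B \<Lambda>0 by (intro add_left_mono mult_right_mono) auto
    finally show ?case by (simp add: algebra_simps)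
  qed
  then show ?thesis by blast
qed

text \<open>
  A vector that is positive on all words \<open>1\<^sup>j\<close> dominates, in the order of the cone, a combination
  \<open>\<kappa> (geom (1/c) - \<epsilon> geom x)\<close>, and the second term cannot cancel the growth of the first.
\<close>

lemma T_pow_lower_bound:
  assumes pos: "\<And>j. 0 < word (replicate j True) \<psi> 0"
  shows "\<exists>\<kappa>>0. \<forall>n. \<kappa> * \<Lambda> ^ n \<le> (T ^^ n) \<psi> 0"
proof -
  \<comment> \<open>A ratio above \<open>1 / c\<close> with \<open>x \<le> 1\<close> and
    \<open>q x \<le> 1 / c\<close>; the last condition rests on
    \<open>q (2 - q) = 1 - (1 - q)^2\<close>.\<close>
  define x where "x = (1 + (1 - q) * min 1 (c - 1)) / c"
  have m: "0 < (1 - q) * min 1 (c - 1)" "(1 - q) * min 1 (c - 1) \<le> c - 1"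
     "(1 - q) * min 1 (c - 1) \<le> 1 - q"
    using q cd by (auto simp: mult_left_le_one_le mult_left_le min_def intro: mult_right_mono[of _ 1, simplified])
  have x1: "1 / c < x" "x \<le> 1"
    using m cd by (auto simp: x_def divide_strict_right_mono)
  have "q * (1 + (1 - q) * min 1 (c - 1)) \<le> q * (1 + (1 - q))"
    using m q by (intro mult_left_mono) auto
  also have "\<dots> = 1 - (1 - q)\<^sup>2" by (simp add: power2_eq_square algebra_simps)
  also have "\<dots> \<le> 1" by simp
  finally have x2: "q * x \<le> 1 / c" using cd by (simp add: x_def divide_right_mono)
  obtain B where B: "\<And>n. (T ^^ n) (geom x) 0 \<le> B * \<Lambda> ^ n"
    using geom_T_pow_bound[OF x1 x2] by blast
  note \<Lambda> = \<Lambda>_pos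
  \<comment> \<open>The ratio of the two vectors on words \<open>1^j\<close> is \<open>s^j\<close>.
    With \<open>\<epsilon> = s^J\<close> the subtracted multiple of \<open>geom x\<close> dominates
    for \<open>j > J\<close>, and \<open>J\<close> is taken so large that it removes at most half of
    the growth \<open>\<Lambda>^n\<close>.\<close>
  define s where "s = (1 + 1 / c) / (1 + x)"
  have x0: "0 < x" using x1(1) cd by (meson divide_pos_pos less_trans zero_less_one)
  have s: "0 < s" "s < 1"
    using x0 x1 cd by (simp_all add: s_def add_pos_pos pos_divide_less_eq del: divide_less_eq_1_pos)
  have "(\<lambda>J. s ^ J * B) \<longlonglongrightarrow> 0 * B"
    using s by (intro tendsto_intros LIMSEQ_realpow_zero) auto
  then have "eventually (\<lambda>J. s ^ J * B < 1 / 2) sequentially" by (rule order_tendstoD) auto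
  then obtain J where J: "s ^ J * B < 1 / 2" by (auto simp: eventually_sequentially)
  \<comment> \<open>Only finitely many words are left to compare, because for \<open>j > J\<close>
    the vector \<open>\<xi>\<close> is nonpositive on \<open>1^j\<close>.\<close>
  define \<kappa> where "\<kappa> = Min ((\<lambda>j. word (replicate j True) \<psi> 0 / (1 + 1 / c) ^ j) ` {..J})"
  have c1: "0 < 1 + 1 / c" using cd by (simp add: add_pos_pos)
  have \<kappa>: "0 < \<kappa>" unfolding \<kappa>_def using pos c1 by (subst Min_gr_iff) auto
  have \<kappa>_le: "\<kappa> * (1 + 1 / c) ^ j \<le> word (replicate j True) \<psi> 0" if "j \<le> J" for j
  proof -
    have "\<kappa> \<le> word (replicate j True) \<psi> 0 / (1 + 1 / c) ^ j"
      unfolding \<kappa>_def using that by (intro Min_le) auto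
    then show ?thesis using c1 by (simp add: pos_le_divide_eq)
  qed
  define \<xi> where "\<xi> = (\<lambda>j. \<kappa> * geom (1 / c) j + (- (\<kappa> * s ^ J)) * geom x j)"
  have le: "word (replicate j True) \<xi> 0 \<le> word (replicate j True) \<psi> 0" for j
  proof -
    have eq: "word (replicate j True) \<xi> 0 = \<kappa> * (1 + 1 / c) ^ j - \<kappa> * s ^ J * (1 + x) ^ j"
      unfolding \<xi>_def word_linear by (simp add: full_word_geom geom_def)
    show ?thesis
    proof (cases "j \<le> J")
      case True
      have "0 \<le> \<kappa> * s ^ J * (1 + x) ^ j" using \<kappa> s x0 by simp
      then show ?thesis using eq \<kappa>_le[OF True] by linarith
    next
      case False
      have "(1 + 1 / c) ^ j = s ^ j * (1 + x) ^ j" using x0 by (simp add: s_def power_divide)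
      also have "\<dots> \<le> s ^ J * (1 + x) ^ j"
        using False s x0 by (intro mult_right_mono power_decreasing) auto
      finally have "\<kappa> * (1 + 1 / c) ^ j \<le> \<kappa> * (s ^ J * (1 + x) ^ j)"
        using \<kappa> by (intro mult_left_mono) auto
      then show ?thesis using eq pos[of j] by (simp add: mult_ac)
    qed
  qed
  have "\<kappa> / 2 * \<Lambda> ^ n \<le> (T ^^ n) \<psi> 0" for n
  proof -
    have "s ^ J * (T ^^ n) (geom x) 0 \<le> s ^ J * (B * \<Lambda> ^ n)" using s B by (intro mult_left_mono) auto
    also have "\<dots> = (s ^ J * B) * \<Lambda> ^ n" by simp
    also have "\<dots> \<le> 1 / 2 * \<Lambda> ^ n" using J \<Lambda> by (intro mult_right_mono) auto
    finally have "\<kappa> * (s ^ J * (T ^^ n) (geom x) 0) \<le> \<kappa> * (1 / 2 * \<Lambda> ^ n)"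
      using \<kappa> by (intro mult_left_mono) auto
    moreover have "(T ^^ n) \<xi> 0 = \<kappa> * \<Lambda> ^ n - \<kappa> * (s ^ J * (T ^^ n) (geom x) 0)"
      unfolding \<xi>_def T_pow_linear by (simp add: geom_T_pow geom_def)
    ultimately show ?thesis using T_pow_mono[OF le, of n] by simp
  qed
  then show ?thesis using \<kappa> by (intro exI[of _ "\<kappa> / 2"]) auto
qed

section \<open>Solutions of the right boundary relation\<close>

function start_vector :: "nat \<Rightarrow> nat \<Rightarrow> real" where
  "start_vector k0 j = (if j < k0 then 0 else if j = k0 then 1 else
     ((a + b - a * b * q ^ (j - 1) * (c + d)) * start_vector k0 (j - 1)
       - a * b * (1 - q ^ (j - 1)) * start_vector k0 (j - 2)) / (1 - a * b * c * d * q ^ (j - 1)))"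
  by auto
termination by (relation "Wellfounded.measure snd") auto

declare start_vector.simps [simp del]

text \<open>The right relation at index \<open>j\<close> determines \<open>\<phi> (Suc j)\<close>
  with coefficient \<open>1 - a b c d q^j\<close>. Where this vanishes,
  \<open>\<phi> (Suc j)\<close> is free, so a solution can be started there from zeros. The
  truncated index \<open>j - 2\<close> at \<open>j = 1\<close> is harmless, since its coefficient is
  \<open>1 - q ^ 0\<close>.\<close>

lemma right_vector_start_vector:
  assumes "k0 = 0 \<or> a * b * c * d * q ^ (k0 - 1) = 1"
    and "\<And>j. j \<ge> k0 \<Longrightarrow> a * b * c * d * q ^ j \<noteq> 1"
  shows "right_vector (start_vector k0)"
  unfolding right_vector_def
proof
  fix j
  let ?f = "start_vector k0"
  consider "Suc j < k0" | "Suc j = k0" | "j \<ge> k0" by linarith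
  then show "X ?f j + a * b * Y ?f j = (a + b) * ?f j"
  proof cases
    case 1
    then show ?thesis by (simp add: X_def Y_def start_vector.simps)
  next
    \<comment> \<open>The only equation in which the initial \<open>1\<close> meets the zeros before
      it; it holds because the coefficient of the \<open>1\<close> is zero.\<close>
    case 2
    then have "?f (Suc j) = 1" "?f j = 0" "?f (j - 1) = 0" "a * b * c * d * q ^ j = 1"
      using assms(1) by (auto simp: start_vector.simps)
    then show ?thesis by (simp add: X_def Y_def mult_ac)
  next
    case 3
    have "?f (Suc j) * (1 - a * b * c * d * q ^ j)
        = (a + b - a * b * q ^ j * (c + d)) * ?f j - a * b * (1 - q ^ j) * ?f (j - 1)"
      using assms(2)[OF 3] 3 by (subst start_vector.simps) simp
    then show ?thesis by (simp add: X_def Y_def algebra_simps)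
  qed
qed

end

section \<open>Finite Markov chains and irreducibility\<close>

definition balanced :: "'a set \<Rightarrow> ('a \<Rightarrow> 'a \<Rightarrow> real) \<Rightarrow> ('a \<Rightarrow> real) \<Rightarrow> bool" where
  "balanced V r f \<longleftrightarrow> (\<forall>y\<in>V. (\<Sum>x\<in>V. f x * r x y) = f y * (\<Sum>x\<in>V. r y x))"

lemma balanced_linear:
  assumes "balanced V r f" "balanced V r g"
  shows "balanced V r (\<lambda>x. s * f x + t * g x)"
proof -
  have "(\<Sum>x\<in>V. (s * f x + t * g x) * r x y) = s * (\<Sum>x\<in>V. f x * r x y) + t * (\<Sum>x\<in>V. g x * r x y)"
    for y by (simp add: sum.distrib sum_distrib_left algebra_simps)
  then show ?thesis using assms by (simp add: balanced_def algebra_simps)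
qed

locale finite_chain =
  fixes V :: "'a set" and r :: "'a \<Rightarrow> 'a \<Rightarrow> real"
  assumes finite_V: "finite V"
    and rate_nonneg: "0 \<le> r x y"
    and irreducible: "x \<in> V \<Longrightarrow> y \<in> V \<Longrightarrow> (x, y) \<in> {(x, y). x \<in> V \<and> y \<in> V \<and> 0 < r x y}\<^sup>*"
begin

text \<open>Both sides of \<open>\<bar>f y\<bar> \<Sum> r y x \<le> \<Sum> \<bar>f x\<bar> r x y\<close> have the same sum over \<open>y\<close>.\<close>

lemma balanced_abs:
  assumes "balanced V r f"
  shows "balanced V r (\<lambda>x. \<bar>f x\<bar>)"
proof -
  let ?g = "\<lambda>y. (\<Sum>x\<in>V. \<bar>f x\<bar> * r x y) - \<bar>f y\<bar> * (\<Sum>x\<in>V. r y x)"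
  have "0 \<le> ?g y" if "y \<in> V" for y
  proof -
    have "\<bar>f y\<bar> * (\<Sum>x\<in>V. r y x) = \<bar>f y * (\<Sum>x\<in>V. r y x)\<bar>"
      using rate_nonneg by (simp add: abs_mult sum_nonneg)
    also have "\<dots> = \<bar>\<Sum>x\<in>V. f x * r x y\<bar>" using assms that by (simp add: balanced_def)
    also have "\<dots> \<le> (\<Sum>x\<in>V. \<bar>f x * r x y\<bar>)" by (rule sum_abs)
    also have "\<dots> = (\<Sum>x\<in>V. \<bar>f x\<bar> * r x y)" using rate_nonneg by (simp add: abs_mult)
    finally show ?thesis by simp
  qed
  moreover have "(\<Sum>y\<in>V. ?g y) = 0"
    unfolding sum_subtractf by (subst sum.swap) (simp add: sum_distrib_left)
  ultimately have "\<forall>y\<in>V. ?g y = 0"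
    using sum_nonneg_eq_0_iff[OF finite_V, of ?g] by blast
  then show ?thesis by (simp add: balanced_def)
qed

lemma balanced_positive_nonneg:
  assumes "balanced V r f" "\<And>x. x \<in> V \<Longrightarrow> 0 \<le> f x" "x \<in> V" "0 < f x" "y \<in> V"
  shows "0 < f y"
  using irreducible[OF assms(3,5)]
proof (induction rule: rtrancl_induct)
  case (step y z)
  then have yz: "y \<in> V" "z \<in> V" "0 < r y z" by auto
  have "0 < f y * r y z" using step yz by simp
  also have "f y * r y z \<le> (\<Sum>x\<in>V. f x * r x z)"
    using yz assms(2) rate_nonneg finite_V by (intro member_le_sum) auto
  also have "\<dots> = f z * (\<Sum>x\<in>V. r z x)" using assms(1) yz by (simp add: balanced_def)
  finally show ?case using assms(2)[OF yz(2)] by (cases "f z = 0") auto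
qed (use assms in auto)

text \<open>\<open>\<bar>f\<bar> + f\<close> is balanced and nonnegative, hence positive everywhere
  once it is positive somewhere; its zeros would be the points where
  \<open>f \<le> 0\<close>.\<close>

lemma balanced_definite:
  assumes "balanced V r f" "x \<in> V" "0 < f x" "y \<in> V"
  shows "0 < f y"
proof -
  have "balanced V r (\<lambda>x. 1 * \<bar>f x\<bar> + 1 * f x)"
    by (rule balanced_linear[OF balanced_abs[OF assms(1)] assms(1)])
  then have "0 < 1 * \<bar>f y\<bar> + 1 * f y"
    by (rule balanced_positive_nonneg[OF _ _ assms(2) _ assms(4)]) (use assms(3) in auto)
  then show ?thesis by linarith
qed

text \<open>A difference of two balanced functions that is positive at one point is positive at all
  of them, against equal totals.\<close>

lemma balanced_unique:
  assumes "balanced V r f" "balanced V r g" "sum f V = sum g V" "x \<in> V"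
  shows "f x = g x"
proof (rule ccontr)
  have no: False if bal: "balanced V r f" "balanced V r g" and eq: "sum f V = sum g V"
      and gt: "g x < f x" for f g
  proof -
    have "balanced V r (\<lambda>x. 1 * f x + (-1) * g x)" by (rule balanced_linear[OF bal])
    then have "0 < 1 * f y + (-1) * g y" if "y \<in> V" for y
      by (rule balanced_definite[OF _ assms(4) _ that]) (use gt in simp)
    then have "g y < f y" if "y \<in> V" for y using that by force
    then have "sum g V < sum f V" using finite_V assms(4) by (intro sum_strict_mono) auto
    then show False using eq by simp
  qed
  assume "f x \<noteq> g x"
  then show False using no[OF assms(1,2,3)] no[OF assms(2,1)] assms(3) by linarith
qed

end

lemma finite_configs: "finite (configs n)"
proof -
  have "\<tau> \<in> (\<lambda>A i. i \<in> A) ` Pow {..<n}" if "\<tau> \<in> configs n" for \<tau>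
    using that by (intro image_eqI[of _ _ "{i. \<tau> i}"]) (auto simp: configs_def, meson not_less)
  then have "configs n \<subseteq> (\<lambda>A i. i \<in> A) ` Pow {..<n}" by blast
  then show ?thesis by (rule finite_subset) auto
qed

lemma configs_upd: "\<tau> \<in> configs n \<Longrightarrow> i < n \<Longrightarrow> \<tau>(i := x) \<in> configs n"
  by (auto simp: configs_def)

lemma balanced_iff_generator:
  fixes p :: "config \<Rightarrow> real"
  assumes "\<And>g \<tau>. L g \<tau> = (\<Sum>\<tau>'\<in>V. r \<tau> \<tau>' * (g \<tau>' - g \<tau>))" "finite V"
  shows "balanced V r p \<longleftrightarrow> (\<forall>g. (\<Sum>\<tau>\<in>V. p \<tau> * L g \<tau>) = 0)"
proof -
  have eq: "(\<Sum>\<tau>\<in>V. p \<tau> * L g \<tau>)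
      = (\<Sum>y\<in>V. g y * ((\<Sum>x\<in>V. p x * r x y) - p y * (\<Sum>x\<in>V. r y x)))" for g
  proof -
    have "(\<Sum>\<tau>\<in>V. p \<tau> * L g \<tau>) = (\<Sum>x\<in>V. \<Sum>y\<in>V. p x * r x y * g y) - (\<Sum>y\<in>V. \<Sum>x\<in>V. p y * r y x * g y)"
      by (simp add: assms sum_distrib_left right_diff_distrib sum_subtractf mult.assoc)
    also have "(\<Sum>x\<in>V. \<Sum>y\<in>V. p x * r x y * g y) = (\<Sum>y\<in>V. \<Sum>x\<in>V. p x * r x y * g y)"
      by (rule sum.swap)
    finally show ?thesis
      by (simp add: sum_distrib_left right_diff_distrib sum_subtractf mult_ac)
  qed
  show ?thesis
  proof
    assume "\<forall>g. (\<Sum>\<tau>\<in>V. p \<tau> * L g \<tau>) = 0"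
    then have 0: "(\<Sum>y\<in>V. g y * ((\<Sum>x\<in>V. p x * r x y) - p y * (\<Sum>x\<in>V. r y x))) = 0" for g
      unfolding eq by blast
    show "balanced V r p"
      unfolding balanced_def
    proof
      fix z assume "z \<in> V"
      then show "(\<Sum>x\<in>V. p x * r x z) = p z * (\<Sum>x\<in>V. r z x)"
        using 0[of "\<lambda>y. if y = z then 1 else 0"] assms(2) by (simp add: if_distrib[of "\<lambda>x. x * _"] cong: if_cong)
    qed
  next
    assume "balanced V r p"
    then show "\<forall>g. (\<Sum>\<tau>\<in>V. p \<tau> * L g \<tau>) = 0"
      unfolding eq by (auto simp: balanced_def intro!: sum.neutral)
  qed
qed

section \<open>Irreducibility of the exclusion process\<close>

lemma jump_rate_nonneg:
  assumes "0 \<le> \<alpha>" "0 \<le> \<beta>" "0 \<le> \<gamma>" "0 \<le> \<delta>" "0 \<le> q"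
  shows "0 \<le> jump_rate \<alpha> \<beta> \<gamma> \<delta> q n \<tau> \<tau>'"
  unfolding jump_rate_def using assms by (intro add_nonneg_nonneg sum_nonneg) auto

lemma jump_rate_pos:
  assumes "0 < \<alpha>" "0 < \<beta>" "0 \<le> \<gamma>" "0 \<le> \<delta>" "0 \<le> q"
  shows "\<not> \<tau> 0 \<Longrightarrow> 0 < jump_rate \<alpha> \<beta> \<gamma> \<delta> q n \<tau> (\<tau>(0 := True))"
    and "\<tau> (n - 1) \<Longrightarrow> 0 < jump_rate \<alpha> \<beta> \<gamma> \<delta> q n \<tau> (\<tau>(n - 1 := False))"
    and "Suc i < n \<Longrightarrow> \<tau> i \<Longrightarrow> \<not> \<tau> (Suc i)
      \<Longrightarrow> 0 < jump_rate \<alpha> \<beta> \<gamma> \<delta> q n \<tau> (\<tau>(i := False, Suc i := True))"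
proof -
  let ?h = "\<lambda>\<tau>' i. (if \<tau> i \<and> \<not> \<tau> (Suc i) \<and> \<tau>' = \<tau>(i := False, Suc i := True) then 1 else 0)
      + (if \<not> \<tau> i \<and> \<tau> (Suc i) \<and> \<tau>' = \<tau>(i := True, Suc i := False) then q else 0)"
  have h: "0 \<le> ?h \<tau>' i" for \<tau>' i using assms by auto
  then have s: "0 \<le> sum (?h \<tau>') A" for \<tau>' A by (intro sum_nonneg) auto
  have b: "0 \<le> (if P then \<alpha> else 0)" "0 \<le> (if P then \<beta> else 0)" "0 \<le> (if P then \<gamma> else 0)"
    "0 \<le> (if P then \<delta> else 0)" for P
    using assms by auto
  have lower: "(\<Sum>i<n - 1. ?h \<tau>' i) \<le> jump_rate \<alpha> \<beta> \<gamma> \<delta> q n \<tau> \<tau>'"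
    "(if \<not> \<tau> 0 \<and> \<tau>' = \<tau>(0 := True) then \<alpha> else 0) \<le> jump_rate \<alpha> \<beta> \<gamma> \<delta> q n \<tau> \<tau>'"
    "(if \<tau> (n - 1) \<and> \<tau>' = \<tau>(n - 1 := False) then \<beta> else 0) \<le> jump_rate \<alpha> \<beta> \<gamma> \<delta> q n \<tau> \<tau>'" for \<tau>'
    unfolding jump_rate_def
    using s[of \<tau>' "{..<n - 1}"] b(1)[of "\<not> \<tau> 0 \<and> \<tau>' = \<tau>(0 := True)"]
      b(3)[of "\<tau> 0 \<and> \<tau>' = \<tau>(0 := False)"] b(4)[of "\<not> \<tau> (n - 1) \<and> \<tau>' = \<tau>(n - 1 := True)"]
      b(2)[of "\<tau> (n - 1) \<and> \<tau>' = \<tau>(n - 1 := False)"]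
    by linarith+
  show "0 < jump_rate \<alpha> \<beta> \<gamma> \<delta> q n \<tau> (\<tau>(0 := True))" if "\<not> \<tau> 0"
    using lower(2)[of "\<tau>(0 := True)"] assms that by auto
  show "0 < jump_rate \<alpha> \<beta> \<gamma> \<delta> q n \<tau> (\<tau>(n - 1 := False))" if "\<tau> (n - 1)"
    using lower(3)[of "\<tau>(n - 1 := False)"] assms that by auto
  show "0 < jump_rate \<alpha> \<beta> \<gamma> \<delta> q n \<tau> (\<tau>(i := False, Suc i := True))"
    if "Suc i < n" "\<tau> i" "\<not> \<tau> (Suc i)"
  proof -
    let ?\<tau>' = "\<tau>(i := False, Suc i := True)"
    have "0 < ?h ?\<tau>' i" using that by simp
    also have "?h ?\<tau>' i \<le> sum (?h ?\<tau>') {..<n - 1}"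
      using that h by (intro member_le_sum) auto
    finally show ?thesis using lower(1)[of ?\<tau>'] by linarith
  qed
qed

text \<open>A potential for the induction on paths: the weights \<open>u\<close> are chosen so that
  each move considered lowers it.\<close>

definition mass :: "nat \<Rightarrow> (nat \<Rightarrow> nat) \<Rightarrow> config \<Rightarrow> nat" where
  "mass n u \<tau> = (\<Sum>k<n. if \<tau> k then u k else 0)"

lemma mass_upd:
  assumes "i < n"
  shows "mass n u (\<tau>(i := x)) + (if \<tau> i then u i else 0) = mass n u \<tau> + (if x then u i else 0)"
proof -
  have "(\<Sum>k\<in>{..<n} - {i}. if (\<tau>(i := x)) k then u k else 0) = (\<Sum>k\<in>{..<n} - {i}. if \<tau> k then u k else 0)"
    by (intro sum.cong) auto
  then show ?thesis
    using assms by (simp add: mass_def sum.remove[of "{..<n}" i])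
qed

text \<open>The rightmost particle hops right, or leaves from the last site at rate
  \<open>\<beta>\<close>. Only moves whose rates are positive for all admissible parameters occur,
  as \<open>\<gamma>\<close>, \<open>\<delta>\<close> and \<open>q\<close> may be zero.\<close>

lemma reach_empty:
  assumes pos: "0 < \<alpha>" "0 < \<beta>" "0 \<le> \<gamma>" "0 \<le> \<delta>" "0 \<le> q" and "\<tau> \<in> configs n"
  shows "(\<tau>, \<lambda>_. False)
    \<in> {(x, y). x \<in> configs n \<and> y \<in> configs n \<and> 0 < jump_rate \<alpha> \<beta> \<gamma> \<delta> q n x y}\<^sup>*"
  using assms(6)
proof (induction "mass n (\<lambda>i. n - i) \<tau>" arbitrary: \<tau> rule: less_induct)
  case less
  let ?E = "{(x, y). x \<in> configs n \<and> y \<in> configs n \<and> 0 < jump_rate \<alpha> \<beta> \<gamma> \<delta> q n x y}"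
  show ?case
  proof (cases "\<exists>i. \<tau> i")
    case False
    then have "\<tau> = (\<lambda>_. False)" by auto
    then show ?thesis by simp
  next
    case True
    have ub: "i < n" if "\<tau> i" for i using less.prems that by (auto simp: configs_def) (meson not_less)
    have "{i. \<tau> i} \<subseteq> {..<n}" using ub by blast
    then have fin: "finite {i. \<tau> i}" by (rule finite_subset) simp
    define i where "i = Max {i. \<tau> i}"
    have i: "\<tau> i" using Max_in[OF fin] True by (auto simp: i_def)
    have i_max: "\<not> \<tau> j" if "i < j" for j using Max_ge[OF fin, of j] that by (auto simp: i_def)
    have "\<exists>\<tau>'. (\<tau>, \<tau>') \<in> ?E \<and> mass n (\<lambda>i. n - i) \<tau>' < mass n (\<lambda>i. n - i) \<tau>"
    proof (cases "Suc i < n")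
      case True
      let ?\<tau>' = "\<tau>(i := False, Suc i := True)"
      have "mass n (\<lambda>i. n - i) ?\<tau>' < mass n (\<lambda>i. n - i) \<tau>"
      proof -
        have "mass n (\<lambda>i. n - i) (\<tau>(i := False)) + (n - i) = mass n (\<lambda>i. n - i) \<tau>"
          using mass_upd[of i n "\<lambda>i. n - i" \<tau> False] True i by simp
        moreover have "mass n (\<lambda>i. n - i) ?\<tau>' = mass n (\<lambda>i. n - i) (\<tau>(i := False)) + (n - Suc i)"
          using mass_upd[of "Suc i" n "\<lambda>i. n - i" "\<tau>(i := False)" True] True i_max[of "Suc i"] by simp
        ultimately show ?thesis using True by linarith
      qed
      then show ?thesis
        using jump_rate_pos(3)[OF pos True, of \<tau>] True i i_max[of "Suc i"] less.prems
        by (intro exI[of _ ?\<tau>'] conjI) (simp_all add: configs_upd)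
    next
      case False
      then have n: "i = n - 1" "i < n" using ub[OF i] by auto
      let ?\<tau>' = "\<tau>(n - 1 := False)"
      have "mass n (\<lambda>i. n - i) ?\<tau>' < mass n (\<lambda>i. n - i) \<tau>"
        using mass_upd[of i n "\<lambda>i. n - i" \<tau> False] n i by simp
      then show ?thesis
        using jump_rate_pos(2)[OF pos, of \<tau> n] n i less.prems
        by (intro exI[of _ ?\<tau>'] conjI) (simp_all add: configs_upd)
    qed
    then obtain \<tau>' where "(\<tau>, \<tau>') \<in> ?E" "mass n (\<lambda>i. n - i) \<tau>' < mass n (\<lambda>i. n - i) \<tau>" by blast
    moreover from this have "(\<tau>', \<lambda>_. False) \<in> ?E\<^sup>*" using less.hyps by blast
    ultimately show ?thesis by (meson converse_rtrancl_into_rtrancl)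
  qed
qed

text \<open>The path is built backwards from its end: the leftmost particle arrived last, either by
  a hop from its left neighbour or by entering at rate \<open>\<alpha>\<close>.\<close>

lemma reach_from_empty:
  assumes pos: "0 < \<alpha>" "0 < \<beta>" "0 \<le> \<gamma>" "0 \<le> \<delta>" "0 \<le> q" and "\<tau> \<in> configs n"
  shows "(\<lambda>_. False, \<tau>)
    \<in> {(x, y). x \<in> configs n \<and> y \<in> configs n \<and> 0 < jump_rate \<alpha> \<beta> \<gamma> \<delta> q n x y}\<^sup>*"
  using assms(6)
proof (induction "mass n Suc \<tau>" arbitrary: \<tau> rule: less_induct)
  case less
  let ?E = "{(x, y). x \<in> configs n \<and> y \<in> configs n \<and> 0 < jump_rate \<alpha> \<beta> \<gamma> \<delta> q n x y}"
  show ?case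
  proof (cases "\<exists>i. \<tau> i")
    case False
    then have "\<tau> = (\<lambda>_. False)" by auto
    then show ?thesis by simp
  next
    case True
    have ub: "i < n" if "\<tau> i" for i using less.prems that by (auto simp: configs_def) (meson not_less)
    define i where "i = (LEAST i. \<tau> i)"
    have i: "\<tau> i" using True unfolding i_def by (rule LeastI_ex)
    have i_min: "\<not> \<tau> j" if "j < i" for j using that not_less_Least unfolding i_def by blast
    have "\<exists>\<tau>'. (\<tau>', \<tau>) \<in> ?E \<and> mass n Suc \<tau>' < mass n Suc \<tau>"
    proof (cases i)
      case 0
      let ?\<tau>' = "\<tau>(0 := False)"
      have "?\<tau>'(0 := True) = \<tau>" using i 0 by (auto simp: fun_eq_iff)
      moreover have "mass n Suc ?\<tau>' < mass n Suc \<tau>"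
        using mass_upd[of 0 n Suc \<tau> False] i ub[OF i] 0 by simp
      ultimately show ?thesis
        using jump_rate_pos(1)[OF pos, of ?\<tau>' n] ub[OF i] 0 less.prems
        by (intro exI[of _ ?\<tau>'] conjI) (simp_all add: configs_upd)
    next
      case (Suc j)
      let ?\<tau>' = "\<tau>(Suc j := False, j := True)"
      have eq: "?\<tau>'(j := False, Suc j := True) = \<tau>" using i i_min[of j] Suc by (auto simp: fun_eq_iff)
      moreover have "mass n Suc ?\<tau>' < mass n Suc \<tau>"
      proof -
        have "mass n Suc (\<tau>(Suc j := False)) + Suc (Suc j) = mass n Suc \<tau>"
          using mass_upd[of "Suc j" n Suc \<tau> False] ub[OF i] i Suc by simp
        moreover have "mass n Suc ?\<tau>' = mass n Suc (\<tau>(Suc j := False)) + Suc j"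
          using mass_upd[of j n Suc "\<tau>(Suc j := False)" True] ub[OF i] Suc i_min[of j] by simp
        ultimately show ?thesis by linarith
      qed
      moreover have "0 < jump_rate \<alpha> \<beta> \<gamma> \<delta> q n ?\<tau>' \<tau>"
        using jump_rate_pos(3)[OF pos, of j n ?\<tau>'] ub[OF i] Suc unfolding eq by auto
      ultimately show ?thesis
        using ub[OF i] Suc less.prems
        by (intro exI[of _ ?\<tau>'] conjI) (simp_all add: configs_upd)
    qed
    then obtain \<tau>' where "(\<tau>', \<tau>) \<in> ?E" "mass n Suc \<tau>' < mass n Suc \<tau>" by blast
    moreover from this have "(\<lambda>_. False, \<tau>') \<in> ?E\<^sup>*" using less.hyps by blast
    ultimately show ?thesis by (meson rtrancl_into_rtrancl)
  qed
qed

lemma asep_chain: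
  assumes "0 < \<alpha>" "0 < \<beta>" "0 \<le> \<gamma>" "0 \<le> \<delta>" "0 \<le> q"
  shows "finite_chain (configs n) (jump_rate \<alpha> \<beta> \<gamma> \<delta> q n)"
proof
  show "0 \<le> jump_rate \<alpha> \<beta> \<gamma> \<delta> q n x y" for x y using assms by (intro jump_rate_nonneg) auto
  show "(x, y) \<in> {(x, y). x \<in> configs n \<and> y \<in> configs n \<and> 0 < jump_rate \<alpha> \<beta> \<gamma> \<delta> q n x y}\<^sup>*"
    if "x \<in> configs n" "y \<in> configs n" for x y
    by (rule rtrancl_trans[OF reach_empty[OF assms that(1)] reach_from_empty[OF assms that(2)]])
qed (rule finite_configs)

section \<open>The matrix product solves the balance equations\<close>

text \<open>Summation by parts along an involution; every jump of the process swaps two neighbouring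
  sites or flips a boundary site.\<close>

lemma sum_change_variable:
  fixes f g p :: "'a \<Rightarrow> real"
  assumes "finite V" "\<And>\<tau>. \<tau> \<in> V \<Longrightarrow> s \<tau> \<in> V" "\<And>\<tau>. \<tau> \<in> V \<Longrightarrow> s (s \<tau>) = \<tau>"
  shows "(\<Sum>\<tau>\<in>V. f \<tau> * (p \<tau> * (g (s \<tau>) - g \<tau>)))
    = (\<Sum>\<tau>\<in>V. g \<tau> * (f (s \<tau>) * p (s \<tau>) - f \<tau> * p \<tau>))"
proof -
  have "(\<Sum>\<tau>\<in>V. f \<tau> * p \<tau> * g (s \<tau>)) = (\<Sum>\<tau>\<in>V. f (s \<tau>) * p (s \<tau>) * g \<tau>)"
    by (rule sum.reindex_bij_witness[of _ s s]) (use assms in auto)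
  then show ?thesis
    by (simp add: right_diff_distrib sum_subtractf mult_ac)
qed

definition swap_sites :: "nat \<Rightarrow> config \<Rightarrow> config" where
  "swap_sites i \<tau> = \<tau>(i := \<tau> (Suc i), Suc i := \<tau> i)"

definition flip_site :: "nat \<Rightarrow> config \<Rightarrow> config" where
  "flip_site i \<tau> = \<tau>(i := \<not> \<tau> i)"

lemma swap_sites: "swap_sites i (swap_sites i \<tau>) = \<tau>" "Suc i < n \<Longrightarrow> \<tau> \<in> configs n \<Longrightarrow> swap_sites i \<tau> \<in> configs n"
  by (auto simp: swap_sites_def fun_eq_iff configs_def)

lemma flip_site: "flip_site i (flip_site i \<tau>) = \<tau>" "i < n \<Longrightarrow> \<tau> \<in> configs n \<Longrightarrow> flip_site i \<tau> \<in> configs n"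
  by (auto simp: flip_site_def fun_eq_iff configs_def)

lemma asep_generator_eq:
  assumes "\<tau> \<in> configs n" "1 \<le> n"
  shows "asep_generator \<alpha> \<beta> \<gamma> \<delta> q n g \<tau> =
     (\<Sum>i<n - 1. ((if \<tau> i \<and> \<not> \<tau> (Suc i) then 1 else 0) + (if \<not> \<tau> i \<and> \<tau> (Suc i) then q else 0))
        * (g (swap_sites i \<tau>) - g \<tau>))
   + (if \<tau> 0 then \<gamma> else \<alpha>) * (g (flip_site 0 \<tau>) - g \<tau>)
   + (if \<tau> (n - 1) then \<beta> else \<delta>) * (g (flip_site (n - 1) \<tau>) - g \<tau>)"
proof -
  let ?V = "configs n"
  have delta: "(\<Sum>\<tau>'\<in>?V. (if P \<and> \<tau>' = \<sigma> then x else 0) * (g \<tau>' - g \<tau>))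
      = (if P then x else 0) * (g \<sigma> - g \<tau>)" if "P \<Longrightarrow> \<sigma> \<in> ?V" for P \<sigma> x
    using that finite_configs[of n] by (cases P) (simp_all add: if_distrib[of "\<lambda>x. x * _"] cong: if_cong)
  have "asep_generator \<alpha> \<beta> \<gamma> \<delta> q n g \<tau> =
    (\<Sum>i<n - 1. (\<Sum>\<tau>'\<in>?V. (if \<tau> i \<and> \<not> \<tau> (Suc i) \<and> \<tau>' = \<tau>(i := False, Suc i := True) then 1 else 0) * (g \<tau>' - g \<tau>))
        + (\<Sum>\<tau>'\<in>?V. (if \<not> \<tau> i \<and> \<tau> (Suc i) \<and> \<tau>' = \<tau>(i := True, Suc i := False) then q else 0) * (g \<tau>' - g \<tau>)))
   + (\<Sum>\<tau>'\<in>?V. (if \<not> \<tau> 0 \<and> \<tau>' = \<tau>(0 := True) then \<alpha> else 0) * (g \<tau>' - g \<tau>))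
   + (\<Sum>\<tau>'\<in>?V. (if \<tau> 0 \<and> \<tau>' = \<tau>(0 := False) then \<gamma> else 0) * (g \<tau>' - g \<tau>))
   + (\<Sum>\<tau>'\<in>?V. (if \<not> \<tau> (n - 1) \<and> \<tau>' = \<tau>(n - 1 := True) then \<delta> else 0) * (g \<tau>' - g \<tau>))
   + (\<Sum>\<tau>'\<in>?V. (if \<tau> (n - 1) \<and> \<tau>' = \<tau>(n - 1 := False) then \<beta> else 0) * (g \<tau>' - g \<tau>))"
    unfolding asep_generator_def jump_rate_def
    by (simp only: distrib_right sum.distrib sum_distrib_right sum.swap[of _ "{..<n - 1}" ?V])
  also have "\<dots> = 
     (\<Sum>i<n - 1. ((if \<tau> i \<and> \<not> \<tau> (Suc i) then 1 else 0) + (if \<not> \<tau> i \<and> \<tau> (Suc i) then q else 0))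
        * (g (swap_sites i \<tau>) - g \<tau>))
   + (if \<not> \<tau> 0 then \<alpha> else 0) * (g (\<tau>(0 := True)) - g \<tau>)
   + (if \<tau> 0 then \<gamma> else 0) * (g (\<tau>(0 := False)) - g \<tau>)
   + (if \<not> \<tau> (n - 1) then \<delta> else 0) * (g (\<tau>(n - 1 := True)) - g \<tau>)
   + (if \<tau> (n - 1) then \<beta> else 0) * (g (\<tau>(n - 1 := False)) - g \<tau>)"
  proof (intro arg_cong2[of _ _ _ _ "(+)"] delta sum.cong refl)
    fix i assume "i \<in> {..<n - 1}"
    then have i: "Suc i < n" by auto
    have V: "\<tau>(i := x, Suc i := y) \<in> ?V" for x y using i assms by (auto intro!: configs_upd)
    have sw: "\<tau> i \<Longrightarrow> \<not> \<tau> (Suc i) \<Longrightarrow> \<tau>(i := False, Suc i := True) = swap_sites i \<tau>"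
      "\<not> \<tau> i \<Longrightarrow> \<tau> (Suc i) \<Longrightarrow> \<tau>(i := True, Suc i := False) = swap_sites i \<tau>"
      by (auto simp: swap_sites_def)
    show "(\<Sum>\<tau>'\<in>?V. (if \<tau> i \<and> \<not> \<tau> (Suc i) \<and> \<tau>' = \<tau>(i := False, Suc i := True) then 1 else 0) * (g \<tau>' - g \<tau>))
        + (\<Sum>\<tau>'\<in>?V. (if \<not> \<tau> i \<and> \<tau> (Suc i) \<and> \<tau>' = \<tau>(i := True, Suc i := False) then q else 0) * (g \<tau>' - g \<tau>))
       = ((if \<tau> i \<and> \<not> \<tau> (Suc i) then 1 else 0) + (if \<not> \<tau> i \<and> \<tau> (Suc i) then q else 0)) * (g (swap_sites i \<tau>) - g \<tau>)"
      using delta[of "\<tau> i \<and> \<not> \<tau> (Suc i)" "\<tau>(i := False, Suc i := True)" 1, OF V]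
        delta[of "\<not> \<tau> i \<and> \<tau> (Suc i)" "\<tau>(i := True, Suc i := False)" q, OF V] sw
      by (auto simp: conj_assoc)
  qed (use assms in \<open>auto intro!: configs_upd\<close>)
  also have "\<dots> =  (\<Sum>i<n - 1. ((if \<tau> i \<and> \<not> \<tau> (Suc i) then 1 else 0) + (if \<not> \<tau> i \<and> \<tau> (Suc i) then q else 0))
        * (g (swap_sites i \<tau>) - g \<tau>))
   + (if \<tau> 0 then \<gamma> else \<alpha>) * (g (flip_site 0 \<tau>) - g \<tau>)
   + (if \<tau> (n - 1) then \<beta> else \<delta>) * (g (flip_site (n - 1) \<tau>) - g \<tau>)"
    by (simp add: flip_site_def)
  finally show ?thesis .
qed

text \<open>The adjoint of the generator: the factor of \<open>g \<tau>\<close> is the net flow into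
  \<open>\<tau>\<close>, grouped by bond and by reservoir so that each group can be matched with one
  relation of the algebra.\<close>

lemma generator_sum:
  fixes f g :: "config \<Rightarrow> real"
  assumes "1 \<le> n"
  shows "(\<Sum>\<tau>\<in>configs n. f \<tau> * asep_generator \<alpha> \<beta> \<gamma> \<delta> q n g \<tau>) = (\<Sum>\<tau>\<in>configs n. g \<tau> * (
     (\<Sum>i<n - 1. (if \<tau> i \<and> \<not> \<tau> (Suc i) then q * f (swap_sites i \<tau>) - f \<tau> else 0)
        + (if \<not> \<tau> i \<and> \<tau> (Suc i) then f (swap_sites i \<tau>) - q * f \<tau> else 0))
     + (if \<tau> 0 then \<alpha> * f (flip_site 0 \<tau>) - \<gamma> * f \<tau> else \<gamma> * f (flip_site 0 \<tau>) - \<alpha> * f \<tau>)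
     + (if \<tau> (n - 1) then \<delta> * f (flip_site (n - 1) \<tau>) - \<beta> * f \<tau>
        else \<beta> * f (flip_site (n - 1) \<tau>) - \<delta> * f \<tau>)))"
proof -
  let ?V = "configs n"
  let ?p = "\<lambda>i \<tau>. (if \<tau> i \<and> \<not> \<tau> (Suc i) then 1 else 0) + (if \<not> \<tau> i \<and> \<tau> (Suc i) then q else 0)"
  have "(\<Sum>\<tau>\<in>?V. f \<tau> * asep_generator \<alpha> \<beta> \<gamma> \<delta> q n g \<tau>)
    = (\<Sum>i<n - 1. \<Sum>\<tau>\<in>?V. f \<tau> * (?p i \<tau> * (g (swap_sites i \<tau>) - g \<tau>)))
     + (\<Sum>\<tau>\<in>?V. f \<tau> * ((if \<tau> 0 then \<gamma> else \<alpha>) * (g (flip_site 0 \<tau>) - g \<tau>)))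
     + (\<Sum>\<tau>\<in>?V. f \<tau> * ((if \<tau> (n - 1) then \<beta> else \<delta>) * (g (flip_site (n - 1) \<tau>) - g \<tau>)))"
  proof -
    have "(\<Sum>\<tau>\<in>?V. f \<tau> * asep_generator \<alpha> \<beta> \<gamma> \<delta> q n g \<tau>) = (\<Sum>\<tau>\<in>?V. f \<tau> * (
        (\<Sum>i<n - 1. ?p i \<tau> * (g (swap_sites i \<tau>) - g \<tau>))
        + (if \<tau> 0 then \<gamma> else \<alpha>) * (g (flip_site 0 \<tau>) - g \<tau>)
        + (if \<tau> (n - 1) then \<beta> else \<delta>) * (g (flip_site (n - 1) \<tau>) - g \<tau>)))"
      by (intro sum.cong refl arg_cong2[of _ _ _ _ "(*)"] asep_generator_eq assms)
    then show ?thesis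
      by (simp only: distrib_left sum.distrib sum_distrib_left sum.swap[of _ "{..<n - 1}" ?V])
  qed
  also have "\<dots> = (\<Sum>i<n - 1. \<Sum>\<tau>\<in>?V. g \<tau> * (f (swap_sites i \<tau>) * ?p i (swap_sites i \<tau>) - f \<tau> * ?p i \<tau>))
     + (\<Sum>\<tau>\<in>?V. g \<tau> * (f (flip_site 0 \<tau>) * (if flip_site 0 \<tau> 0 then \<gamma> else \<alpha>) - f \<tau> * (if \<tau> 0 then \<gamma> else \<alpha>)))
     + (\<Sum>\<tau>\<in>?V. g \<tau> * (f (flip_site (n - 1) \<tau>) * (if flip_site (n - 1) \<tau> (n - 1) then \<beta> else \<delta>)
          - f \<tau> * (if \<tau> (n - 1) then \<beta> else \<delta>)))"
    using assms
    by (intro arg_cong2[of _ _ _ _ "(+)"] sum.cong refl sum_change_variable)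
       (auto simp: finite_configs swap_sites flip_site)
  also have "\<dots> = (\<Sum>\<tau>\<in>?V. g \<tau> * (
     (\<Sum>i<n - 1. f (swap_sites i \<tau>) * ?p i (swap_sites i \<tau>) - f \<tau> * ?p i \<tau>)
     + (f (flip_site 0 \<tau>) * (if flip_site 0 \<tau> 0 then \<gamma> else \<alpha>) - f \<tau> * (if \<tau> 0 then \<gamma> else \<alpha>))
     + (f (flip_site (n - 1) \<tau>) * (if flip_site (n - 1) \<tau> (n - 1) then \<beta> else \<delta>)
          - f \<tau> * (if \<tau> (n - 1) then \<beta> else \<delta>))))"
    by (simp only: distrib_left sum.distrib sum_distrib_left sum.swap[of _ "{..<n - 1}" ?V])
  also have "\<dots> = (\<Sum>\<tau>\<in>?V. g \<tau> * (
     (\<Sum>i<n - 1. (if \<tau> i \<and> \<not> \<tau> (Suc i) then q * f (swap_sites i \<tau>) - f \<tau> else 0)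
        + (if \<not> \<tau> i \<and> \<tau> (Suc i) then f (swap_sites i \<tau>) - q * f \<tau> else 0))
     + (if \<tau> 0 then \<alpha> * f (flip_site 0 \<tau>) - \<gamma> * f \<tau> else \<gamma> * f (flip_site 0 \<tau>) - \<alpha> * f \<tau>)
     + (if \<tau> (n - 1) then \<delta> * f (flip_site (n - 1) \<tau>) - \<beta> * f \<tau>
        else \<beta> * f (flip_site (n - 1) \<tau>) - \<delta> * f \<tau>)))"
    by (intro sum.cong refl arg_cong2[of _ _ _ _ "(+)"] arg_cong2[of _ _ _ _ "(*)"])
       (auto simp: swap_sites_def flip_site_def)
  finally show ?thesis .
qed

section \<open>Matrix product weights\<close>

context asep_weights begin

definition weight :: "(nat \<Rightarrow> real) \<Rightarrow> nat \<Rightarrow> config \<Rightarrow> real" where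
  "weight \<phi> n \<tau> = word (map \<tau> [0..<n]) \<phi> 0"

definition removed_weight :: "(nat \<Rightarrow> real) \<Rightarrow> nat \<Rightarrow> nat \<Rightarrow> config \<Rightarrow> real" where
  "removed_weight \<phi> n i \<tau> = word (map \<tau> [0..<i] @ map \<tau> [Suc i..<n]) \<phi> 0"

text \<open>The scalar auxiliary matrices of the cancellation mechanism: \<open>-1\<close> for a
  particle, \<open>1\<close> for a hole.\<close>

definition site_sign :: "bool \<Rightarrow> real" where
  "site_sign s = (if s then - 1 else 1)"

text \<open>The rates recovered from the parameters, inverting \<open>\<phi>_+\<close> and
  \<open>\<phi>_-\<close>; the two boundary relations of the algebra are normalised by the same
  products.\<close>

definition \<alpha> :: real where "\<alpha> = (1 - q) / ((1 + c) * (1 + d))"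
definition \<beta> :: real where "\<beta> = (1 - q) / ((1 + a) * (1 + b))"
definition \<gamma> :: real where "\<gamma> = - (c * d) * \<alpha>"
definition \<delta> :: real where "\<delta> = - (a * b) * \<beta>"

lemma rates: "0 < \<alpha>" "0 < \<beta>" "0 \<le> \<gamma>" "0 \<le> \<delta>"
proof -
  show 1: "0 < \<alpha>" "0 < \<beta>" unfolding \<alpha>_def \<beta>_def using signs q by auto
  show "0 \<le> \<gamma>" "0 \<le> \<delta>" unfolding \<gamma>_def \<delta>_def using signs 1 by (auto intro: mult_nonpos_nonneg)
qed

text \<open>For unequal neighbours this is the bulk relation: its two shorter words arise by
  deleting one of the two sites. For equal neighbours both deletions give the same word and both
  sides are zero.\<close>

lemma bulk_term:
  fixes \<phi> :: "nat \<Rightarrow> real"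
  assumes "Suc i < n"
  defines "f \<equiv> weight \<phi> n"
  shows "(if \<tau> i \<and> \<not> \<tau> (Suc i) then q * f (swap_sites i \<tau>) - f \<tau> else 0)
        + (if \<not> \<tau> i \<and> \<tau> (Suc i) then f (swap_sites i \<tau>) - q * f \<tau> else 0)
     = (1 - q) * (site_sign (\<tau> i) * removed_weight \<phi> n i \<tau>
        - site_sign (\<tau> (Suc i)) * removed_weight \<phi> n (Suc i) \<tau>)"
proof -
  let ?u = "map \<tau> [0..<i]" and ?v = "map \<tau> [Suc (Suc i)..<n]"
  have up: "[0..<n] = [0..<i] @ i # Suc i # [Suc (Suc i)..<n]"
    using assms(1) by (metis Suc_lessD less_imp_le_nat upt_add_eq_append upt_conv_Cons le_add_diff_inverse zero_le)
  have f: "f \<tau> = word (?u @ \<tau> i # \<tau> (Suc i) # ?v) \<phi> 0"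
    by (simp add: f_def weight_def up)
  have "map (swap_sites i \<tau>) [0..<i] = ?u" "map (swap_sites i \<tau>) [Suc (Suc i)..<n] = ?v"
    by (auto simp: swap_sites_def)
  then have fs: "f (swap_sites i \<tau>) = word (?u @ \<tau> (Suc i) # \<tau> i # ?v) \<phi> 0"
    by (simp add: f_def weight_def up) (simp add: swap_sites_def)
  have r: "removed_weight \<phi> n i \<tau> = word (?u @ \<tau> (Suc i) # ?v) \<phi> 0"
    "removed_weight \<phi> n (Suc i) \<tau> = word (?u @ \<tau> i # ?v) \<phi> 0"
    using assms(1) by (simp_all add: removed_weight_def upt_conv_Cons)
  show ?thesis
    unfolding f fs r using word_bulk[of ?u ?v \<phi>]
    by (cases "\<tau> i"; cases "\<tau> (Suc i)") (simp_all add: site_sign_def algebra_simps)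
qed

lemma left_term:
  fixes \<phi> :: "nat \<Rightarrow> real"
  assumes "1 \<le> n"
  defines "f \<equiv> weight \<phi> n"
  shows "(if \<tau> 0 then \<alpha> * f (flip_site 0 \<tau>) - \<gamma> * f \<tau> else \<gamma> * f (flip_site 0 \<tau>) - \<alpha> * f \<tau>)
    = - (1 - q) * site_sign (\<tau> 0) * removed_weight \<phi> n 0 \<tau>"
proof -
  let ?v = "map \<tau> [Suc 0..<n]"
  have up: "[0..<n] = 0 # [Suc 0..<n]" using assms(1) by (simp add: upt_conv_Cons)
  have f: "f \<tau> = word (\<tau> 0 # ?v) \<phi> 0"
    by (simp add: f_def weight_def up)
  have "map (flip_site 0 \<tau>) [Suc 0..<n] = ?v" by (auto simp: flip_site_def)
  then have fs: "f (flip_site 0 \<tau>) = word ((\<not> \<tau> 0) # ?v) \<phi> 0"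
    by (simp add: f_def weight_def up) (simp add: flip_site_def)
  have r: "removed_weight \<phi> n 0 \<tau> = word ?v \<phi> 0" by (simp add: removed_weight_def)
  have "\<alpha> * word (False # ?v) \<phi> 0 - \<gamma> * word (True # ?v) \<phi> 0
      = \<alpha> * (word (False # ?v) \<phi> 0 + c * d * word (True # ?v) \<phi> 0)"
    by (simp add: \<gamma>_def algebra_simps)
  also have "\<dots> = \<alpha> * ((1 + c) * (1 + d)) * word ?v \<phi> 0" unfolding word_left by simp
  also have "\<alpha> * ((1 + c) * (1 + d)) = 1 - q" using cd by (simp add: \<alpha>_def)
  finally show ?thesis
    unfolding f fs r by (cases "\<tau> 0") (simp_all add: site_sign_def algebra_simps)
qed

lemma right_term:
  fixes \<phi> :: "nat \<Rightarrow> real"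
  assumes "1 \<le> n" "right_vector \<phi>"
  defines "f \<equiv> weight \<phi> n"
  shows "(if \<tau> (n - 1) then \<delta> * f (flip_site (n - 1) \<tau>) - \<beta> * f \<tau>
        else \<beta> * f (flip_site (n - 1) \<tau>) - \<delta> * f \<tau>)
    = (1 - q) * site_sign (\<tau> (n - 1)) * removed_weight \<phi> n (n - 1) \<tau>"
proof -
  let ?v = "map \<tau> [0..<n - 1]"
  have up: "[0..<n] = [0..<n - 1] @ [n - 1]" using assms(1)
    by (metis One_nat_def Suc_pred le_eq_less_or_eq less_eq_Suc_le upt_Suc_append zero_le)
  have f: "f \<tau> = word (?v @ [\<tau> (n - 1)]) \<phi> 0"
    by (simp add: f_def weight_def up)
  have "map (flip_site (n - 1) \<tau>) [0..<n - 1] = ?v" by (auto simp: flip_site_def)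
  then have fs: "f (flip_site (n - 1) \<tau>) = word (?v @ [\<not> \<tau> (n - 1)]) \<phi> 0"
    by (simp add: f_def weight_def up) (simp add: flip_site_def)
  have r: "removed_weight \<phi> n (n - 1) \<tau> = word ?v \<phi> 0" using assms(1) by (simp add: removed_weight_def)
  have "\<beta> * word (?v @ [True]) \<phi> 0 - \<delta> * word (?v @ [False]) \<phi> 0
      = \<beta> * (word (?v @ [True]) \<phi> 0 + a * b * word (?v @ [False]) \<phi> 0)"
    by (simp add: \<delta>_def algebra_simps)
  also have "\<dots> = \<beta> * ((1 + a) * (1 + b)) * word ?v \<phi> 0" unfolding word_right[OF assms(2)] by simp
  also have "\<beta> * ((1 + a) * (1 + b)) = 1 - q" using ab by (simp add: \<beta>_def)
  finally show ?thesis
    unfolding f fs r by (cases "\<tau> (n - 1)") (simp_all add: site_sign_def algebra_simps)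
qed

text \<open>The net flows through the bonds telescope to a difference of end terms, and each
  reservoir cancels one end. Thus the flow into every single configuration is zero.\<close>

lemma weight_balanced:
  assumes "1 \<le> n" "right_vector \<phi>"
  shows "balanced (configs n) (jump_rate \<alpha> \<beta> \<gamma> \<delta> q n) (weight \<phi> n)"
proof -
  have "(\<Sum>\<tau>\<in>configs n. weight \<phi> n \<tau> * asep_generator \<alpha> \<beta> \<gamma> \<delta> q n g \<tau>) = 0" for g
    unfolding generator_sum[OF assms(1)]
  proof (intro sum.neutral ballI)
    fix \<tau>
    let ?t = "\<lambda>i. site_sign (\<tau> i) * removed_weight \<phi> n i \<tau>"
    have "(\<Sum>i<n - 1. (if \<tau> i \<and> \<not> \<tau> (Suc i) then q * weight \<phi> n (swap_sites i \<tau>) - weight \<phi> n \<tau> else 0)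
        + (if \<not> \<tau> i \<and> \<tau> (Suc i) then weight \<phi> n (swap_sites i \<tau>) - q * weight \<phi> n \<tau> else 0))
       = (\<Sum>i<n - 1. (1 - q) * (?t i - ?t (Suc i)))"
      by (intro sum.cong refl bulk_term) auto
    also have "\<dots> = (1 - q) * (?t 0 - ?t (n - 1))"
      by (simp only: sum_distrib_left[symmetric] sum_lessThan_telescope'[of ?t])
    finally show "g \<tau> * (
     (\<Sum>i<n - 1. (if \<tau> i \<and> \<not> \<tau> (Suc i) then q * weight \<phi> n (swap_sites i \<tau>) - weight \<phi> n \<tau> else 0)
        + (if \<not> \<tau> i \<and> \<tau> (Suc i) then weight \<phi> n (swap_sites i \<tau>) - q * weight \<phi> n \<tau> else 0))
     + (if \<tau> 0 then \<alpha> * weight \<phi> n (flip_site 0 \<tau>) - \<gamma> * weight \<phi> n \<tau> else \<gamma> * weight \<phi> n (flip_site 0 \<tau>) - \<alpha> * weight \<phi> n \<tau>)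
     + (if \<tau> (n - 1) then \<delta> * weight \<phi> n (flip_site (n - 1) \<tau>) - \<beta> * weight \<phi> n \<tau>
        else \<beta> * weight \<phi> n (flip_site (n - 1) \<tau>) - \<delta> * weight \<phi> n \<tau>)) = 0"
      unfolding left_term[OF assms(1)] right_term[OF assms] by (simp add: algebra_simps)
  qed
  then show ?thesis
    using balanced_iff_generator[of "asep_generator \<alpha> \<beta> \<gamma> \<delta> q n" "jump_rate \<alpha> \<beta> \<gamma> \<delta> q n" "configs n" "weight \<phi> n"]
    by (auto simp: asep_generator_def finite_configs)
qed

end

section \<open>Stationary measures\<close>

text \<open>The linear coefficient is the derivative at \<open>0\<close>, computed from the right
  because constancy is known only for \<open>t \<ge> 0\<close>.\<close>

lemma powser_const_coeff:
  fixes e :: "nat \<Rightarrow> real"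
  assumes "\<And>t. summable (\<lambda>k. e k * t ^ k)" "\<And>t. 0 \<le> t \<Longrightarrow> (\<Sum>k. e k * t ^ k) = e 0"
  shows "e 1 = 0"
proof -
  let ?h = "\<lambda>t. \<Sum>k. e k * t ^ k"
  have "(?h has_field_derivative (\<Sum>k. diffs e k * 0 ^ k)) (at 0)"
    by (rule termdiffs_strong_converges_everywhere[OF assms(1)])
  then have "((\<lambda>y. (?h y - ?h 0) / (y - 0)) \<longlongrightarrow> (\<Sum>k. diffs e k * 0 ^ k)) (at 0)"
    by (simp only: has_field_derivative_iff)
  then have "((\<lambda>y. (?h y - ?h 0) / (y - 0)) \<longlongrightarrow> (\<Sum>k. diffs e k * 0 ^ k)) (at_right 0)"
    by (rule tendsto_mono[rotated]) (simp add: at_within_le_at)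
  moreover have "((\<lambda>y. (?h y - ?h 0) / (y - 0)) \<longlongrightarrow> 0) (at_right 0)"
    by (rule tendsto_eventually) (auto simp: eventually_at_filter assms(2) intro!: always_eventually)
  ultimately have "(\<Sum>k. diffs e k * 0 ^ k) = 0"
    by (rule tendsto_unique[rotated]) simp
  then show ?thesis by (simp add: diffs_def)
qed

lemma expectation_configs:
  assumes "set_pmf \<mu> \<subseteq> configs n"
  shows "measure_pmf.expectation \<mu> h = (\<Sum>\<tau>\<in>configs n. pmf \<mu> \<tau> * h \<tau>)"
  using integral_measure_pmf_real[OF finite_configs[of n], of \<mu> h] assms by (auto simp: mult.commute)

lemma generator_pow_bound:
  obtains C where "0 \<le> C" "\<And>k \<tau>. \<tau> \<in> configs n \<Longrightarrow>
    \<bar>(asep_generator \<alpha> \<beta> \<gamma> \<delta> q n ^^ k) f \<tau>\<bar> \<le> C ^ k * (\<Sum>\<tau>\<in>configs n. \<bar>f \<tau>\<bar>)"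
proof -
  let ?V = "configs n" and ?r = "jump_rate \<alpha> \<beta> \<gamma> \<delta> q n"
  let ?L = "asep_generator \<alpha> \<beta> \<gamma> \<delta> q n"
  define C where "C = 2 * (\<Sum>x\<in>?V. \<Sum>y\<in>?V. \<bar>?r x y\<bar>)"
  have C: "0 \<le> C" by (auto simp: C_def intro!: sum_nonneg)
  let ?M = "\<Sum>\<tau>\<in>?V. \<bar>f \<tau>\<bar>"
  have "\<bar>(?L ^^ k) f \<tau>\<bar> \<le> C ^ k * ?M" if "\<tau> \<in> ?V" for k \<tau>
    using that
  proof (induction k arbitrary: \<tau>)
    case 0
    then show ?case using finite_configs[of n] by (simp add: member_le_sum[of \<tau> ?V "\<lambda>\<tau>. \<bar>f \<tau>\<bar>"])
  next
    case (Suc k)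
    let ?g = "(?L ^^ k) f"
    have M: "0 \<le> C ^ k * ?M" using C by (intro mult_nonneg_nonneg sum_nonneg) auto
    have "\<bar>?L ?g \<tau>\<bar> \<le> (\<Sum>\<tau>'\<in>?V. \<bar>?r \<tau> \<tau>'\<bar> * \<bar>?g \<tau>' - ?g \<tau>\<bar>)"
      unfolding asep_generator_def abs_mult[symmetric] by (rule sum_abs)
    also have "\<dots> \<le> (\<Sum>\<tau>'\<in>?V. \<bar>?r \<tau> \<tau>'\<bar> * (2 * (C ^ k * ?M)))"
    proof (intro sum_mono mult_left_mono)
      fix \<tau>' assume "\<tau>' \<in> ?V"
      then show "\<bar>?g \<tau>' - ?g \<tau>\<bar> \<le> 2 * (C ^ k * ?M)"
        using Suc.IH[of \<tau>'] Suc.IH[of \<tau>] Suc.prems abs_triangle_ineq4[of "?g \<tau>'" "?g \<tau>"] by simp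
    qed auto
    also have "\<dots> = (\<Sum>\<tau>'\<in>?V. \<bar>?r \<tau> \<tau>'\<bar>) * (2 * (C ^ k * ?M))" by (simp only: sum_distrib_right)
    also have "\<dots> \<le> (\<Sum>x\<in>?V. \<Sum>y\<in>?V. \<bar>?r x y\<bar>) * (2 * (C ^ k * ?M))"
    proof (intro mult_right_mono)
      show "(\<Sum>\<tau>'\<in>?V. \<bar>?r \<tau> \<tau>'\<bar>) \<le> (\<Sum>x\<in>?V. \<Sum>y\<in>?V. \<bar>?r x y\<bar>)"
        using Suc.prems finite_configs[of n] by (intro member_le_sum[of \<tau> ?V "\<lambda>x. \<Sum>y\<in>?V. \<bar>?r x y\<bar>"] sum_nonneg) auto
    qed (use M in auto)
    also have "\<dots> = C ^ Suc k * ?M" by (simp add: C_def)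
    finally show ?case by simp
  qed
  then show ?thesis using that C by blast
qed

lemma semigroup_summable:
  assumes "\<tau> \<in> configs n"
  shows "summable (\<lambda>k. t ^ k / fact k * (asep_generator \<alpha> \<beta> \<gamma> \<delta> q n ^^ k) f \<tau>)"
proof -
  obtain C where C: "0 \<le> C" "\<And>k \<tau>. \<tau> \<in> configs n \<Longrightarrow>
    \<bar>(asep_generator \<alpha> \<beta> \<gamma> \<delta> q n ^^ k) f \<tau>\<bar> \<le> C ^ k * (\<Sum>\<tau>\<in>configs n. \<bar>f \<tau>\<bar>)"
    using generator_pow_bound by blast
  let ?M = "\<Sum>\<tau>\<in>configs n. \<bar>f \<tau>\<bar>"
  have "summable (\<lambda>k. ?M * (inverse (fact k) * (\<bar>t\<bar> * C) ^ k))"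
    by (intro summable_mult summable_exp)
  then show ?thesis
  proof (rule summable_comparison_test'[of _ 0])
    fix k
    have "norm (t ^ k / fact k * (asep_generator \<alpha> \<beta> \<gamma> \<delta> q n ^^ k) f \<tau>)
        = \<bar>t\<bar> ^ k / fact k * \<bar>(asep_generator \<alpha> \<beta> \<gamma> \<delta> q n ^^ k) f \<tau>\<bar>"
      by (simp add: abs_mult power_abs)
    also have "\<dots> \<le> \<bar>t\<bar> ^ k / fact k * (C ^ k * ?M)"
      using C(2)[OF assms] by (intro mult_left_mono) auto
    also have "\<dots> = ?M * (inverse (fact k) * (\<bar>t\<bar> * C) ^ k)"
      by (simp add: power_mult_distrib divide_inverse)
    finally show "norm (t ^ k / fact k * (asep_generator \<alpha> \<beta> \<gamma> \<delta> q n ^^ k) f \<tau>)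
        \<le> ?M * (inverse (fact k) * (\<bar>t\<bar> * C) ^ k)" .
  qed
qed

lemma expectation_semigroup:
  fixes \<mu> :: "config pmf" and f :: "config \<Rightarrow> real" and \<alpha> \<beta> \<gamma> \<delta> q t :: real
  assumes "set_pmf \<mu> \<subseteq> configs n"
  defines "A \<equiv> \<lambda>k. (\<Sum>\<tau>\<in>configs n. pmf \<mu> \<tau> * (asep_generator \<alpha> \<beta> \<gamma> \<delta> q n ^^ k) f \<tau>)"
  shows "(\<lambda>k. A k / fact k * t ^ k) sums measure_pmf.expectation \<mu> (asep_semigroup \<alpha> \<beta> \<gamma> \<delta> q n t f)"
proof -
  have "(\<lambda>k. \<Sum>\<tau>\<in>configs n. pmf \<mu> \<tau> * (t ^ k / fact k * (asep_generator \<alpha> \<beta> \<gamma> \<delta> q n ^^ k) f \<tau>))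
     sums (\<Sum>\<tau>\<in>configs n. pmf \<mu> \<tau> * asep_semigroup \<alpha> \<beta> \<gamma> \<delta> q n t f \<tau>)"
    unfolding asep_semigroup_def
    by (intro sums_sum sums_mult summable_sums semigroup_summable)
  moreover have "(\<Sum>\<tau>\<in>configs n. pmf \<mu> \<tau> * (t ^ k / fact k * (asep_generator \<alpha> \<beta> \<gamma> \<delta> q n ^^ k) f \<tau>))
      = A k / fact k * t ^ k" for k
    by (simp add: A_def sum_distrib_left sum_distrib_right sum_divide_distrib mult_ac)
  ultimately show ?thesis by (simp add: expectation_configs[OF assms(1)])
qed

text \<open>The expectation of the semigroup is a power series in \<open>t\<close> with coefficients
  \<open>\<mu>(L^k f) / k!\<close>. Invariance forces the linear one to vanish, which is balance;
  conversely balance kills every term with \<open>k \<ge> 1\<close>, since \<open>L^k f\<close> is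
  again in the range of \<open>L\<close>.\<close>

lemma asep_stationary_iff:
  "asep_stationary \<alpha> \<beta> \<gamma> \<delta> q n \<mu> \<longleftrightarrow>
    set_pmf \<mu> \<subseteq> configs n \<and> balanced (configs n) (jump_rate \<alpha> \<beta> \<gamma> \<delta> q n) (pmf \<mu>)"
proof (cases "set_pmf \<mu> \<subseteq> configs n")
  case True
  let ?L = "asep_generator \<alpha> \<beta> \<gamma> \<delta> q n"
  define A where "A f k = (\<Sum>\<tau>\<in>configs n. pmf \<mu> \<tau> * (?L ^^ k) f \<tau>)" for f k
  have sums: "(\<lambda>k. A f k / fact k * t ^ k) sums measure_pmf.expectation \<mu> (asep_semigroup \<alpha> \<beta> \<gamma> \<delta> q n t f)"
    for f t unfolding A_def by (rule expectation_semigroup[OF True])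
  have A0: "A f 0 = measure_pmf.expectation \<mu> f" for f
    by (simp add: A_def expectation_configs[OF True])
  have bal: "balanced (configs n) (jump_rate \<alpha> \<beta> \<gamma> \<delta> q n) (pmf \<mu>) \<longleftrightarrow> (\<forall>g. A g 1 = 0)"
    using balanced_iff_generator[of ?L "jump_rate \<alpha> \<beta> \<gamma> \<delta> q n" "configs n" "pmf \<mu>"]
    by (simp add: asep_generator_def finite_configs A_def)
  show ?thesis
  proof
    assume st: "asep_stationary \<alpha> \<beta> \<gamma> \<delta> q n \<mu>"
    have "A g 1 = 0" for g
    proof -
      have "A g 1 / fact 1 = 0"
        by (rule powser_const_coeff[of "\<lambda>k. A g k / fact k"])
          (use sums[of g] st in \<open>auto simp: sums_iff asep_stationary_def A0\<close>)
      then show ?thesis by simp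
    qed
    then show "set_pmf \<mu> \<subseteq> configs n \<and> balanced (configs n) (jump_rate \<alpha> \<beta> \<gamma> \<delta> q n) (pmf \<mu>)"
      using True bal by blast
  next
    assume "set_pmf \<mu> \<subseteq> configs n \<and> balanced (configs n) (jump_rate \<alpha> \<beta> \<gamma> \<delta> q n) (pmf \<mu>)"
    then have 0: "A g 1 = 0" for g using bal by blast
    have "A f k = 0" if "k \<noteq> 0" for f k
    proof -
      obtain j where "k = Suc j" using \<open>k \<noteq> 0\<close> not0_implies_Suc by blast
      then show ?thesis using 0[of "(?L ^^ j) f"] by (simp add: A_def)
    qed
    then have "(\<lambda>k. A f k / fact k * t ^ k) sums (A f 0)" for f t
      using sums_finite[of "{0}" "\<lambda>k. A f k / fact k * t ^ k"] by auto
    then show "asep_stationary \<alpha> \<beta> \<gamma> \<delta> q n \<mu>"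
      using sums_unique2[OF sums] True by (auto simp: asep_stationary_def A0)
  qed
qed (simp add: asep_stationary_def)

lemma asep_measure_eqI:
  assumes "0 < \<alpha>" "0 < \<beta>" "0 \<le> \<gamma>" "0 \<le> \<delta>" "0 \<le> q"
    and "set_pmf \<mu> \<subseteq> configs n" "balanced (configs n) (jump_rate \<alpha> \<beta> \<gamma> \<delta> q n) (pmf \<mu>)"
  shows "asep_measure \<alpha> \<beta> \<gamma> \<delta> q n = \<mu>"
  unfolding asep_measure_def
proof (rule the_equality)
  interpret finite_chain "configs n" "jump_rate \<alpha> \<beta> \<gamma> \<delta> q n" by (rule asep_chain[OF assms(1-5)])
  show "asep_stationary \<alpha> \<beta> \<gamma> \<delta> q n \<mu>" using assms by (simp add: asep_stationary_iff)
  fix \<nu> assume "asep_stationary \<alpha> \<beta> \<gamma> \<delta> q n \<nu>"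
  then have \<nu>: "set_pmf \<nu> \<subseteq> configs n" "balanced (configs n) (jump_rate \<alpha> \<beta> \<gamma> \<delta> q n) (pmf \<nu>)"
    by (simp_all add: asep_stationary_iff)
  have "sum (pmf \<nu>) (configs n) = sum (pmf \<mu>) (configs n)"
    using \<nu>(1) assms(6) by (simp add: sum_pmf_eq_1 finite_configs)
  then have "pmf \<nu> x = pmf \<mu> x" if "x \<in> configs n" for x
    by (rule balanced_unique[OF \<nu>(2) assms(7) _ that])
  moreover have "pmf \<nu> x = pmf \<mu> x" if "x \<notin> configs n" for x
    using that \<nu>(1) assms(6) by (metis pmf_eq_0_set_pmf subsetD)
  ultimately show "\<nu> = \<mu>" by (intro pmf_eqI) blast
qed

context asep_weights begin

section \<open>Eventual positivity of the weights\<close>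

lemma right_vector_scale:
  assumes "right_vector \<phi>"
  shows "right_vector (\<lambda>j. s * \<phi> j)"
  unfolding right_vector_def
proof
  fix j
  have "X (\<lambda>j. s * \<phi> j) j + a * b * Y (\<lambda>j. s * \<phi> j) j = s * (X \<phi> j + a * b * Y \<phi> j)"
    using X_linear[of s \<phi> 0 \<phi>] Y_linear[of s \<phi> 0 \<phi>] by (simp add: algebra_simps)
  also have "\<dots> = (a + b) * (s * \<phi> j)"
    using assms by (simp add: right_vector_def)
  finally show "X (\<lambda>j. s * \<phi> j) j + a * b * Y (\<lambda>j. s * \<phi> j) j = (a + b) * (s * \<phi> j)" .
qed

lemma word_scale: "word w (\<lambda>j. s * \<phi> j) = (\<lambda>j. s * word w \<phi> j)"
  using word_linear[of w s \<phi> 0 \<phi>] by simp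

lemma map_config:
  assumes "length w = n"
  obtains \<tau> where "\<tau> \<in> configs n" "map \<tau> [0..<n] = w"
proof
  show "(\<lambda>i. i < n \<and> w ! i) \<in> configs n" by (simp add: configs_def)
  show "map (\<lambda>i. i < n \<and> w ! i) [0..<n] = w" using assms by (intro nth_equalityI) auto
qed

text \<open>The weights are balanced for an irreducible chain, so the sign of a single one fixes all
  the others.\<close>

lemma positive_from_full_word:
  assumes "right_vector \<phi>" "1 \<le> n" "0 < word (replicate n True) \<phi> 0"
  shows "positive n \<phi>"
  unfolding positive_def
proof (intro allI impI)
  fix w :: "bool list"
  assume "length w = n"
  then obtain \<tau> where \<tau>: "\<tau> \<in> configs n" "map \<tau> [0..<n] = w" by (rule map_config)
  obtain \<sigma> where \<sigma>: "\<sigma> \<in> configs n" "map \<sigma> [0..<n] = replicate n True"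
    by (rule map_config[of "replicate n True" n]) auto
  interpret finite_chain "configs n" "jump_rate \<alpha> \<beta> \<gamma> \<delta> q n"
    by (rule asep_chain) (use rates q in auto)
  have "0 < weight \<phi> n \<tau>"
    by (rule balanced_definite[OF weight_balanced[OF assms(2,1)] \<sigma>(1) _ \<tau>(1)])
      (use assms \<sigma> in \<open>simp add: weight_def\<close>)
  then show "0 < word w \<phi> 0" by (simp add: weight_def \<tau>)
qed

lemma positive_Suc:
  assumes "right_vector \<phi>" "positive n \<phi>" "a * b * c * d * q ^ n < 1"
  shows "positive (Suc n) \<phi>"
  by (rule positive_from_full_word[OF assms(1)])
    (use full_word_step[OF assms(1,2)] assms(3) in \<open>auto simp: zero_less_mult_iff\<close>)

lemma positive_Suc_minus:
  assumes "right_vector \<phi>" "positive n \<phi>" "1 < a * b * c * d * q ^ n"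
  shows "positive (Suc n) (\<lambda>j. - 1 * \<phi> j)"
proof (rule positive_from_full_word[OF right_vector_scale[OF assms(1)]])
  have "word (replicate (Suc n) True) \<phi> 0 < 0"
    using full_word_step[OF assms(1,2)] assms(3) by (simp add: zero_less_mult_iff)
  then show "0 < word (replicate (Suc n) True) (\<lambda>j. - 1 * \<phi> j) 0"
    unfolding word_scale by simp
qed simp

lemma positive_eventually:
  assumes "right_vector \<phi>" "positive N \<phi>" "\<And>n. N \<le> n \<Longrightarrow> a * b * c * d * q ^ n < 1"
  shows "N \<le> n \<Longrightarrow> positive n \<phi>"
  by (induction n rule: dec_induct) (use assms in \<open>auto intro: positive_Suc\<close>)

lemma full_word_start_vector:
  "j + m < k0 \<Longrightarrow> word (replicate m True) (start_vector k0) j = 0"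
  "j + m = k0 \<Longrightarrow> word (replicate m True) (start_vector k0) j = 1"
  by (induction m arbitrary: j) (auto simp: start_vector.simps site_def X_def)

lemma positive_right_vector:
  "\<exists>\<phi> N. right_vector \<phi> \<and> (\<forall>n\<ge>N. positive n \<phi>)"
proof (cases "\<exists>k. a * b * c * d * q ^ k = 1")
  case True
  then obtain k where k: "a * b * c * d * q ^ k = 1" by blast
  have lt: "a * b * c * d * q ^ j < 1" if j: "Suc k \<le> j" for j
  proof -
    obtain i where "j = k + Suc i" using j by (metis add_Suc_right add_Suc le_Suc_ex)
    then have "a * b * c * d * q ^ j = a * b * c * d * q ^ k * q ^ Suc i"
      by (simp add: power_add mult_ac)
    also have "\<dots> = q * q ^ i" using k by simp
    also have "\<dots> \<le> q" using q q_power[of i] by (simp add: mult_left_le)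
    finally show ?thesis using q by simp
  qed
  let ?\<phi> = "start_vector (Suc k)"
  have rv: "right_vector ?\<phi>"
    using k lt by (intro right_vector_start_vector) fastforce+
  \<comment> \<open>The coordinates up to \<open>k\<close> vanish, so \<open>(1 + x)^(k+1)\<close>
    picks out the coordinate \<open>k + 1\<close>, which is \<open>1\<close>.\<close>
  moreover have "positive (Suc k) ?\<phi>"
    using full_word_start_vector(2)[of 0 "Suc k" "Suc k"]
    by (intro positive_from_full_word[OF rv]) (auto simp del: replicate_Suc)
  ultimately show ?thesis using positive_eventually lt by blast
next
  case False
  let ?\<phi> = "start_vector 0"
  have rv: "right_vector ?\<phi>" using False by (intro right_vector_start_vector) auto
  \<comment> \<open>The sign depends on the size: it flips in passing from \<open>n\<close> to
    \<open>n + 1\<close> whenever \<open>a b c d q^n > 1\<close>. From \<open>N\<close> on there is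
    no further flip, and the sign reached at \<open>N\<close> is kept.\<close>
  have s: "\<exists>s. positive n (\<lambda>j. s * ?\<phi> j)" for n
  proof (induction n)
    case 0
    have "positive 0 (\<lambda>j. 1 * ?\<phi> j)" by (simp add: positive_def start_vector.simps)
    then show ?case by blast
  next
    case (Suc n)
    then obtain s where s: "positive n (\<lambda>j. s * ?\<phi> j)" by blast
    have "a * b * c * d * q ^ n < 1 \<or> 1 < a * b * c * d * q ^ n" using False by (meson linorder_neqE)
    then show ?case
    proof
      assume "a * b * c * d * q ^ n < 1"
      then show ?thesis using positive_Suc[OF right_vector_scale[OF rv] s] by blast
    next
      assume "1 < a * b * c * d * q ^ n"
      then have "positive (Suc n) (\<lambda>j. - 1 * (s * ?\<phi> j))"
        by (rule positive_Suc_minus[OF right_vector_scale[OF rv] s])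
      then have "positive (Suc n) (\<lambda>j. (- 1 * s) * ?\<phi> j)" by (simp only: mult.assoc)
      then show ?thesis by blast
    qed
  qed
  have "(\<lambda>n. a * b * c * d * q ^ n) \<longlonglongrightarrow> a * b * c * d * 0"
    using q by (intro tendsto_intros LIMSEQ_realpow_zero) auto
  then have "eventually (\<lambda>n. a * b * c * d * q ^ n < 1) sequentially" by (rule order_tendstoD) auto
  then obtain N where N: "\<And>n. N \<le> n \<Longrightarrow> a * b * c * d * q ^ n < 1"
    by (auto simp: eventually_sequentially)
  obtain s where "positive N (\<lambda>j. s * ?\<phi> j)" using s by blast
  then have "\<forall>n\<ge>N. positive n (\<lambda>j. s * ?\<phi> j)"
    using positive_eventually[OF right_vector_scale[OF rv], of N s] N by blast
  then show ?thesis using right_vector_scale[OF rv] by blast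
qed

end

section \<open>The total variation bound\<close>

definition restrict_config :: "nat \<Rightarrow> config \<Rightarrow> config" where
  "restrict_config m \<tau> = (\<lambda>i. i < m \<and> \<tau> i)"

lemma restrict_config_in_configs: "restrict_config m \<tau> \<in> configs m"
  by (simp add: restrict_config_def configs_def)

lemma restrict_config_ident: "\<tau> \<in> configs m \<Longrightarrow> restrict_config m \<tau> = \<tau>"
  by (auto simp: restrict_config_def configs_def fun_eq_iff) (meson not_less)

lemma card_configs: "card (configs m) \<le> 2 ^ m"
proof -
  have "configs m \<subseteq> (\<lambda>A i. i \<in> A) ` Pow {..<m}"
  proof
    fix \<tau> assume "\<tau> \<in> configs m"
    then have "{i. \<tau> i} \<in> Pow {..<m}" by (auto simp: configs_def) (meson not_less)
    then show "\<tau> \<in> (\<lambda>A i. i \<in> A) ` Pow {..<m}" by (rule rev_image_eqI) simp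
  qed
  then have "card (configs m) \<le> card ((\<lambda>A i. i \<in> A) ` Pow {..<m})" by (rule card_mono[rotated]) simp
  also have "\<dots> \<le> card (Pow {..<m})" by (rule card_image_le) simp
  finally show ?thesis by (simp add: card_Pow)
qed

lemma configs_Suc: "configs (Suc n) = configs n \<union> (\<lambda>\<tau>. \<tau>(n := True)) ` configs n"
proof (intro equalityI subsetI)
  fix \<tau> assume \<tau>: "\<tau> \<in> configs (Suc n)"
  show "\<tau> \<in> configs n \<union> (\<lambda>\<tau>. \<tau>(n := True)) ` configs n"
  proof (cases "\<tau> n")
    case True
    then have "\<tau> = (\<tau>(n := False))(n := True)" by (auto simp: fun_eq_iff)
    moreover have "\<tau>(n := False) \<in> configs n" using \<tau> by (auto simp: configs_def)
    ultimately show ?thesis by blast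
  next
    case False
    have "\<not> \<tau> i" if "n \<le> i" for i
      using that \<tau> False by (cases "i = n") (auto simp: configs_def)
    then have "\<tau> \<in> configs n" by (simp add: configs_def)
    then show ?thesis by blast
  qed
next
  have "configs n \<subseteq> configs (Suc n)" unfolding configs_def using Suc_leD by blast
  then show "\<tau> \<in> configs (Suc n)" if "\<tau> \<in> configs n \<union> (\<lambda>\<tau>. \<tau>(n := True)) ` configs n" for \<tau>
    using that configs_upd[of _ "Suc n" n True] by blast
qed

lemma set_pmf_marginal: "set_pmf (marginal m \<mu>) \<subseteq> configs m"
  by (auto simp: marginal_def configs_def)

lemma pmf_marginal:
  assumes "set_pmf \<mu> \<subseteq> configs n"
  shows "pmf (marginal m \<mu>) x = (\<Sum>\<tau>\<in>{\<tau> \<in> configs n. restrict_config m \<tau> = x}. pmf \<mu> \<tau>)"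
proof -
  have "pmf (marginal m \<mu>) x = measure (measure_pmf \<mu>) (restrict_config m -` {x})"
    by (simp add: marginal_def pmf_map restrict_config_def[abs_def])
  also have "\<dots> = measure (measure_pmf \<mu>) {\<tau> \<in> configs n. restrict_config m \<tau> = x}"
    using assms by (intro measure_pmf.finite_measure_eq_AE) (auto simp: AE_measure_pmf_iff)
  also have "\<dots> = (\<Sum>\<tau>\<in>{\<tau> \<in> configs n. restrict_config m \<tau> = x}. pmf \<mu> \<tau>)"
    by (rule measure_measure_pmf_finite) (simp add: finite_configs)
  finally show ?thesis .
qed

lemma pmf_bernoulli_product:
  assumes "0 \<le> \<rho>" "\<rho> \<le> 1" "x \<in> configs m"
  shows "pmf (bernoulli_product m \<rho>) x = (\<Prod>i<m. if x i then \<rho> else 1 - \<rho>)"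
proof -
  have "pmf (bernoulli_product m \<rho>) x = (\<Prod>i<m. pmf (bernoulli_pmf \<rho>) (x i))"
    unfolding bernoulli_product_def
    using assms(3) by (intro pmf_Pi') (auto simp: configs_def)
  also have "\<dots> = (\<Prod>i<m. if x i then \<rho> else 1 - \<rho>)"
    using assms by (intro prod.cong) auto
  finally show ?thesis .
qed

lemma set_pmf_bernoulli_product: "set_pmf (bernoulli_product m \<rho>) \<subseteq> configs m"
  unfolding bernoulli_product_def configs_def
  using set_Pi_pmf_subset[of "{..<m}" False "\<lambda>_. bernoulli_pmf \<rho>"] by fastforce

lemma d_TV_le_1:
  assumes "set_pmf \<kappa> \<subseteq> configs m" "set_pmf \<kappa>' \<subseteq> configs m"
  shows "d_TV m \<kappa> \<kappa>' \<le> 1"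
proof -
  have "(\<Sum>x\<in>configs m. \<bar>pmf \<kappa> x - pmf \<kappa>' x\<bar>) \<le> (\<Sum>x\<in>configs m. pmf \<kappa> x + pmf \<kappa>' x)"
  proof (intro sum_mono)
    show "\<bar>pmf \<kappa> x - pmf \<kappa>' x\<bar> \<le> pmf \<kappa> x + pmf \<kappa>' x" for x
      using pmf_nonneg[of \<kappa> x] pmf_nonneg[of \<kappa>' x] by linarith
  qed
  also have "\<dots> = 2" using assms by (simp add: sum.distrib sum_pmf_eq_1 finite_configs)
  finally show ?thesis by (simp add: d_TV_def)
qed

lemma d_TV_nonneg: "0 \<le> d_TV m \<kappa> \<kappa>'"
  by (simp add: d_TV_def sum_nonneg)

text \<open>The midpoint between \<open>c\<close> and the lower bounds on the remainder's growth:
  \<open>1\<close>, \<open>a\<close> and \<open>q c\<close>.\<close>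

definition growth_radius :: "real \<Rightarrow> real \<Rightarrow> real \<Rightarrow> real" where
  "growth_radius A C q = (max 1 (max A (q * C)) + C) / 2"

definition decay_rate :: "real \<Rightarrow> real \<Rightarrow> real \<Rightarrow> real" where
  "decay_rate A C q =
     (2 + growth_radius A C q + 1 / growth_radius A C q) / (2 + C + 1 / C)"

context asep_weights begin

text \<open>The sum over the last site turns \<open>site True + site False\<close> into
  \<open>T\<close>, acting directly on the right vector.\<close>

lemma sum_fiber_weight:
  assumes "x \<in> configs m" "m \<le> n"
  shows "(\<Sum>\<tau>\<in>{\<tau> \<in> configs n. restrict_config m \<tau> = x}. weight \<psi> n \<tau>)
    = word (map x [0..<m]) ((T ^^ (n - m)) \<psi>) 0"
  using assms(2)
proof (induction n arbitrary: \<psi> rule: dec_induct)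
  case base
  have "{\<tau> \<in> configs m. restrict_config m \<tau> = x} = {x}"
    using assms(1) by (auto simp: restrict_config_ident)
  then show ?case by (simp add: weight_def)
next
  case (step n)
  let ?F = "{\<tau> \<in> configs n. restrict_config m \<tau> = x}" and ?u = "\<lambda>\<tau>. \<tau>(n := True) :: config"
  have res: "restrict_config m (?u \<tau>) = restrict_config m \<tau>" for \<tau>
    using step(1) by (auto simp: restrict_config_def fun_eq_iff)
  have "{\<tau> \<in> configs (Suc n). restrict_config m \<tau> = x} = ?F \<union> ?u ` ?F"
    unfolding configs_Suc using res by auto
  moreover have "inj_on ?u ?F"
  proof (rule inj_onI)
    fix \<sigma> \<tau> assume "\<sigma> \<in> ?F" "\<tau> \<in> ?F" "?u \<sigma> = ?u \<tau>"
    then show "\<sigma> = \<tau>"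
      by (auto simp: configs_def fun_eq_iff split: if_splits)
  qed
  moreover have "?F \<inter> ?u ` ?F = {}" by (auto simp: configs_def)
  moreover have "finite ?F" by (simp add: finite_configs)
  ultimately have "(\<Sum>\<tau>\<in>{\<tau> \<in> configs (Suc n). restrict_config m \<tau> = x}. weight \<psi> (Suc n) \<tau>)
      = (\<Sum>\<tau>\<in>?F. weight \<psi> (Suc n) \<tau>) + (\<Sum>\<tau>\<in>?F. weight \<psi> (Suc n) (?u \<tau>))"
    by (simp add: sum.union_disjoint sum.reindex)
  also have "\<dots> = (\<Sum>\<tau>\<in>?F. weight (T \<psi>) n \<tau>)"
    unfolding sum.distrib[symmetric]
  proof (intro sum.cong refl)
    fix \<tau> assume "\<tau> \<in> ?F"
    then have "\<not> \<tau> n" by (simp add: configs_def)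
    moreover have "map (?u \<tau>) [0..<n] = map \<tau> [0..<n]" by auto
    ultimately show "weight \<psi> (Suc n) \<tau> + weight \<psi> (Suc n) (?u \<tau>) = weight (T \<psi>) n \<tau>"
      using word_linear[of "map \<tau> [0..<n]" 1 "site True \<psi>" 1 "site False \<psi>"]
      by (simp add: weight_def word_append T_def[abs_def])
  qed
  also have "\<dots> = word (map x [0..<m]) ((T ^^ (n - m)) (T \<psi>)) 0" by (rule step.IH)
  also have "(T ^^ (n - m)) (T \<psi>) = (T ^^ (Suc n - m)) \<psi>"
    using step(1) by (simp add: Suc_diff_le funpow_Suc_right del: funpow.simps)
  finally show ?case .
qed

lemma sum_weight: "(\<Sum>\<tau>\<in>configs n. weight \<psi> n \<tau>) = (T ^^ n) \<psi> 0"
proof -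
  have "{\<tau> \<in> configs n. restrict_config 0 \<tau> = (\<lambda>_. False)} = configs n"
    by (auto simp: restrict_config_def)
  then show ?thesis
    using sum_fiber_weight[of "\<lambda>_. False" 0 n \<psi>] by (simp add: configs_def)
qed

lemma asep_measure_weight:
  assumes "right_vector \<phi>" "positive n \<phi>" "1 \<le> n"
  shows "set_pmf (asep_measure \<alpha> \<beta> \<gamma> \<delta> q n) \<subseteq> configs n"
    and "\<tau> \<in> configs n \<Longrightarrow> pmf (asep_measure \<alpha> \<beta> \<gamma> \<delta> q n) \<tau> = weight \<phi> n \<tau> / (T ^^ n) \<phi> 0"
    and "0 < (T ^^ n) \<phi> 0"
proof -
  let ?V = "configs n" and ?Z = "(T ^^ n) \<phi> 0"
  have w: "0 < weight \<phi> n \<tau>" for \<tau> using assms(2) by (simp add: weight_def positive_def)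
  have "(\<lambda>_. False) \<in> ?V" by (simp add: configs_def)
  then show Z: "0 < ?Z" unfolding sum_weight[symmetric]
    using w finite_configs by (intro sum_pos) auto
  define p where "p \<tau> = (if \<tau> \<in> ?V then weight \<phi> n \<tau> / ?Z else 0)" for \<tau>
  have p0: "0 \<le> p \<tau>" for \<tau> using w[of \<tau>] Z by (simp add: p_def)
  have "(\<integral>\<^sup>+\<tau>. ennreal (p \<tau>) \<partial>count_space UNIV) = (\<Sum>\<tau>\<in>?V. ennreal (p \<tau>))"
    by (rule nn_integral_count_space'[OF finite_configs]) (auto simp: p_def)
  also have "\<dots> = ennreal (\<Sum>\<tau>\<in>?V. p \<tau>)" using p0 by (intro sum_ennreal) auto
  also have "(\<Sum>\<tau>\<in>?V. p \<tau>) = (\<Sum>\<tau>\<in>?V. weight \<phi> n \<tau>) / ?Z"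
    by (simp add: p_def sum_divide_distrib)
  also have "\<dots> = 1" using Z by (simp add: sum_weight)
  finally have p1: "(\<integral>\<^sup>+\<tau>. ennreal (p \<tau>) \<partial>count_space UNIV) = 1" by simp
  let ?\<mu> = "embed_pmf p"
  have pmf: "pmf ?\<mu> \<tau> = p \<tau>" for \<tau> using p0 p1 by (intro pmf_embed_pmf)
  have set: "set_pmf ?\<mu> \<subseteq> ?V" by (auto simp: set_pmf_eq pmf p_def)
  have "balanced ?V (jump_rate \<alpha> \<beta> \<gamma> \<delta> q n) (\<lambda>\<tau>. 1 / ?Z * weight \<phi> n \<tau> + 0 * weight \<phi> n \<tau>)"
    by (rule balanced_linear[OF weight_balanced weight_balanced]) (use assms in auto)
  then have "balanced ?V (jump_rate \<alpha> \<beta> \<gamma> \<delta> q n) (pmf ?\<mu>)"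
    unfolding balanced_def pmf by (simp add: p_def)
  then have eq: "asep_measure \<alpha> \<beta> \<gamma> \<delta> q n = ?\<mu>"
    using set rates q by (intro asep_measure_eqI) auto
  show "set_pmf (asep_measure \<alpha> \<beta> \<gamma> \<delta> q n) \<subseteq> ?V" using eq set by simp
  show "pmf (asep_measure \<alpha> \<beta> \<gamma> \<delta> q n) \<tau> = weight \<phi> n \<tau> / ?Z" if "\<tau> \<in> ?V"
    using that by (simp add: eq pmf p_def)
qed

lemma marginal_weight:
  assumes "right_vector \<phi>" "positive n \<phi>" "1 \<le> n" "m \<le> n" "x \<in> configs m"
  shows "pmf (marginal m (asep_measure \<alpha> \<beta> \<gamma> \<delta> q n)) x
    = word (map x [0..<m]) ((T ^^ (n - m)) \<phi>) 0 / (T ^^ n) \<phi> 0"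
proof -
  note mu = asep_measure_weight[OF assms(1-3)]
  have "pmf (marginal m (asep_measure \<alpha> \<beta> \<gamma> \<delta> q n)) x
      = (\<Sum>\<tau>\<in>{\<tau> \<in> configs n. restrict_config m \<tau> = x}. weight \<phi> n \<tau> / (T ^^ n) \<phi> 0)"
    unfolding pmf_marginal[OF mu(1)] by (intro sum.cong) (auto simp: mu(2))
  then show ?thesis
    by (simp add: sum_divide_distrib[symmetric] sum_fiber_weight[OF assms(5,4)])
qed

text \<open>Since \<open>\<Lambda> = (1 + c) (1 + 1 / c)\<close>, the eigenvalues
  \<open>1 + 1 / c\<close> of a particle and \<open>1 + c\<close> of a hole are
  \<open>\<Lambda>\<close> times the Bernoulli probabilities \<open>1 / (1 + c)\<close> and
  \<open>c / (1 + c)\<close>.\<close>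

lemma word_geom_bernoulli:
  assumes "x \<in> configs m"
  shows "word (map x [0..<m]) (geom (1 / c)) 0 = \<Lambda> ^ m * pmf (bernoulli_product m (1 / (1 + c))) x"
proof -
  have P: "word (map x [0..<k]) (\<lambda>j. s * geom (1 / c) j)
     = (\<lambda>j. (\<Prod>i<k. if x i then 1 + 1 / c else 1 + c) * s * geom (1 / c) j)" for k s
  proof (induction k arbitrary: s)
    case (Suc k)
    have "site t (\<lambda>j. s * geom (1 / c) j) = (\<lambda>j. ((if t then 1 + 1 / c else 1 + c) * s) * geom (1 / c) j)" for t
      using site_linear[of t s "geom (1 / c)" 0] by (auto simp: geom_site_c)
    then show ?case by (simp add: word_append Suc del: if_distrib mult.assoc) (simp add: mult_ac)
  qed simp
  have "geom (1 / c) 0 = 1" by (simp add: geom_def)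
  then have "word (map x [0..<m]) (geom (1 / c)) 0 = (\<Prod>i<m. if x i then 1 + 1 / c else 1 + c)"
    using fun_cong[OF P[of m 1], of 0] by simp
  also have "\<dots> = (\<Prod>i<m. \<Lambda> * (if x i then 1 / (1 + c) else 1 - 1 / (1 + c)))"
  proof (intro prod.cong refl)
    have "\<Lambda> = (1 + c) * (1 + 1 / c)" using cd by (simp add: \<Lambda>_def field_simps)
    moreover have "1 - 1 / (1 + c) = c / (1 + c)" using cd by (simp add: field_simps)
    moreover have "c * (1 + 1 / c) = 1 + c" using cd by (simp add: field_simps)
    ultimately show "(if x i then 1 + 1 / c else 1 + c)
        = \<Lambda> * (if x i then 1 / (1 + c) else 1 - 1 / (1 + c))" for i
      using cd by (simp add: mult_ac)
  qed
  also have "\<dots> = \<Lambda> ^ m * (\<Prod>i<m. if x i then 1 / (1 + c) else 1 - 1 / (1 + c))"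
    by (simp add: prod.distrib)
  also have "(\<Prod>i<m. if x i then 1 / (1 + c) else 1 - 1 / (1 + c)) = pmf (bernoulli_product m (1 / (1 + c))) x"
    using assms cd by (subst pmf_bernoulli_product) auto
  finally show ?thesis .
qed

lemma growth_radius:
  defines "r \<equiv> growth_radius a c q"
  shows "1 < r" "a < r" "q * c < r" "r < c"
proof -
  have "q * c < c" using q cd by simp
  then have "max 1 (max a (q * c)) < c" using cd ac by simp
  moreover obtain t where "t = max 1 (max a (q * c))" by blast
  moreover from this have "1 \<le> t" "a \<le> t" "q * c \<le> t" by auto
  ultimately show "1 < r" "a < r" "q * c < r" "r < c"
    unfolding r_def growth_radius_def by auto
qed

lemma decay_rate: "0 < decay_rate a c q" "decay_rate a c q < 1"
proof -
  let ?r = "growth_radius a c q"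
  note r = growth_radius
  have "c + 1 / c - (?r + 1 / ?r) = (c - ?r) * (c * ?r - 1) / (c * ?r)"
    using r cd by (simp add: field_simps)
  moreover have "1 < c * ?r" using r cd by (simp add: less_1_mult)
  then have "0 < (c - ?r) * (c * ?r - 1) / (c * ?r)"
    using r by (intro divide_pos_pos mult_pos_pos) auto
  ultimately have "2 + ?r + 1 / ?r < 2 + c + 1 / c" by linarith
  moreover have "0 < 2 + ?r + 1 / ?r" using r by (intro add_pos_pos) auto
  ultimately show "0 < decay_rate a c q" "decay_rate a c q < 1"
    by (simp_all add: decay_rate_def)
qed

text \<open>
  Since \<open>\<phi> - K geom (1/c)\<close> has Chebyshev coordinates of growth \<open>r < c\<close>, it contributes
  \<open>O((2 + r + 1/r)\<^sup>n)\<close>, while the geometric vector produces exactly the Bernoulli weights.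
\<close>

lemma total_variation_bound:
  "\<exists>M W. 1 \<le> M \<and> 1 \<le> W \<and> (\<forall>m n. 1 \<le> m \<longrightarrow> m \<le> n \<longrightarrow>
     d_TV m (marginal m (asep_measure \<alpha> \<beta> \<gamma> \<delta> q n)) (bernoulli_product m (1 / (1 + c)))
       \<le> M * W ^ m * decay_rate a c q ^ n)"
proof -
  define r where "r = growth_radius a c q"
  define l where "l = 2 + r + 1 / r"
  define \<theta> where "\<theta> = decay_rate a c q"
  have r: "1 < r" "a < r" "q * c < r" "r < c" using growth_radius by (simp_all add: r_def)
  have l: "1 \<le> l" using r by (simp add: l_def)
  have \<theta>: "0 < \<theta>" "\<theta> < 1" "\<theta> = l / \<Lambda>"
    using decay_rate by (simp_all add: \<theta>_def decay_rate_def l_def r_def \<Lambda>_def)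
  note \<Lambda> = \<Lambda>_pos
  obtain \<phi> N where \<phi>: "right_vector \<phi>" "\<And>n. N \<le> n \<Longrightarrow> positive n \<phi>"
    using positive_right_vector by blast
  obtain K B where KB: "cheb_bounded B r (\<lambda>j. 1 * \<phi> j + (- K) * geom (1 / c) j)"
    using right_vector_decomposition[OF \<phi>(1) less_imp_le[OF r(1)] r(2-4)] by blast
  define \<psi> where "\<psi> = (\<lambda>j. 1 * \<phi> j + (- K) * geom (1 / c) j)"
  have \<psi>: "cheb_bounded B r \<psi>" using KB by (simp add: \<psi>_def)
  have B: "0 \<le> B" by (rule cheb_bounded_nonneg[OF \<psi>])
  have \<phi>_eq: "\<phi> = (\<lambda>j. K * geom (1 / c) j + 1 * \<psi> j)" by (simp add: \<psi>_def)
  \<comment> \<open>Positivity of \<open>\<phi>\<close> is known only for words of length at least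
    \<open>N\<close>; summing out \<open>N\<close> sites first makes it available for all lengths,
    as the lower bound requires.\<close>
  have "0 < word (replicate j True) ((T ^^ N) \<phi>) 0" for j
    using positive_T_pow[of j N \<phi>] \<phi>(2)[of "j + N"] by (simp add: positive_def)
  then obtain \<kappa> where \<kappa>: "0 < \<kappa>" "\<And>n. \<kappa> * \<Lambda> ^ n \<le> (T ^^ n) ((T ^^ N) \<phi>) 0"
    using T_pow_lower_bound by blast
  define \<kappa>' where "\<kappa>' = \<kappa> / \<Lambda> ^ N"
  have \<kappa>': "0 < \<kappa>'" using \<kappa> \<Lambda> by (simp add: \<kappa>'_def)
  have Z: "\<kappa>' * \<Lambda> ^ n \<le> (T ^^ n) \<phi> 0" if "N \<le> n" for n
  proof -
    have "\<kappa> * \<Lambda> ^ (n - N) \<le> (T ^^ (n - N)) ((T ^^ N) \<phi>) 0" by (rule \<kappa>(2))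
    also have "(T ^^ (n - N)) ((T ^^ N) \<phi>) = (T ^^ n) \<phi>"
      using that by (simp flip: funpow_add[unfolded o_def, THEN fun_cong])
    finally show ?thesis using that \<Lambda> by (simp add: \<kappa>'_def power_diff)
  qed
  have Tb: "cheb_bounded (B * l ^ n) r ((T ^^ n) \<psi>)" for n
    unfolding l_def by (rule cheb_bounded_T_pow[OF \<psi>]) (use r in simp)
  define D where "D = B * cheb_radius / \<kappa>'"
  define M where "M = max (max 1 D) (1 / \<theta> ^ N)"
  have D: "0 \<le> D" using B cheb_radius \<kappa>' by (simp add: D_def)
  have bound: "d_TV m (marginal m (asep_measure \<alpha> \<beta> \<gamma> \<delta> q n)) (bernoulli_product m (1 / (1 + c)))
       \<le> M * (2 * site_norm) ^ m * \<theta> ^ n" if mn: "1 \<le> m" "m \<le> n" for m n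
  proof (cases "N \<le> n")
    case True
    let ?\<mu> = "marginal m (asep_measure \<alpha> \<beta> \<gamma> \<delta> q n)" and ?b = "bernoulli_product m (1 / (1 + c))"
    let ?Z = "(T ^^ n) \<phi> 0"
    have Z0: "0 < ?Z" using Z[OF True] \<kappa>' \<Lambda> by (meson less_le_trans mult_pos_pos zero_less_power)
    have pt: "\<bar>pmf ?\<mu> x - pmf ?b x\<bar> \<le> 2 * D * site_norm ^ m * \<theta> ^ n" if x: "x \<in> configs m" for x
    proof -
      let ?w = "map x [0..<m]"
      define E where "E = word ?w ((T ^^ (n - m)) \<psi>) 0"
      define E' where "E' = (T ^^ n) \<psi> 0"
      have 1: "word ?w ((T ^^ (n - m)) \<phi>) 0 = K * (\<Lambda> ^ n * pmf ?b x) + E"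
      proof -
        have "(T ^^ (n - m)) \<phi> = (\<lambda>j. (K * \<Lambda> ^ (n - m)) * geom (1 / c) j + 1 * (T ^^ (n - m)) \<psi> j)"
          by (subst \<phi>_eq) (simp only: T_pow_linear geom_T_pow mult.assoc)
        then have "word ?w ((T ^^ (n - m)) \<phi>) 0
            = (K * \<Lambda> ^ (n - m)) * (\<Lambda> ^ m * pmf ?b x) + E"
          by (simp only: word_linear) (simp add: word_geom_bernoulli[OF x] E_def)
        moreover have "\<Lambda> ^ (n - m) * \<Lambda> ^ m = \<Lambda> ^ n" using mn by (simp flip: power_add)
        ultimately show ?thesis by (metis mult.assoc)
      qed
      have 2: "?Z = K * \<Lambda> ^ n + E'"
        by (subst \<phi>_eq, subst T_pow_linear) (simp add: geom_T_pow geom_def E'_def)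
      \<comment> \<open>The contributions of \<open>K\<close> cancel exactly; only remainders are
        left above the partition function.\<close>
      have "pmf ?\<mu> x - pmf ?b x = (E - pmf ?b x * E') / ?Z"
        using marginal_weight[OF \<phi>(1) \<phi>(2)[OF True] _ mn(2) x] mn 1 2 Z0
        by (simp add: field_simps)
      then have "\<bar>pmf ?\<mu> x - pmf ?b x\<bar> = \<bar>E - pmf ?b x * E'\<bar> / ?Z" using Z0 by simp
      also have "\<dots> \<le> \<bar>E - pmf ?b x * E'\<bar> / (\<kappa>' * \<Lambda> ^ n)"
        using Z[OF True] Z0 \<kappa>' \<Lambda> by (intro divide_left_mono mult_pos_pos) auto
      also have "\<dots> \<le> (2 * (B * cheb_radius) * site_norm ^ m * l ^ n) / (\<kappa>' * \<Lambda> ^ n)"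
      proof (rule divide_right_mono)
        have "\<bar>E\<bar> \<le> B * l ^ n * site_norm ^ m * cheb_radius"
        proof -
          \<comment> \<open>The powers of \<open>T\<close> are taken at the sharp radius
            \<open>r\<close>; only then is the radius enlarged to one where \<open>X\<close> is
            controlled. As \<open>l \<ge> 1\<close>, the exponent \<open>n - m\<close> may be
            rounded up to \<open>n\<close>.\<close>
          have "cheb_bounded (B * l ^ n) cheb_radius ((T ^^ (n - m)) \<psi>)"
            using r cheb_radius l B
            by (intro cheb_bounded_mono[OF Tb[of "n - m"]] mult_left_mono power_increasing) auto
          from cheb_bounded_0[OF cheb_bounded_word[OF this, of ?w]] show ?thesis by (simp add: E_def)
        qed
        moreover have "\<bar>pmf ?b x * E'\<bar> \<le> B * l ^ n * site_norm ^ m * cheb_radius"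
        proof -
          have "\<bar>pmf ?b x * E'\<bar> \<le> 1 * \<bar>E'\<bar>"
            unfolding abs_mult by (intro mult_right_mono) (auto simp: pmf_le_1)
          also have "\<dots> \<le> B * l ^ n * 1 * r" using cheb_bounded_0[OF Tb[of n]] by (simp add: E'_def)
          also have "\<dots> \<le> B * l ^ n * site_norm ^ m * cheb_radius"
            using B l r cheb_radius site_norm by (intro mult_mono mult_left_mono one_le_power) auto
          finally show ?thesis .
        qed
        ultimately show "\<bar>E - pmf ?b x * E'\<bar> \<le> 2 * (B * cheb_radius) * site_norm ^ m * l ^ n"
          using abs_triangle_ineq4[of E "pmf ?b x * E'"] by (simp add: mult_ac)
      qed (use \<kappa>' \<Lambda> in simp)
      also have "\<dots> = 2 * D * site_norm ^ m * \<theta> ^ n" by (simp add: D_def \<theta>(3) power_divide)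
      finally show ?thesis .
    qed
    have "d_TV m ?\<mu> ?b \<le> 1 / 2 * (\<Sum>x\<in>configs m. 2 * D * site_norm ^ m * \<theta> ^ n)"
      unfolding d_TV_def using pt by (intro mult_left_mono sum_mono) auto
    also have "\<dots> = real (card (configs m)) * (D * site_norm ^ m * \<theta> ^ n)" by simp
    also have "\<dots> \<le> 2 ^ m * (D * site_norm ^ m * \<theta> ^ n)"
      using D site_norm \<theta> card_configs[of m]
      by (intro mult_right_mono) (auto simp: numeral_power_le_of_nat_cancel_iff of_nat_le_numeral_power_cancel_iff)
    also have "\<dots> = D * (2 * site_norm) ^ m * \<theta> ^ n" by (simp add: power_mult_distrib)
    also have "\<dots> \<le> M * (2 * site_norm) ^ m * \<theta> ^ n"
      using site_norm \<theta> by (intro mult_right_mono) (auto simp: M_def)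
    finally show ?thesis .
  next
    case False
    \<comment> \<open>For these finitely many \<open>n\<close> the summand
      \<open>1 / \<theta> ^ N\<close> in \<open>M\<close> makes the asserted bound at least
      \<open>1\<close>.\<close>
    have "d_TV m (marginal m (asep_measure \<alpha> \<beta> \<gamma> \<delta> q n)) (bernoulli_product m (1 / (1 + c))) \<le> 1"
      by (rule d_TV_le_1[OF set_pmf_marginal set_pmf_bernoulli_product])
    also have "1 = 1 / \<theta> ^ N * 1 * \<theta> ^ N" using \<theta>(1) by simp
    also have "\<dots> \<le> M * (2 * site_norm) ^ m * \<theta> ^ n"
      using \<theta> site_norm False
      by (intro mult_mono power_decreasing one_le_power) (auto simp: M_def le_max_iff_disj)
    finally show ?thesis .
  qed
  show ?thesis
    using bound site_norm by (intro exI[of _ M] exI[of _ "2 * site_norm"]) (auto simp: M_def \<theta>_def)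
qed

end

section \<open>Weak convergence\<close>

lemma compact_config: "compact (UNIV :: config set)"
proof -
  have "compact_space (euclidean :: bool topology)"
    by (simp add: compact_space_def compactin_euclidean_iff finite_imp_compact)
  then have "compact_space (euclidean :: config topology)"
    unfolding euclidean_product_topology[symmetric] compact_space_product_topology by simp
  then show ?thesis by (simp add: compact_space_def compactin_euclidean_iff)
qed

lemma open_cylinder: "open {\<sigma> :: config. \<forall>i<m. \<sigma> i = \<tau> i}"
proof -
  have "open ((\<lambda>\<sigma> :: config. \<sigma> i) -` {\<tau> i})" for i
    by (intro open_vimage continuous_on_product_coordinates) (rule discrete_topology_class.open_discrete)
  then have "open (\<Inter>i\<in>{..<m}. (\<lambda>\<sigma> :: config. \<sigma> i) -` {\<tau> i})" by blast
  also have "(\<Inter>i\<in>{..<m}. (\<lambda>\<sigma> :: config. \<sigma> i) -` {\<tau> i}) = {\<sigma>. \<forall>i<m. \<sigma> i = \<tau> i}" by auto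
  finally show ?thesis .
qed

lemma open_contains_cylinder:
  assumes "open U" "(\<tau> :: config) \<in> U"
  shows "\<exists>m. \<forall>\<sigma>. (\<forall>i<m. \<sigma> i = \<tau> i) \<longrightarrow> \<sigma> \<in> U"
proof -
  have "openin (product_topology (\<lambda>i. euclidean) UNIV) U"
    using assms(1) by (simp add: euclidean_product_topology)
  then obtain X where X: "\<tau> \<in> (\<Pi>\<^sub>E i\<in>UNIV. X i)" "finite {i. X i \<noteq> topspace euclidean}" "(\<Pi>\<^sub>E i\<in>UNIV. X i) \<subseteq> U"
    using product_topology_open_contains_basis[of "\<lambda>_. euclidean" UNIV U \<tau>] assms(2) by blast
  define m where "m = Suc (Max {i. X i \<noteq> UNIV})"
  have m: "i < m" if "X i \<noteq> UNIV" for i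
  proof -
    have "i \<le> Max {i. X i \<noteq> UNIV}" using X(2) that by (intro Max_ge) auto
    then show ?thesis by (simp add: m_def)
  qed
  show ?thesis
  proof (intro exI allI impI)
    fix \<sigma> assume \<sigma>: "\<forall>i<m. \<sigma> i = \<tau> i"
    have "\<sigma> i \<in> X i" for i
      using m[of i] \<sigma> X(1) by (cases "X i = UNIV") auto
    then show "\<sigma> \<in> U" using X(3) by auto
  qed
qed

text \<open>Uniform continuity by compactness: finitely many cylinders on which \<open>f\<close>
  stays within \<open>\<epsilon> / 2\<close> of its value at the centre cover the space, and a
  configuration shares its cylinder with every restriction to at least that many sites.\<close>

lemma continuous_cylinder_approximation:
  fixes f :: "config \<Rightarrow> real"
  assumes "continuous_on UNIV f" "0 < \<epsilon>"
  shows "\<exists>m. \<forall>k\<ge>m. \<forall>\<tau>. \<bar>f (restrict_config k \<tau>) - f \<tau>\<bar> < \<epsilon>"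
proof -
  have "\<exists>m. \<forall>\<sigma>. (\<forall>i<m. \<sigma> i = \<tau> i) \<longrightarrow> \<bar>f \<sigma> - f \<tau>\<bar> < \<epsilon> / 2" for \<tau>
  proof -
    have "open (f -` ball (f \<tau>) (\<epsilon> / 2))" using assms(1) by (intro open_vimage open_ball)
    moreover have "\<tau> \<in> f -` ball (f \<tau>) (\<epsilon> / 2)" using assms(2) by simp
    ultimately show ?thesis
      using open_contains_cylinder by (fastforce simp: dist_real_def abs_minus_commute)
  qed
  then obtain M where M: "\<And>\<tau> \<sigma>. (\<forall>i<M \<tau>. \<sigma> i = \<tau> i) \<Longrightarrow> \<bar>f \<sigma> - f \<tau>\<bar> < \<epsilon> / 2" by metis
  let ?U = "\<lambda>\<tau>. {\<sigma> :: config. \<forall>i<M \<tau>. \<sigma> i = \<tau> i}"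
  obtain F where F: "finite F" "UNIV \<subseteq> (\<Union>\<tau>\<in>F. ?U \<tau>)"
  proof (rule compactE_image[OF compact_config, of UNIV ?U])
    show "open (?U \<tau>)" for \<tau> by (rule open_cylinder)
    show "UNIV \<subseteq> (\<Union>\<tau>\<in>UNIV. ?U \<tau>)" by blast
  qed
  define m where "m = Max (M ` F)"
  have "\<bar>f (restrict_config k \<sigma>) - f \<sigma>\<bar> < \<epsilon>" if "m \<le> k" for k \<sigma>
  proof -
    obtain \<tau> where \<tau>: "\<tau> \<in> F" "\<forall>i<M \<tau>. \<sigma> i = \<tau> i" using F(2) by blast
    have "M \<tau> \<le> m" unfolding m_def using F(1) \<tau>(1) by (intro Max_ge) auto
    then have "M \<tau> \<le> k" using that by simp
    then have "\<forall>i<M \<tau>. restrict_config k \<sigma> i = \<tau> i" using \<tau>(2) by (auto simp: restrict_config_def)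
    from M[OF this] M[OF \<tau>(2)] show ?thesis by linarith
  qed
  then show ?thesis by blast
qed

lemma restrict_config_eq_prod_emb:
  assumes "x \<in> configs m"
  shows "{\<tau>. restrict_config m \<tau> = x}
    = prod_emb UNIV (\<lambda>_. measure_pmf (bernoulli_pmf \<rho>)) {..<m} (\<Pi>\<^sub>E i\<in>{..<m}. {x i})"
proof -
  have "restrict_config m \<tau> = x \<longleftrightarrow> (\<forall>i<m. \<tau> i = x i)" for \<tau>
    using assms by (auto simp: restrict_config_def configs_def fun_eq_iff) (meson not_less)+
  then show ?thesis
    by (auto simp: prod_emb_def restrict_def PiE_def Pi_def extensional_def)
qed

lemma sets_bernoulli_measure: "sets (bernoulli_measure \<rho>) = sets config_space"
  unfolding bernoulli_measure_def config_space_def by (intro sets_PiM_cong) auto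

lemma space_bernoulli_measure: "space (bernoulli_measure \<rho>) = UNIV"
  by (simp add: bernoulli_measure_def space_PiM)

lemma prob_space_bernoulli_measure: "prob_space (bernoulli_measure \<rho>)"
  unfolding bernoulli_measure_def by (intro prob_space_PiM prob_space_measure_pmf)

lemma restrict_config_sets:
  assumes "x \<in> configs m" shows "{\<tau>. restrict_config m \<tau> = x} \<in> sets config_space"
  unfolding restrict_config_eq_prod_emb[OF assms, of 0] sets_bernoulli_measure[of 0, symmetric] bernoulli_measure_def
  by (intro sets_PiM_I) auto

lemma bernoulli_measure_cylinder:
  assumes "0 \<le> \<rho>" "\<rho> \<le> 1" "x \<in> configs m"
  shows "measure (bernoulli_measure \<rho>) {\<tau>. restrict_config m \<tau> = x} = pmf (bernoulli_product m \<rho>) x"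
proof -
  interpret product_prob_space "\<lambda>_::nat. measure_pmf (bernoulli_pmf \<rho>)" UNIV
    by unfold_locales
  have "measure (bernoulli_measure \<rho>) {\<tau>. restrict_config m \<tau> = x}
     = (\<Prod>i<m. measure (measure_pmf (bernoulli_pmf \<rho>)) {x i})"
    unfolding restrict_config_eq_prod_emb[OF assms(3), of \<rho>] bernoulli_measure_def
    by (rule measure_PiM_emb) auto
  also have "\<dots> = (\<Prod>i<m. if x i then \<rho> else 1 - \<rho>)"
    using assms by (intro prod.cong) (auto simp: measure_pmf_single)
  finally show ?thesis using pmf_bernoulli_product[OF assms] by simp
qed

lemma restrict_config_indicator:
  "f (restrict_config m \<tau>) = (\<Sum>x\<in>configs m. f x * indicator {\<tau>. restrict_config m \<tau> = x} \<tau>)"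
  for f :: "config \<Rightarrow> real"
proof -
  have "(\<Sum>x\<in>configs m. f x * indicator {\<tau>. restrict_config m \<tau> = x} \<tau>)
      = (\<Sum>x\<in>configs m. if x = restrict_config m \<tau> then f x else 0)"
    by (intro sum.cong) (auto simp: indicator_def)
  then show ?thesis by (simp add: finite_configs restrict_config_in_configs)
qed

lemma measurable_cylinder_function:
  fixes f :: "config \<Rightarrow> real"
  shows "(\<lambda>\<tau>. f (restrict_config m \<tau>)) \<in> borel_measurable config_space"
  unfolding restrict_config_indicator
  by (intro borel_measurable_sum borel_measurable_times borel_measurable_const
      borel_measurable_indicator restrict_config_sets)

text \<open>Measurability is for the product \<open>\<sigma>\<close>-algebra, which is generated by
  cylinders; \<open>f\<close> is the limit of its cylinder approximations.\<close>

lemma continuous_measurable_config: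
  fixes f :: "config \<Rightarrow> real"
  assumes "continuous_on UNIV f"
  shows "f \<in> borel_measurable config_space"
proof (rule borel_measurable_LIMSEQ_real[OF _ measurable_cylinder_function])
  fix \<tau> :: config
  show "(\<lambda>k. f (restrict_config k \<tau>)) \<longlonglongrightarrow> f \<tau>"
  proof (rule LIMSEQ_I)
    fix \<epsilon> :: real assume "0 < \<epsilon>"
    from continuous_cylinder_approximation[OF assms this]
    show "\<exists>m. \<forall>k\<ge>m. norm (f (restrict_config k \<tau>) - f \<tau>) < \<epsilon>" by auto
  qed
qed

lemma integral_bernoulli_cylinder:
  fixes f :: "config \<Rightarrow> real"
  assumes "0 \<le> \<rho>" "\<rho> \<le> 1"
  shows "(\<integral>\<tau>. f (restrict_config m \<tau>) \<partial>bernoulli_measure \<rho>)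
    = (\<Sum>x\<in>configs m. f x * pmf (bernoulli_product m \<rho>) x)"
proof -
  interpret prob_space "bernoulli_measure \<rho>" by (rule prob_space_bernoulli_measure)
  have "(\<integral>\<tau>. f (restrict_config m \<tau>) \<partial>bernoulli_measure \<rho>)
     = (\<Sum>x\<in>configs m. \<integral>\<tau>. f x * indicator {\<tau>. restrict_config m \<tau> = x} \<tau> \<partial>bernoulli_measure \<rho>)"
    unfolding restrict_config_indicator[of f]
    by (intro Bochner_Integration.integral_sum integrable_mult_right integrable_real_indicator)
      (auto simp: sets_bernoulli_measure restrict_config_sets less_top[symmetric])
  also have "\<dots> = (\<Sum>x\<in>configs m. f x * pmf (bernoulli_product m \<rho>) x)"
    by (intro sum.cong refl) (simp add: space_bernoulli_measure bernoulli_measure_cylinder assms)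
  finally show ?thesis .
qed

lemma integral_config_measure:
  fixes f :: "config \<Rightarrow> real"
  assumes "f \<in> borel_measurable config_space"
  shows "(\<integral>\<tau>. f \<tau> \<partial>config_measure \<mu>) = measure_pmf.expectation \<mu> f"
  unfolding config_measure_def using assms
  by (subst integral_distr) (auto simp: config_space_def space_PiM)

lemma expectation_cylinder:
  fixes f :: "config \<Rightarrow> real"
  shows "measure_pmf.expectation \<mu> (\<lambda>\<tau>. f (restrict_config m \<tau>)) = (\<Sum>x\<in>configs m. f x * pmf (marginal m \<mu>) x)"
proof -
  have "measure_pmf.expectation (marginal m \<mu>) f = measure_pmf.expectation \<mu> (\<lambda>\<tau>. f (restrict_config m \<tau>))"
    by (simp add: marginal_def restrict_config_def[abs_def])
  then show ?thesis by (simp add: expectation_configs[OF set_pmf_marginal] mult.commute)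
qed

lemma (in prob_space) expectation_diff_le:
  fixes f g :: "'a \<Rightarrow> real"
  assumes "integrable M f" "integrable M g" "\<And>x. \<bar>f x - g x\<bar> \<le> \<epsilon>"
  shows "\<bar>expectation f - expectation g\<bar> \<le> \<epsilon>"
proof -
  have "expectation f - expectation g = expectation (\<lambda>x. f x - g x)" using assms by simp
  moreover have "\<bar>expectation (\<lambda>x. f x - g x)\<bar> \<le> expectation (\<lambda>x. \<bar>f x - g x\<bar>)"
    by (rule integral_abs_bound)
  moreover have "expectation (\<lambda>x. \<bar>f x - g x\<bar>) \<le> expectation (\<lambda>_. \<epsilon>)"
    using assms by (intro integral_mono) auto
  moreover have "expectation (\<lambda>_. \<epsilon>) = \<epsilon>" by (simp add: prob_space)
  ultimately show ?thesis by linarith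
qed

text \<open>A third of \<open>\<epsilon>\<close> goes to the cylinder approximation under each of
  the two measures, the last third to the marginals, whose integrals differ by at most
  \<open>2 B\<close> times the total variation distance.\<close>

lemma weakly_converges_bernoulli:
  assumes \<rho>: "0 \<le> \<rho>" "\<rho> \<le> 1"
    and tv: "\<And>m. 1 \<le> m \<Longrightarrow> (\<lambda>n. d_TV m (marginal m (\<mu> n)) (bernoulli_product m \<rho>)) \<longlonglongrightarrow> 0"
  shows "weakly_converges (\<lambda>n. config_measure (\<mu> n)) (bernoulli_measure \<rho>)"
  unfolding weakly_converges_def
proof (intro allI impI, elim conjE)
  fix f :: "config \<Rightarrow> real"
  assume f: "continuous_on UNIV f" "bounded (range f)"
  note fm = continuous_measurable_config[OF f(1)]
  obtain B where B: "\<And>\<tau>. \<bar>f \<tau>\<bar> \<le> B" using f(2) by (auto simp: bounded_iff)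
  have B0: "0 \<le> B" using B[of "\<lambda>_. False"] by linarith
  interpret N: prob_space "bernoulli_measure \<rho>" by (rule prob_space_bernoulli_measure)
  have intN: "integrable (bernoulli_measure \<rho>) g" if "g \<in> borel_measurable config_space" "\<And>\<tau>. \<bar>g \<tau>\<bar> \<le> B" for g
    using that by (intro N.integrable_const_bound[of _ B])
      (auto simp: measurable_cong_sets[OF sets_bernoulli_measure refl])
  have int\<mu>: "integrable (measure_pmf (\<mu> n)) g" if "\<And>\<tau>. \<bar>g \<tau>\<bar> \<le> B" for g :: "config \<Rightarrow> real" and n
    using that by (intro measure_pmf.integrable_const_bound[of _ B]) auto
  show "(\<lambda>n. \<integral>\<tau>. f \<tau> \<partial>config_measure (\<mu> n)) \<longlonglongrightarrow> (\<integral>\<tau>. f \<tau> \<partial>bernoulli_measure \<rho>)"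
  proof (rule LIMSEQ_I)
    fix \<epsilon> :: real assume \<epsilon>: "0 < \<epsilon>"
    obtain m0 where m0: "\<And>k \<tau>. m0 \<le> k \<Longrightarrow> \<bar>f (restrict_config k \<tau>) - f \<tau>\<bar> < \<epsilon> / 3"
      using continuous_cylinder_approximation[OF f(1), of "\<epsilon> / 3"] \<epsilon> by auto
    define m where "m = Suc m0"
    let ?g = "\<lambda>\<tau>. f (restrict_config m \<tau>)"
    have g: "\<bar>f \<tau> - ?g \<tau>\<bar> \<le> \<epsilon> / 3" for \<tau>
      using m0[of m \<tau>] by (simp add: m_def abs_minus_commute)
    let ?d = "\<lambda>n. d_TV m (marginal m (\<mu> n)) (bernoulli_product m \<rho>)"
    have "(\<lambda>n. 2 * B * ?d n) \<longlonglongrightarrow> 2 * B * 0" by (intro tendsto_intros tv) (simp add: m_def)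
    then have "eventually (\<lambda>n. 2 * B * ?d n < \<epsilon> / 3) sequentially"
      using \<epsilon> by (intro order_tendstoD) auto
    then obtain n0 where n0: "\<And>n. n0 \<le> n \<Longrightarrow> 2 * B * ?d n < \<epsilon> / 3"
      by (auto simp: eventually_sequentially)
    have "\<bar>(\<integral>\<tau>. f \<tau> \<partial>config_measure (\<mu> n)) - (\<integral>\<tau>. f \<tau> \<partial>bernoulli_measure \<rho>)\<bar> < \<epsilon>" if "n0 \<le> n" for n
    proof -
      have 1: "\<bar>measure_pmf.expectation (\<mu> n) f - measure_pmf.expectation (\<mu> n) ?g\<bar> \<le> \<epsilon> / 3"
        by (intro measure_pmf.expectation_diff_le int\<mu> B g)
      have 2: "\<bar>N.expectation f - N.expectation ?g\<bar> \<le> \<epsilon> / 3"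
        by (intro N.expectation_diff_le intN B g fm measurable_cylinder_function)
      have "measure_pmf.expectation (\<mu> n) ?g - N.expectation ?g
          = (\<Sum>x\<in>configs m. f x * (pmf (marginal m (\<mu> n)) x - pmf (bernoulli_product m \<rho>) x))"
        unfolding expectation_cylinder integral_bernoulli_cylinder[OF \<rho>]
        by (simp add: right_diff_distrib sum_subtractf)
      also have "\<bar>\<dots>\<bar> \<le> (\<Sum>x\<in>configs m. B * \<bar>pmf (marginal m (\<mu> n)) x - pmf (bernoulli_product m \<rho>) x\<bar>)"
        by (intro order_trans[OF sum_abs] sum_mono) (auto simp: abs_mult intro!: mult_right_mono B)
      also have "\<dots> = 2 * B * ?d n" by (simp add: d_TV_def sum_distrib_left)
      also have "\<dots> < \<epsilon> / 3" by (rule n0[OF that])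
      finally show ?thesis using 1 2 unfolding integral_config_measure[OF fm] by linarith
    qed
    then show "\<exists>n0. \<forall>n\<ge>n0. norm ((\<integral>\<tau>. f \<tau> \<partial>config_measure (\<mu> n)) - (\<integral>\<tau>. f \<tau> \<partial>bernoulli_measure \<rho>)) < \<epsilon>"
      by auto
  qed
qed

section \<open>Parameters\<close>

text \<open>\<open>p\<close> and \<open>m\<close> are the roots of
  \<open>x z^2 - (1 - q - x + y) z - y\<close>. Their sum and product give
  \<open>(1 + p) (1 + m) = (1 - q) / x\<close>, which inverts the parametrisation and, being
  positive, forces \<open>m > -1\<close>.\<close>

lemma phi_params:
  assumes "0 < x" "0 \<le> y" "0 \<le> q" "q < 1"
  defines "p \<equiv> phi_plus q x y" and "m \<equiv> phi_minus q x y"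
  shows "0 \<le> p" "-1 < m" "m \<le> 0" "x = (1 - q) / ((1 + p) * (1 + m))"
    "y = - (p * m) * ((1 - q) / ((1 + p) * (1 + m)))"
proof -
  define u where "u = 1 - q - x + y"
  define s where "s = sqrt (u\<^sup>2 + 4 * x * y)"
  have p: "p = (u + s) / (2 * x)" and m: "m = (u - s) / (2 * x)"
    by (simp_all add: p_def m_def phi_plus_def phi_minus_def u_def s_def)
  have xy: "0 \<le> 4 * x * y" using assms by simp
  have s2: "s\<^sup>2 = u\<^sup>2 + 4 * x * y" unfolding s_def using xy by simp
  have "\<bar>u\<bar> = sqrt (u\<^sup>2)" by simp
  also have "\<dots> \<le> s" unfolding s_def using xy by (intro real_sqrt_le_mono) simp
  finally have us: "\<bar>u\<bar> \<le> s" .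
  show p0: "0 \<le> p" unfolding p using us assms by (intro divide_nonneg_pos) auto
  show "m \<le> 0" unfolding m using us assms by (intro divide_nonpos_pos) auto
  have sum: "p + m = u / x" unfolding p m using assms by (simp add: field_simps)
  have "p * m = (u\<^sup>2 - s\<^sup>2) / (4 * x\<^sup>2)"
    unfolding p m by (simp add: power2_eq_square algebra_simps)
  also have "\<dots> = - y / x" using assms s2 by (simp add: field_simps power2_eq_square)
  finally have prod: "p * m = - y / x" .
  have "(1 + p) * (1 + m) = 1 + (p + m) + p * m" by (simp add: algebra_simps)
  also have "\<dots> = (1 - q) / x" unfolding sum prod using assms by (simp add: u_def field_simps)
  finally have pm: "(1 + p) * (1 + m) = (1 - q) / x" .
  then have "0 < (1 + p) * (1 + m)" using assms by simp
  then show "-1 < m" using p0 by (simp add: zero_less_mult_iff)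
  show x: "x = (1 - q) / ((1 + p) * (1 + m))" unfolding pm using assms by simp
  show "y = - (p * m) * ((1 - q) / ((1 + p) * (1 + m)))"
    unfolding x[symmetric] prod using assms by simp
qed

lemma asep_weights_params:
  assumes "asep_params \<alpha> \<beta> \<gamma> \<delta> q" "A = phi_plus q \<beta> \<delta>" "B = phi_minus q \<beta> \<delta>"
    "C = phi_plus q \<alpha> \<gamma>" "D = phi_minus q \<alpha> \<gamma>" "C > A" "C > 1"
  shows "asep_weights q A B C D"
    and "\<alpha> = asep_weights.\<alpha> q C D" "\<beta> = asep_weights.\<beta> q A B"
      "\<gamma> = asep_weights.\<gamma> q C D" "\<delta> = asep_weights.\<delta> q A B"
proof -
  have par: "0 < \<alpha>" "0 < \<beta>" "0 \<le> \<gamma>" "0 \<le> \<delta>" "0 \<le> q" "q < 1"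
    using assms(1) by (auto simp: asep_params_def)
  note 1 = phi_params[OF par(2,4,5,6), folded assms(2,3)]
  note 2 = phi_params[OF par(1,3,5,6), folded assms(4,5)]
  show w: "asep_weights q A B C D"
    by unfold_locales (rule par(5) par(6) 1(1-3) 2(2-3) assms(6,7))+
  show "\<alpha> = asep_weights.\<alpha> q C D" "\<beta> = asep_weights.\<beta> q A B"
    unfolding asep_weights.\<alpha>_def[OF w] asep_weights.\<beta>_def[OF w] by (fact 1 2)+
  show "\<gamma> = asep_weights.\<gamma> q C D" "\<delta> = asep_weights.\<delta> q A B"
    unfolding asep_weights.\<gamma>_def[OF w] asep_weights.\<delta>_def[OF w]
      asep_weights.\<alpha>_def[OF w] asep_weights.\<beta>_def[OF w] by (fact 1 2)+
qed

lemma asep_total_variation_bound: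
  assumes "asep_params \<alpha> \<beta> \<gamma> \<delta> q" "A = phi_plus q \<beta> \<delta>" "C = phi_plus q \<alpha> \<gamma>" "C > A" "C > 1"
  shows "0 < decay_rate A C q" "decay_rate A C q < 1"
    and "\<exists>M W. 1 \<le> M \<and> 1 \<le> W \<and> (\<forall>m n. 1 \<le> m \<longrightarrow> m \<le> n \<longrightarrow>
     d_TV m (marginal m (asep_measure \<alpha> \<beta> \<gamma> \<delta> q n)) (bernoulli_product m (1 / (1 + C)))
       \<le> M * W ^ m * decay_rate A C q ^ n)"
proof -
  define B D where "B = phi_minus q \<beta> \<delta>" and "D = phi_minus q \<alpha> \<gamma>"
  note w = asep_weights_params[OF assms(1,2) B_def assms(3) D_def assms(4,5)]
  show "0 < decay_rate A C q" "decay_rate A C q < 1"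
    by (rule asep_weights.decay_rate[OF w(1)])+
  show "\<exists>M W. 1 \<le> M \<and> 1 \<le> W \<and> (\<forall>m n. 1 \<le> m \<longrightarrow> m \<le> n \<longrightarrow>
     d_TV m (marginal m (asep_measure \<alpha> \<beta> \<gamma> \<delta> q n)) (bernoulli_product m (1 / (1 + C)))
       \<le> M * W ^ m * decay_rate A C q ^ n)"
    using asep_weights.total_variation_bound[OF w(1)] unfolding w(2-5)[symmetric] .
qed

text \<open>The constant has to be a function of \<open>A, B, C, D, q\<close>, whereas the bound
  supplies constants only after the rates are fixed. The rates are determined by these parameters,
  so the choice can be made with the rates written in terms of them.\<close>

definition tv_constant :: "real \<Rightarrow> real \<Rightarrow> real \<Rightarrow> real \<Rightarrow> real \<Rightarrow> real" where
  "tv_constant A B C D q = (SOME H. 0 < H \<and> (\<forall>m n. 1 \<le> m \<and> m \<le> n \<longrightarrow>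
     d_TV m (marginal m (asep_measure (asep_weights.\<alpha> q C D) (asep_weights.\<beta> q A B)
         (asep_weights.\<gamma> q C D) (asep_weights.\<delta> q A B) q n)) (bernoulli_product m (1 / (1 + C)))
       \<le> decay_rate A C q ^ n * (H * real m) ^ (3 * m)))"

lemma tv_constant:
  assumes "asep_params \<alpha> \<beta> \<gamma> \<delta> q" "A = phi_plus q \<beta> \<delta>" "B = phi_minus q \<beta> \<delta>"
    "C = phi_plus q \<alpha> \<gamma>" "D = phi_minus q \<alpha> \<gamma>" "C > A" "C > 1"
  shows "0 < tv_constant A B C D q"
    and "1 \<le> m \<Longrightarrow> m \<le> n \<Longrightarrow>
      d_TV m (marginal m (asep_measure \<alpha> \<beta> \<gamma> \<delta> q n)) (bernoulli_product m (1 / (1 + C)))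
        \<le> decay_rate A C q ^ n * (tv_constant A B C D q * real m) ^ (3 * m)"
proof -
  note bd = asep_total_variation_bound[OF assms(1,2,4,6,7)]
  obtain M W where MW: "1 \<le> M" "1 \<le> W" "\<And>m n. 1 \<le> m \<Longrightarrow> m \<le> n \<Longrightarrow>
     d_TV m (marginal m (asep_measure \<alpha> \<beta> \<gamma> \<delta> q n)) (bernoulli_product m (1 / (1 + C)))
       \<le> M * W ^ m * decay_rate A C q ^ n"
    using bd(3) by blast
  \<comment> \<open>The witness is \<open>M W\<close>: as \<open>M \<ge> 1\<close> and
    \<open>m \<ge> 1\<close>, \<open>M W^m \<le> (M W)^m\<close>, and a base at least
    \<open>1\<close> may be enlarged by \<open>m\<close> and raised to the power
    \<open>3 m\<close>.\<close>
  have "M * W ^ m * decay_rate A C q ^ n \<le> decay_rate A C q ^ n * (M * W * real m) ^ (3 * m)"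
    if "1 \<le> m" for m n
  proof -
    have "1 * 1 \<le> M * W" using MW by (intro mult_mono) auto
    then have "M * W * 1 \<le> M * W * real m" using that by (intro mult_left_mono) auto
    have "M * W ^ m \<le> M ^ m * W ^ m"
      using MW that self_le_power[of M m] by (intro mult_right_mono) auto
    also have "\<dots> = (M * W) ^ m" by (simp add: power_mult_distrib)
    also have "\<dots> \<le> (M * W * real m) ^ m"
      using \<open>1 * 1 \<le> M * W\<close> \<open>M * W * 1 \<le> M * W * real m\<close> by (intro power_mono) auto
    also have "\<dots> \<le> (M * W * real m) ^ (3 * m)"
      using \<open>1 * 1 \<le> M * W\<close> \<open>M * W * 1 \<le> M * W * real m\<close> by (intro power_increasing) auto
    finally have "(M * W ^ m) * decay_rate A C q ^ n \<le> (M * W * real m) ^ (3 * m) * decay_rate A C q ^ n"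
      using bd(1) by (intro mult_right_mono) auto
    then show ?thesis by (simp add: mult.commute)
  qed
  then have "0 < M * W \<and> (\<forall>m n. 1 \<le> m \<and> m \<le> n \<longrightarrow>
     d_TV m (marginal m (asep_measure \<alpha> \<beta> \<gamma> \<delta> q n)) (bernoulli_product m (1 / (1 + C)))
       \<le> decay_rate A C q ^ n * (M * W * real m) ^ (3 * m))"
    using MW(1,2) order_trans[OF MW(3)] by auto
  note ex = exI[of "\<lambda>H. 0 < H \<and> (\<forall>m n. 1 \<le> m \<and> m \<le> n \<longrightarrow>
     d_TV m (marginal m (asep_measure \<alpha> \<beta> \<gamma> \<delta> q n)) (bernoulli_product m (1 / (1 + C)))
       \<le> decay_rate A C q ^ n * (H * real m) ^ (3 * m))", OF this]
  note w = asep_weights_params[OF assms]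
  note H = someI_ex[OF ex, unfolded w(2-5), folded tv_constant_def, folded w(2-5)]
  show "0 < tv_constant A B C D q" using H by blast
  show "1 \<le> m \<Longrightarrow> m \<le> n \<Longrightarrow>
      d_TV m (marginal m (asep_measure \<alpha> \<beta> \<gamma> \<delta> q n)) (bernoulli_product m (1 / (1 + C)))
        \<le> decay_rate A C q ^ n * (tv_constant A B C D q * real m) ^ (3 * m)"
    using H by blast
qed

text \<open>Because \<open>ln n\<close> is unbounded, \<open>m_n ln W \<le> n ln W / ln n\<close> is
  eventually at most half of \<open>- n ln \<theta>\<close>, so the product still decays
  geometrically.\<close>

lemma sublinear_exponent_tendsto_0:
  fixes m :: "nat \<Rightarrow> nat" and \<theta> W :: real
  assumes "0 < \<theta>" "\<theta> < 1" "1 \<le> W"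
    and "eventually (\<lambda>n. real (m n) \<le> real n / ln (real n)) sequentially"
  shows "(\<lambda>n. W ^ m n * \<theta> ^ n) \<longlonglongrightarrow> 0"
proof -
  define t where "t = - ln \<theta>"
  have t: "0 < t" using assms by (simp add: t_def)
  have "filterlim (\<lambda>n. ln (real n)) at_top sequentially"
    by (rule filterlim_compose[OF ln_at_top filterlim_real_sequentially])
  then have "eventually (\<lambda>n. 2 * ln W / t + 1 \<le> ln (real n)) sequentially"
    by (simp add: filterlim_at_top)
  then have "eventually (\<lambda>n. norm (W ^ m n * \<theta> ^ n) \<le> exp (- t / 2) ^ n) sequentially"
    using assms(4)
  proof eventually_elim
    case (elim n)
    have lnW: "0 \<le> ln W" using assms by simp
    have L: "0 < ln (real n)" using elim lnW t by (smt (verit) divide_nonneg_pos mult_nonneg_nonneg)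
    have "real (m n) * ln W \<le> real n / ln (real n) * ln W"
      using elim lnW by (intro mult_right_mono) auto
    also have "\<dots> \<le> real n * (t / 2)"
    proof -
      have "2 * ln W / t \<le> ln (real n)" using elim by simp
      then have "ln W \<le> t / 2 * ln (real n)" using t by (simp add: field_simps)
      then have "ln W / ln (real n) \<le> t / 2" using L by (simp add: divide_le_eq)
      from mult_left_mono[OF this, of "real n"] show ?thesis by simp
    qed
    finally have "real (m n) * ln W + real n * ln \<theta> \<le> real n * (- t / 2)"
      by (simp add: t_def field_simps)
    then have "exp (real (m n) * ln W + real n * ln \<theta>) \<le> exp (real n * (- t / 2))" by simp
    moreover have "exp (real (m n) * ln W + real n * ln \<theta>) = W ^ m n * \<theta> ^ n"
      using assms by (simp add: exp_add exp_of_nat_mult)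
    moreover have "exp (real n * (- t / 2)) = exp (- t / 2) ^ n" by (rule exp_of_nat_mult)
    moreover have "0 \<le> W ^ m n * \<theta> ^ n" using assms by simp
    ultimately show ?case by (simp only: real_norm_def abs_of_nonneg)
  qed
  moreover have "(\<lambda>n. exp (- t / 2) ^ n) \<longlonglongrightarrow> 0"
    using t by (intro LIMSEQ_realpow_zero) auto
  ultimately show ?thesis by (rule Lim_null_comparison)
qed

lemma asep_tv_tendsto_0:
  assumes "asep_params \<alpha> \<beta> \<gamma> \<delta> q" "A = phi_plus q \<beta> \<delta>" "C = phi_plus q \<alpha> \<gamma>" "C > A" "C > 1"
    and "eventually (\<lambda>n. 1 \<le> m n \<and> m n \<le> n \<and> real (m n) \<le> real n / ln (real n)) sequentially"
  shows "(\<lambda>n. d_TV (m n) (marginal (m n) (asep_measure \<alpha> \<beta> \<gamma> \<delta> q n))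
            (bernoulli_product (m n) (1 / (1 + C)))) \<longlonglongrightarrow> 0"
proof -
  note bd = asep_total_variation_bound[OF assms(1-5)]
  let ?\<theta> = "decay_rate A C q"
  obtain M W where MW: "1 \<le> M" "1 \<le> W" "\<And>m n. 1 \<le> m \<Longrightarrow> m \<le> n \<Longrightarrow>
     d_TV m (marginal m (asep_measure \<alpha> \<beta> \<gamma> \<delta> q n)) (bernoulli_product m (1 / (1 + C)))
       \<le> M * W ^ m * ?\<theta> ^ n"
    using bd(3) by blast
  have "(\<lambda>n. W ^ m n * ?\<theta> ^ n) \<longlonglongrightarrow> 0"
    using assms(6) by (intro sublinear_exponent_tendsto_0 bd MW) (auto elim: eventually_mono)
  then have "(\<lambda>n. M * (W ^ m n * ?\<theta> ^ n)) \<longlonglongrightarrow> M * 0" by (intro tendsto_intros)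
  then have "(\<lambda>n. M * (W ^ m n * ?\<theta> ^ n)) \<longlonglongrightarrow> 0" by simp
  then show ?thesis
  proof (rule Lim_null_comparison[rotated])
    show "\<forall>\<^sub>F n in sequentially. norm (d_TV (m n) (marginal (m n) (asep_measure \<alpha> \<beta> \<gamma> \<delta> q n))
            (bernoulli_product (m n) (1 / (1 + C)))) \<le> M * (W ^ m n * ?\<theta> ^ n)"
      using assms(6)
      by eventually_elim (use MW(3) d_TV_nonneg in \<open>auto simp: mult.assoc\<close>)
  qed
qed

lemma asep_weak_convergence:
  assumes "asep_params \<alpha> \<beta> \<gamma> \<delta> q" "A = phi_plus q \<beta> \<delta>" "C = phi_plus q \<alpha> \<gamma>" "C > A" "C > 1"
  shows "weakly_converges (\<lambda>n. config_measure (asep_measure \<alpha> \<beta> \<gamma> \<delta> q n))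
          (bernoulli_measure (1 / (1 + C)))"
proof (rule weakly_converges_bernoulli)
  fix m :: nat assume m: "1 \<le> m"
  have "eventually (\<lambda>n. ln (real n) / real n < 1 / real m) sequentially"
    using lim_ln_over_n m by (intro order_tendstoD) auto
  then have "eventually (\<lambda>n. real m \<le> real n / ln (real n)) sequentially"
    using eventually_gt_at_top[of 1]
  proof eventually_elim
    case (elim n)
    then have "0 < ln (real n)" by simp
    with elim m show ?case by (simp add: field_simps)
  qed
  then show "(\<lambda>n. d_TV m (marginal m (asep_measure \<alpha> \<beta> \<gamma> \<delta> q n)) (bernoulli_product m (1 / (1 + C)))) \<longlonglongrightarrow> 0"
    by (intro asep_tv_tendsto_0[OF assms] eventually_conj)
      (use m eventually_ge_at_top in auto)
qed (use assms in auto)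

theorem theorem1p2:
  shows
   "(\<forall>\<alpha> \<beta> \<gamma> \<delta> q A C.
        asep_params \<alpha> \<beta> \<gamma> \<delta> q \<and>
        A = phi_plus q \<beta> \<delta> \<and> C = phi_plus q \<alpha> \<gamma> \<and> C > A \<and> C > 1 \<longrightarrow>
        weakly_converges (\<lambda>n. config_measure (asep_measure \<alpha> \<beta> \<gamma> \<delta> q n))
          (bernoulli_measure (1 / (1 + C))))
    \<and>
    (\<exists>(\<theta> :: real \<Rightarrow> real \<Rightarrow> real \<Rightarrow> real)
      (H :: real \<Rightarrow> real \<Rightarrow> real \<Rightarrow> real \<Rightarrow> real \<Rightarrow> real).
      \<forall>\<alpha> \<beta> \<gamma> \<delta> q A B C D.
        asep_params \<alpha> \<beta> \<gamma> \<delta> q \<and>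
        A = phi_plus q \<beta> \<delta> \<and> B = phi_minus q \<beta> \<delta> \<and>
        C = phi_plus q \<alpha> \<gamma> \<and> D = phi_minus q \<alpha> \<gamma> \<and> C > A \<and> C > 1 \<and>
        (A \<ge> 1 \<longrightarrow> A / C \<notin> {q ^ l | l :: nat. l \<ge> 1}) \<longrightarrow>
        H A B C D q > 0 \<and> 0 < \<theta> A C q \<and> \<theta> A C q < 1 \<and>
        (\<forall>m n. 1 \<le> m \<and> m \<le> n \<longrightarrow>
           d_TV m (marginal m (asep_measure \<alpha> \<beta> \<gamma> \<delta> q n)) (bernoulli_product m (1 / (1 + C)))
             \<le> \<theta> A C q ^ n * (H A B C D q * real m) ^ (3 * m)))
    \<and>
    (\<exists>s :: real \<Rightarrow> real \<Rightarrow> real \<Rightarrow> real.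
      \<forall>\<alpha> \<beta> \<gamma> \<delta> q A C.
        asep_params \<alpha> \<beta> \<gamma> \<delta> q \<and>
        A = phi_plus q \<beta> \<delta> \<and> C = phi_plus q \<alpha> \<gamma> \<and> C > A \<and> C > 1 \<and>
        (A \<ge> 1 \<longrightarrow> A / C \<notin> {q ^ l | l :: nat. l \<ge> 1}) \<longrightarrow>
        s A C q > 0 \<and>
        (\<forall>m :: nat \<Rightarrow> nat.
           (\<forall>n\<ge>1. 1 \<le> m n \<and> m n \<le> n) \<and>
           (\<forall>\<^sub>F n in sequentially. real (m n) \<le> s A C q * (real n / ln (real n))) \<longrightarrow>
           (\<lambda>n. d_TV (m n) (marginal (m n) (asep_measure \<alpha> \<beta> \<gamma> \<delta> q n))
                  (bernoulli_product (m n) (1 / (1 + C)))) \<longlonglongrightarrow> 0))"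
proof (rule conjI[OF _ conjI], goal_cases)
  case 1
  show ?case by (blast intro: asep_weak_convergence)
next
  case 2
  show ?case
  proof (rule exI[of _ decay_rate], rule exI[of _ tv_constant], intro allI impI, elim conjE)
    fix \<alpha> \<beta> \<gamma> \<delta> q A B C D :: real
    assume *: "asep_params \<alpha> \<beta> \<gamma> \<delta> q" "A = phi_plus q \<beta> \<delta>" "B = phi_minus q \<beta> \<delta>"
      "C = phi_plus q \<alpha> \<gamma>" "D = phi_minus q \<alpha> \<gamma>" "C > A" "C > 1"
    show "tv_constant A B C D q > 0 \<and> 0 < decay_rate A C q \<and> decay_rate A C q < 1 \<and>
        (\<forall>m n. 1 \<le> m \<and> m \<le> n \<longrightarrow>
           d_TV m (marginal m (asep_measure \<alpha> \<beta> \<gamma> \<delta> q n)) (bernoulli_product m (1 / (1 + C)))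
             \<le> decay_rate A C q ^ n * (tv_constant A B C D q * real m) ^ (3 * m))"
      using tv_constant[OF *] asep_total_variation_bound(1,2)[OF *(1,2,4,6,7)] by blast
  qed
next
  case 3
  \<comment> \<open>The estimate behind this part is exponential in \<open>m\<close>, so
    \<open>m_n \<le> n / ln n\<close> already makes its prefactor subexponential in
    \<open>n\<close>; the constant \<open>1\<close> serves as \<open>s\<close>.\<close>
  show ?case
  proof (rule exI[of _ "\<lambda>_ _ _. 1"], intro allI impI, elim conjE, intro conjI allI impI, simp, elim conjE)
    fix \<alpha> \<beta> \<gamma> \<delta> q A C :: real and m :: "nat \<Rightarrow> nat"
    assume *: "asep_params \<alpha> \<beta> \<gamma> \<delta> q" "A = phi_plus q \<beta> \<delta>" "C = phi_plus q \<alpha> \<gamma>" "C > A" "C > 1"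
      and m: "\<forall>n\<ge>1. 1 \<le> m n \<and> m n \<le> n" "\<forall>\<^sub>F n in sequentially. real (m n) \<le> 1 * (real n / ln (real n))"
    show "(\<lambda>n. d_TV (m n) (marginal (m n) (asep_measure \<alpha> \<beta> \<gamma> \<delta> q n))
                  (bernoulli_product (m n) (1 / (1 + C)))) \<longlonglongrightarrow> 0"
    proof (rule asep_tv_tendsto_0[OF *])
      show "\<forall>\<^sub>F n in sequentially. 1 \<le> m n \<and> m n \<le> n \<and> real (m n) \<le> real n / ln (real n)"
        using m(2) eventually_ge_at_top[of 1] by eventually_elim (use m(1) in auto)
    qed
  qed
qed

end
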